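(* Let $T=\sum_{k=M}^N Q_k(z)D^k$, with $Q_k\in\mathbb{R}[z]$ and $Q_MQ_N\not\equiv 0$, be a non-degenerate hyperbolicity preserver with nonnegative Fuchs index $r$, let $n\ge M$ be an integer, and let $A\in\binom{[n+r]}{r}$. Then $$v_{A,n+1}\ll v_{A,n}\ll v_{A+\mathbf{1},n+1},$$ where $A+\mathbf{1}:=\{a+1:a\in A\}$. Moreover, if there is no $\theta\in\mathbb{R}$ for which $Q_1(\theta)=\cdots=Q_n(\theta)=0$, then the interlacing of the zeros (of $v_{A,n+1}$ and $v_{A,n}$, and of $v_{A,n}$ and $v_{A+\mathbf{1},n+1}$) is strict.
   Context: $D=d/dz$, $[m]=\{1,\dots,m\}$, $\binom{[m]}{s}$ is the set of $s$-element subsets of $[m]$, and $Q_k\equiv 0$ for $k<M$ or $k>N$. A nonzero polynomial in $\mathbb{R}[z]$ is hyperbolic if all its zeros are real. A linear operator $T:\mathbb{R}[z]\to\mathbb{R}[z]$ preserves hyperbolicity (is a hyperbolicity preserver) if $T(f)$ is hyperbolic or identically zero whenever $f$ is hyperbolic. The Fuchs index of $T$ is $r=\max_k(\deg Q_k-k)$ (over $k$ with $Q_k\not\equiv0$); $T$ is non-degenerate if $\deg Q_N=N+r$. Proper position of polynomials: the zeros $\alpha_1\le\cdots\le\alpha_p$ of $f$ and $\beta_1\le\cdots\le\beta_q$ of $g$ (hyperbolic, zeros with multiplicity) interlace if $\alpha_1\le\beta_1\le\alpha_2\le\beta_2\le\cdots$ or $\beta_1\le\alpha_1\le\beta_2\le\alpha_2\le\cdots$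 (so $|p-q|\le1$; zeros of any two polynomials of degree $0$ or $1$ interlace). Write $f\ll g$ if the zeros of $f$ and $g$ interlace and $f'g-fg'\le 0$ on all of $\mathbb{R}$. Interlacing is strict if moreover $f$ and $g$ are co-prime. The polynomials $f_{B,n}$, $v_{A,n}$ (for any integer $n\ge M$; used here for both $n$ and $n+1$): a pair $(v,f)$ of hyperbolic polynomials of degrees $r$ and $n$ has zero pattern $(A,B)$, where $A\cup B=[n+r]$ is a disjoint union with $|A|=r$, $|B|=n$, if, with $\alpha_1\le\cdots\le\alpha_{n+r}$ the zeros of $vf$, the zeros of $v$ are $\{\alpha_i:i\in A\}$ and those of $f$ are $\{\alpha_i:i\in B\}$ (as multisets). Given $A\in\binom{[n+r]}{r}$ and $B=[n+r]\setminus A$, let $a$ be the smallest zero of $Q_e$, $e=\min(n,N)$, put $f_0=(z-a)^n$, and recursively let $T(f_i)=v_{i+1}f_{i+1}$ be the unique factorization with $f_{i+1}$ monic and $(v_{i+1},f_{i+1})$ of zero pattern $(A,B)$. It is known that the limits $f_{B,n}:=\lim_i f_i$ and $v_{A,n}:=\lim_i v_i$ exist, that $T(f_{B,n})=v_{A,n}f_{B,n}$ with $f_{B,n}$ monic of degree $n$, and that $(v_{A,n},f_{B,n})$ has zero pattern $(A,B)$. *)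

theory Defs
  imports "HOL-Analysis.Analysis" "HOL-Computational_Algebra.Computational_Algebra"
begin

definition hyperbolic :: "real poly \<Rightarrow> bool" where
  "hyperbolic p \<longleftrightarrow>
     p \<noteq> 0 \<and> (\<forall>z::complex. poly (map_poly complex_of_real p) z = 0 \<longrightarrow> z \<in> \<real>)"

text \<open>The list of real zeros of a nonzero polynomial, repeated according to multiplicity, in
  non-decreasing order.\<close>

definition zeros_list :: "real poly \<Rightarrow> real list" where
  "zeros_list p = sorted_list_of_multiset (proots p)"

definition diff_op :: "(nat \<Rightarrow> real poly) \<Rightarrow> nat \<Rightarrow> nat \<Rightarrow> real poly \<Rightarrow> real poly" where
  "diff_op Q M N f = (\<Sum>k=M..N. Q k * (pderiv ^^ k) f)"

definition hyperbolicity_preserver :: "(real poly \<Rightarrow> real poly) \<Rightarrow> bool" where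
  "hyperbolicity_preserver T \<longleftrightarrow> (\<forall>f. hyperbolic f \<longrightarrow> hyperbolic (T f) \<or> T f = 0)"

text \<open>The maximum is meaningful only for finitely many (and at least one) nonzero \<open>Q k\<close>.\<close>

definition fuchs_index :: "(nat \<Rightarrow> real poly) \<Rightarrow> int" where
  "fuchs_index Q = Max {int (degree (Q k)) - int k | k. Q k \<noteq> 0}"

definition nondegenerate :: "(nat \<Rightarrow> real poly) \<Rightarrow> nat \<Rightarrow> bool" where
  "nondegenerate Q N \<longleftrightarrow> int (degree (Q N)) = int N + fuchs_index Q"

text \<open>\<open>alternating xs ys\<close> is the full chain
  \<open>xs!0 \<le> ys!0 \<le> xs!1 \<le> ys!1 \<le> \<dots>\<close>, which has to use up both lists.\<close>

definition alternating :: "real list \<Rightarrow> real list \<Rightarrow> bool" where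
  "alternating xs ys \<longleftrightarrow>
     (length xs = length ys \<or> length xs = length ys + 1) \<and>
     (\<forall>i < length ys. xs ! i \<le> ys ! i) \<and>
     (\<forall>i. i + 1 < length xs \<longrightarrow> ys ! i \<le> xs ! (i + 1))"

definition interlacing :: "real poly \<Rightarrow> real poly \<Rightarrow> bool" where
  "interlacing f g \<longleftrightarrow> hyperbolic f \<and> hyperbolic g \<and>
     (alternating (zeros_list f) (zeros_list g) \<or> alternating (zeros_list g) (zeros_list f))"

definition strictly_interlacing :: "real poly \<Rightarrow> real poly \<Rightarrow> bool" where
  "strictly_interlacing f g \<longleftrightarrow> interlacing f g \<and> coprime f g"

definition proper_position :: "real poly \<Rightarrow> real poly \<Rightarrow> bool"  (infix "\<lless>" 50) where
  "f \<lless> g \<longleftrightarrow>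
     interlacing f g \<and> (\<forall>x. poly (pderiv f * g - f * pderiv g) x \<le> 0)"

text \<open>The index sets are subsets of \<open>{1..n+r}\<close>, whereas list positions start at \<open>0\<close>.\<close>

definition zero_pattern :: "nat set \<Rightarrow> nat set \<Rightarrow> real poly \<Rightarrow> real poly \<Rightarrow> bool" where
  "zero_pattern A B v f \<longleftrightarrow>
     A \<inter> B = {} \<and> A \<union> B = {1..degree f + degree v} \<and>
     card A = degree v \<and> card B = degree f \<and>
     hyperbolic v \<and> hyperbolic f \<and>
     proots v = image_mset (\<lambda>i. zeros_list (v * f) ! (i - 1)) (mset_set A) \<and>
     proots f = image_mset (\<lambda>i. zeros_list (v * f) ! (i - 1)) (mset_set B)"

definition pattern_factors :: "nat set \<Rightarrow> nat set \<Rightarrow> real poly \<Rightarrow> real poly \<times> real poly" where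
  "pattern_factors A B g =
     (THE (v, f). g = v * f \<and> lead_coeff f = 1 \<and> zero_pattern A B v f)"

text \<open>If \<open>N = 0\<close> and \<open>Q 0\<close> is constant then \<open>Q e\<close> has no zero and \<open>start_zero\<close> is an unspecified real number;
  in this case the operator is multiplication by a constant, and every monic hyperbolic polynomial is a fixed
  point of the iteration below. In the other case without zeros, \<open>e = n = 0\<close>, the initial
  polynomial is \<open>1\<close> whatever the value of \<open>start_zero\<close>.\<close>

definition start_zero :: "(nat \<Rightarrow> real poly) \<Rightarrow> nat \<Rightarrow> nat \<Rightarrow> real" where
  "start_zero Q N n = Min {x. poly (Q (min n N)) x = 0}"

primrec f_iter ::
  "(nat \<Rightarrow> real poly) \<Rightarrow> nat \<Rightarrow> nat \<Rightarrow> nat set \<Rightarrow> nat set \<Rightarrow> nat \<Rightarrow> nat \<Rightarrow> real poly" where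
  "f_iter Q M N A B n 0 = [:- start_zero Q N n, 1:] ^ n"
| "f_iter Q M N A B n (Suc i) = snd (pattern_factors A B (diff_op Q M N (f_iter Q M N A B n i)))"

text \<open>\<open>v_iter \<dots> i\<close> is the cofactor arising together with \<open>f_iter \<dots> (Suc i)\<close>.\<close>

definition v_iter ::
  "(nat \<Rightarrow> real poly) \<Rightarrow> nat \<Rightarrow> nat \<Rightarrow> nat set \<Rightarrow> nat set \<Rightarrow> nat \<Rightarrow> nat \<Rightarrow> real poly" where
  "v_iter Q M N A B n i = fst (pattern_factors A B (diff_op Q M N (f_iter Q M N A B n i)))"

text \<open>Coefficientwise limit, that is, the limit in the finite-dimensional space of polynomials of
  bounded degree when the degrees of the \<open>X i\<close> are bounded.\<close>

definition poly_lim :: "(nat \<Rightarrow> real poly) \<Rightarrow> real poly" where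
  "poly_lim X = (THE p. \<forall>k. (\<lambda>i. coeff (X i) k) \<longlonglongrightarrow> coeff p k)"

definition v_pattern :: "(nat \<Rightarrow> real poly) \<Rightarrow> nat \<Rightarrow> nat \<Rightarrow> nat set \<Rightarrow> nat \<Rightarrow> real poly" where
  "v_pattern Q M N A n = poly_lim (v_iter Q M N A ({1..n + card A} - A) n)"

end

theory Submission
  imports Defs
begin

text \<open>
  Call \<open>p, q\<close> a pencil if all their real linear combinations are hyperbolic or zero. A hyperbolicity
  preserver \<open>T\<close> maps pencils to pencils, and in a pencil the zeros of \<open>p\<close> and \<open>q\<close> separate each other.
  Applied to \<open>(z - a) h\<close> and \<open>h\<close>, this shows that \<open>T\<close> moves all zeros to the right if one zero of its
  argument moves to the right, provided the leading coefficients \<open>\<gamma> j\<close> of \<open>T z\<^sup>j\<close> have one sign; this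
  follows from their log-concavity and from the fact that \<open>\<gamma> j\<close> is a polynomial in \<open>j\<close>. Hence the iterates
  \<open>f\<^sub>i\<close> increase and converge. The relation \<open>\<alpha>\<^sub>j \<le> \<beta>\<^sub>j \<le> \<alpha>\<^sub>j\<^sub>+\<^sub>1\<close> between the zeros of the iterates for
  \<open>n + 1\<close> and \<open>n\<close> is preserved by \<open>T\<close> and by the selection of the positions \<open>B\<close>, and it passes to the
  positions \<open>A\<close> and to the limit; this gives the interlacing.

  For strictness, the polynomial \<open>\<Sum>\<^sub>k Q\<^sub>k(\<theta>) w\<^sup>k\<close> is real-rooted for every \<open>\<theta>\<close>, so that \<open>f \<mapsto> (T f)(\<theta>)\<close> is a
  composition of factors \<open>D - \<lambda>\<close> evaluated at \<open>\<theta>\<close>. If the images of an interlacing pair both vanish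
  at \<open>\<theta>\<close>, then peeling off these factors shows that the pair itself has a common zero at \<open>\<theta>\<close>, which
  is impossible for the limits \<open>f\<close>, since \<open>T\<close> does not increase the multiplicity of a zero.
\<close>

subsection \<open>Hyperbolic polynomials and pencils\<close>

text \<open>The pencil formulation is chosen because a linear map with hyperbolic or zero images
  passes it on without any knowledge of the zeros; their positions are recovered afterwards from one
  local fact, \<open>pencil_double_zero\<close>, and from Wronskians. The assumptions speak of
  \<open>T\<close> only as a map, whereas the iteration starts at a zero of a single coefficient of
  \<open>T\<close>. This gap is closed by the commutator of \<open>T\<close> with multiplication by
  z: it is an operator of the same kind, with coefficients (k + 1) \<open>Q (k + 1)\<close>, order N
  - 1 and Fuchs index r + 1. Statements about \<open>Q k\<close> thereby reduce to statements about
  \<open>Q 0 = T 1\<close>. That the commutator preserves hyperbolicity rests on the monotonicity of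
  \<open>\<gamma>\<close>, and this is where non-degeneracy enters: it gives the polynomial
  \<open>\<Gamma>\<close> behind \<open>\<gamma>\<close> the leading coefficient
  \<open>\<sigma> \<noteq> 0\<close>. A further obstacle is that for n < N the iterations for n and
  n + 1 start at different points, so that they can be compared step by step only after the limits
  are known not to depend on the start.\<close>

definition cpoly :: "real poly \<Rightarrow> complex \<Rightarrow> complex" where
  "cpoly p z = poly (map_poly complex_of_real p) z"

lemma cpoly_pCons [simp]: "cpoly (pCons a p) z = of_real a + z * cpoly p z"
  by (simp add: cpoly_def map_poly_pCons)

lemma cpoly_0 [simp]: "cpoly 0 z = 0" and cpoly_1 [simp]: "cpoly 1 z = 1"
  by (simp_all add: cpoly_def)

lemma cpoly_add [simp]: "cpoly (p + q) z = cpoly p z + cpoly q z"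
proof -
  have "map_poly complex_of_real (p + q) = map_poly of_real p + map_poly of_real q"
    by (intro poly_eqI) (simp add: coeff_map_poly)
  then show ?thesis by (simp add: cpoly_def)
qed

lemma cpoly_smult [simp]: "cpoly (smult c p) z = of_real c * cpoly p z"
  by (induction p) (auto simp: algebra_simps)

lemma cpoly_minus [simp]: "cpoly (- p) z = - cpoly p z"
  using cpoly_smult[of "-1" p z] by simp

lemma cpoly_diff [simp]: "cpoly (p - q) z = cpoly p z - cpoly q z"
  using cpoly_add[of p "- q" z] by simp

lemma cpoly_mult [simp]: "cpoly (p * q) z = cpoly p z * cpoly q z"
  by (induction p) (auto simp: algebra_simps)

lemma cpoly_power [simp]: "cpoly (p ^ n) z = cpoly p z ^ n"
  by (induction n) auto

lemma cpoly_sum [simp]: "cpoly (sum f A) z = (\<Sum>x\<in>A. cpoly (f x) z)"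
  by (induction A rule: infinite_finite_induct) auto

lemma cpoly_of_real [simp]: "cpoly p (of_real x) = of_real (poly p x)"
  by (induction p) auto

lemma hyperbolicD: "hyperbolic p \<Longrightarrow> cpoly p z = 0 \<Longrightarrow> Im z = 0"
  by (auto simp: hyperbolic_def cpoly_def complex_is_Real_iff)

lemma hyperbolicI: "p \<noteq> 0 \<Longrightarrow> (\<And>z. Im z \<noteq> 0 \<Longrightarrow> cpoly p z \<noteq> 0) \<Longrightarrow> hyperbolic p"
  by (auto simp: hyperbolic_def cpoly_def complex_is_Real_iff)

lemma hyperbolic_nz: "hyperbolic p \<Longrightarrow> p \<noteq> 0"
  by (simp add: hyperbolic_def)

lemma hyperbolic_mult_iff: "hyperbolic (p * q) \<longleftrightarrow> hyperbolic p \<and> hyperbolic q"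
  unfolding hyperbolic_def cpoly_def[symmetric] by auto

text \<open>Unfolding these products would destroy the linear factors \<open>[:- c, 1:] * p\<close>
  on which all inductions over zeros operate.\<close>

declare mult_pCons_left [simp del] mult_pCons_right [simp del]

lemma hyperbolic_linear [simp]: "hyperbolic [:c, 1:]"
  by (intro hyperbolicI) (auto simp: complex_eq_iff)

lemma hyperbolic_const [simp]: "hyperbolic [:c:] \<longleftrightarrow> c \<noteq> 0"
  by (auto simp: hyperbolic_def map_poly_pCons)

lemma hyperbolic_1 [simp]: "hyperbolic 1"
  by (simp add: one_pCons)

lemma hyperbolic_smult_iff: "hyperbolic (smult c p) \<longleftrightarrow> c \<noteq> 0 \<and> hyperbolic p"
  using hyperbolic_mult_iff[of "[:c:]" p] by (simp add: mult_pCons_left)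

lemma hyperbolic_power: "hyperbolic p \<Longrightarrow> hyperbolic (p ^ n)"
  by (induction n) (auto simp: hyperbolic_mult_iff)

lemma poly_linear_mult: "poly ([:- c, 1:] * p) x = (x - c) * poly p (x :: real)"
  by (simp add: algebra_simps)

lemma hyperbolic_real_root:
  assumes "hyperbolic p" "degree p > 0"
  shows "\<exists>x. poly p x = 0"
proof -
  let ?q = "map_poly complex_of_real p"
  have "degree ?q = degree p"
    by (rule degree_map_poly) auto
  then have "\<not> constant (poly ?q)" using assms by (simp add: constant_degree)
  then obtain z where z: "poly ?q z = 0" using fundamental_theorem_of_algebra by blast
  then have "Im z = 0" using assms(1) by (intro hyperbolicD) (auto simp: cpoly_def)
  then have "z = of_real (Re z)" by (simp add: complex_eq_iff)
  then have "cpoly p (of_real (Re z)) = 0" using z by (simp add: cpoly_def)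
  then show ?thesis by (auto simp del: of_real_Re)
qed

text \<open>By the fundamental theorem of algebra a nonconstant hyperbolic polynomial has a real
  zero, and the cofactor is hyperbolic again.\<close>

lemma hyperbolic_induct [consumes 1, case_names const linear]:
  assumes "hyperbolic p"
    and "\<And>c. c \<noteq> 0 \<Longrightarrow> P [:c:]"
    and "\<And>c p. hyperbolic p \<Longrightarrow> P p \<Longrightarrow> P ([:- c, 1:] * p)"
  shows "P p"
  using assms(1)
proof (induction "degree p" arbitrary: p)
  case 0
  then obtain c where "p = [:c:]" using degree_eq_zeroE by metis
  with 0 show ?case using assms(2) by auto
next
  case (Suc n)
  obtain x where "poly p x = 0" using hyperbolic_real_root[of p] Suc by auto
  then obtain q where q: "p = [:- x, 1:] * q" by (auto simp: poly_eq_0_iff_dvd)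
  then have hq: "hyperbolic q" using Suc hyperbolic_mult_iff by blast
  have "degree p = Suc (degree q)" unfolding q
    using hyperbolic_nz[OF hq] by (subst degree_mult_eq) auto
  then have "P q" using Suc hq by auto
  then show ?case unfolding q using assms(3) hq by blast
qed

lemma hyperbolic_size: "hyperbolic p \<Longrightarrow> size (proots p) = degree p"
proof (induction rule: hyperbolic_induct)
  case (linear c p)
  then have "p \<noteq> 0" by (simp add: hyperbolic_nz)
  then show ?case using linear by (subst degree_mult_eq; simp add: proots_mult)
qed auto

text \<open>One zero may be missing from the count, as happens in separation arguments: once all
  real zeros are divided out, the cofactor has degree at most one, and a real polynomial of degree
  one has a real zero.\<close>

lemma hyperbolicI_card_zeros:
  assumes "p \<noteq> 0" "degree p \<le> size (proots p) + 1"
  shows "hyperbolic p"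
  using assms
proof (induction "degree p" arbitrary: p rule: less_induct)
  case less
  show ?case
  proof (cases "\<exists>x. poly p x = 0")
    case True
    then obtain x q where q: "p = [:- x, 1:] * q" by (auto simp: poly_eq_0_iff_dvd)
    then have nz: "q \<noteq> 0" using less by auto
    have dp: "degree p = Suc (degree q)" unfolding q
      using nz by (subst degree_mult_eq) auto
    have "size (proots p) = Suc (size (proots q))" unfolding q
      using nz by (subst proots_mult) auto
    then have "hyperbolic q" using less dp nz by auto
    then show ?thesis unfolding q hyperbolic_mult_iff by simp
  next
    case False
    then have "proots p = {#}" using less by (metis (mono_tags) Collect_empty_eq set_count_proots set_mset_eq_empty_iff)
    then have "degree p \<le> 1" using less by simp
    moreover have "degree p \<noteq> 1"
    proof
      assume "degree p = 1"
      then obtain a b where ab: "p = [:a, b:]" using degree1_coeffs[of p] by blast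
      then have "b \<noteq> 0" using \<open>degree p = 1\<close> by auto
      then have "poly p (- a / b) = 0" by (simp add: ab)
      then show False using False by blast
    qed
    ultimately have "degree p = 0" by simp
    then obtain c where "p = [:c:]" using degree_eq_zeroE by metis
    then show ?thesis using less by auto
  qed
qed

text \<open>The zero polynomial is admitted because linear combinations and images under \<open>T\<close> may vanish.\<close>
definition hyp0 :: "real poly \<Rightarrow> bool" where
  "hyp0 p \<longleftrightarrow> p = 0 \<or> hyperbolic p"

text \<open>By the Hermite-Kakeya-Obreschkoff theorem this amounts, up to degenerate cases, to
  interlacing zeros. In this form it passes through every linear map that respects
  \<open>hyp0\<close>, without reference to degrees or to the order of the zeros.\<close>

definition pencil :: "real poly \<Rightarrow> real poly \<Rightarrow> bool" where
  "pencil p q \<longleftrightarrow> (\<forall>a b. hyp0 (smult a p + smult b q))"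

lemma hyp0_mult_iff: "hyperbolic h \<Longrightarrow> hyp0 (h * p) \<longleftrightarrow> hyp0 p"
  by (auto simp: hyp0_def hyperbolic_mult_iff dest: hyperbolic_nz)

lemma pencilD: "pencil p q \<Longrightarrow> hyp0 (smult a p + smult b q)"
  by (simp add: pencil_def)

lemma pencil_left: "pencil p q \<Longrightarrow> hyp0 p"
  using pencilD[of p q 1 0] by simp

lemma pencil_sym: "pencil p q \<Longrightarrow> pencil q p"
  unfolding pencil_def by (metis add.commute)

lemma pencil_right: "pencil p q \<Longrightarrow> hyp0 q"
  using pencil_left pencil_sym by blast

lemma pencil_comb:
  assumes "pencil p q"
  shows "pencil (smult a p + smult b q) (smult c p + smult d q)"
  unfolding pencil_def
proof safe
  fix s t
  have "smult s (smult a p + smult b q) + smult t (smult c p + smult d q) =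
        smult (s * a + t * c) p + smult (s * b + t * d) q"
    by (simp add: algebra_simps smult_add_left smult_add_right)
  then show "hyp0 (smult s (smult a p + smult b q) + smult t (smult c p + smult d q))"
    using assms by (simp add: pencilD)
qed

lemma pencil_mult_iff: "hyperbolic h \<Longrightarrow> pencil (h * p) (h * q) \<longleftrightarrow> pencil p q"
proof -
  assume h: "hyperbolic h"
  have "smult a (h * p) + smult b (h * q) = h * (smult a p + smult b q)" for a b
    by (simp add: algebra_simps)
  then show ?thesis unfolding pencil_def using h hyp0_mult_iff[of h] by metis
qed

lemma pencil_linear: "hyperbolic h \<Longrightarrow> pencil ([:c, 1:] * h) h"
proof -
  assume h: "hyperbolic h"
  have "pencil [:c, 1:] 1" unfolding pencil_def
  proof safe
    fix a b
    have "smult a [:c, 1:] + smult b 1 = [:a * c + b, a:]" by (simp add: one_pCons)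
    moreover have "hyp0 [:u, a:]" for u
    proof (cases "a = 0")
      case False
      then have "[:u, a:] = smult a [:u / a, 1:]" by simp
      then show ?thesis unfolding hyp0_def using False by (metis hyperbolic_smult_iff hyperbolic_linear)
    qed (auto simp: hyp0_def)
    ultimately show "hyp0 (smult a [:c, 1:] + smult b 1)" by simp
  qed
  then show ?thesis using pencil_mult_iff[OF h, of "[:c, 1:]" 1] by (simp add: mult.commute)
qed

subsection \<open>Laguerre's inequality\<close>

lemma pderiv_linear_mult: "pderiv ([:- c, 1:] * p) = [:- c, 1:] * pderiv p + (p :: real poly)"
  unfolding pderiv_mult by (simp add: pderiv_pCons)

text \<open>The expression p'^2 - p p'' equals -p^2 (log p)'', and the factor z - c adds 1 / (x -
  c)^2 to -(log p)''.\<close>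

lemma laguerre_linear_mult:
  fixes p :: "real poly" and c :: real
  defines "q \<equiv> [:- c, 1:] * p"
  shows "poly (pderiv q) x ^ 2 - poly q x * poly (pderiv (pderiv q)) x
     = poly p x ^ 2 + (x - c)^2 * (poly (pderiv p) x ^ 2 - poly p x * poly (pderiv (pderiv p)) x)"
proof -
  have "poly q x = (x - c) * poly p x" by (simp add: q_def algebra_simps)
  moreover have "poly (pderiv q) x = (x - c) * poly (pderiv p) x + poly p x"
    unfolding q_def pderiv_linear_mult poly_add poly_mult by simp
  moreover have "poly (pderiv (pderiv q)) x = (x - c) * poly (pderiv (pderiv p)) x + 2 * poly (pderiv p) x"
    unfolding q_def pderiv_linear_mult pderiv_add poly_add poly_mult by simp
  ultimately show ?thesis by (simp only:) (simp add: algebra_simps power2_eq_square)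
qed

lemma laguerre_nonneg:
  "hyperbolic p \<Longrightarrow> poly (pderiv p) x ^ 2 - poly p x * poly (pderiv (pderiv p)) x \<ge> 0"
proof (induction rule: hyperbolic_induct)
  case (linear c p)
  have "poly (pderiv ([:- c, 1:] * p)) x ^ 2 - poly ([:- c, 1:] * p) x * poly (pderiv (pderiv ([:- c, 1:] * p))) x
     = poly p x ^ 2 + (x - c)^2 * (poly (pderiv p) x ^ 2 - poly p x * poly (pderiv (pderiv p)) x)"
    by (rule laguerre_linear_mult)
  then show ?case using linear by simp
qed auto

text \<open>The left-hand side of the hypothesis is \<open>p(x)\<^sup>2\<close> times the sum of \<open>1 / (x - c)\<^sup>2\<close> over all zeros
  \<open>c\<close>, so that it keeps all zeros away from \<open>x\<close>.\<close>
lemma laguerre_bound: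
  assumes "hyperbolic p" "poly p x \<noteq> 0" "K \<ge> 0"
    and "poly (pderiv p) x ^ 2 - poly p x * poly (pderiv (pderiv p)) x \<le> K\<^sup>2 * poly p x ^ 2"
  shows "\<bar>poly p t\<bar> \<le> \<bar>poly p x\<bar> * (1 + K * \<bar>t - x\<bar>) ^ degree p"
  using assms(1,2,4)
proof (induction rule: hyperbolic_induct)
  case (linear c p)
  let ?L = "poly (pderiv p) x ^ 2 - poly p x * poly (pderiv (pderiv p)) x"
  have eq: "poly (pderiv ([:- c, 1:] * p)) x ^ 2 - poly ([:- c, 1:] * p) x * poly (pderiv (pderiv ([:- c, 1:] * p))) x
     = poly p x ^ 2 + (x - c)^2 * ?L"
    by (rule laguerre_linear_mult)
  have px: "poly p x \<noteq> 0" and xc: "x \<noteq> c" using linear by auto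
  have le: "poly p x ^ 2 + (x - c)^2 * ?L \<le> K\<^sup>2 * ((x - c)^2 * poly p x ^ 2)"
    using linear.prems(2) unfolding eq by (simp add: power_mult_distrib[symmetric] algebra_simps)
  have L0: "?L \<ge> 0" using laguerre_nonneg linear by blast
  \<comment> \<open>Both summands on the left of \<open>le\<close> are nonnegative. Dropping the
    \<open>?L\<close> term keeps the split-off zero away from \<open>x\<close>, namely
    \<open>1 \<le> K * \<bar>x - c\<bar>\<close>; dropping the square gives the hypothesis for the
    smaller \<open>p\<close>.\<close>
  have "poly p x ^ 2 * 1 \<le> poly p x ^ 2 * (K * (x - c))\<^sup>2"
  proof -
    have "0 \<le> (x - c)^2 * ?L" using L0 by simp
    then have "poly p x ^ 2 \<le> K\<^sup>2 * ((x - c)^2 * poly p x ^ 2)" using le by linarith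
    then show ?thesis by (simp add: power_mult_distrib mult_ac)
  qed
  then have "1\<^sup>2 \<le> \<bar>K * (x - c)\<bar>\<^sup>2" using px by simp
  then have 1: "1 \<le> K * \<bar>x - c\<bar>" using assms(3) power2_le_imp_le[of 1 "\<bar>K * (x - c)\<bar>"] by (simp add: abs_mult)
  have "(x - c)^2 * ?L \<le> (x - c)^2 * (K\<^sup>2 * poly p x ^ 2)"
    using le zero_le_power2[of "poly p x"] unfolding mult.left_commute[of "(x - c)^2" "K\<^sup>2"] by linarith
  then have "?L \<le> K\<^sup>2 * poly p x ^ 2" using xc by simp
  then have IH: "\<bar>poly p t\<bar> \<le> \<bar>poly p x\<bar> * (1 + K * \<bar>t - x\<bar>) ^ degree p"
    using linear.IH px by blast
  have "\<bar>t - c\<bar> \<le> \<bar>t - x\<bar> * 1 + \<bar>x - c\<bar>" by simp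
  also have "\<dots> \<le> \<bar>t - x\<bar> * (K * \<bar>x - c\<bar>) + \<bar>x - c\<bar>" using 1 by (intro add_right_mono mult_left_mono) auto
  also have "\<dots> = \<bar>x - c\<bar> * (1 + K * \<bar>t - x\<bar>)" by (simp add: algebra_simps)
  finally have "\<bar>t - c\<bar> * \<bar>poly p t\<bar> \<le> (\<bar>x - c\<bar> * (1 + K * \<bar>t - x\<bar>)) * (\<bar>poly p x\<bar> * (1 + K * \<bar>t - x\<bar>) ^ degree p)"
    using IH by (intro mult_mono) (auto simp: assms(3))
  moreover have "degree ([:- c, 1:] * p) = Suc (degree p)"
    using linear hyperbolic_nz by (subst degree_mult_eq) auto
  ultimately show ?case unfolding poly_linear_mult abs_mult by (simp only: power_Suc mult_ac)
qed auto

text \<open>If \<open>u\<close> did not vanish at the double zero \<open>x\<close> of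
  \<open>h\<close>, then \<open>h + s e u\<close> would have a value of order e at \<open>x\<close>,
  while its Laguerre expression there is at most K^2 times the square of this value, with K
  independent of e. By \<open>laguerre_bound\<close> it is then of order e everywhere, and e tending
  to 0 forces \<open>h = 0\<close>.\<close>

lemma pencil_double_zero:
  assumes "pencil h u" "h \<noteq> 0" "poly h x = 0" "poly (pderiv h) x = 0"
  shows "poly u x = 0"
proof (rule ccontr)
  assume u: "poly u x \<noteq> 0"
  obtain t where t: "poly h t \<noteq> 0" using assms(2) poly_all_0_iff_0 by blast
  \<comment> \<open>The Laguerre expression of \<open>h + s e u\<close> at \<open>x\<close> has one
    term linear in e, namely -e s u h''; the sign \<open>s\<close> makes it nonpositive.
    \<open>K\<close> is chosen so that the remaining quadratic term is at most the square allowed by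
    \<open>laguerre_bound\<close>.\<close>
  define s where "s = (if poly u x * poly (pderiv (pderiv h)) x \<ge> 0 then 1 else -1 :: real)"
  define K where "K = sqrt (\<bar>poly (pderiv u) x ^ 2 - poly u x * poly (pderiv (pderiv u)) x\<bar> / poly u x ^ 2)"
  define D where "D = max (degree h) (degree u)"
  have K0: "K \<ge> 0" by (simp add: K_def)
  have K2: "K\<^sup>2 * poly u x ^ 2 = \<bar>poly (pderiv u) x ^ 2 - poly u x * poly (pderiv (pderiv u)) x\<bar>"
    using u by (simp add: K_def)
  have bound: "\<bar>poly h t + s * e * poly u t\<bar> \<le> e * (\<bar>poly u x\<bar> * (1 + K * \<bar>t - x\<bar>) ^ D)" if e: "e > 0" for e
  proof -
    let ?p = "smult 1 h + smult (s * e) u"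
    have ss: "s * s = 1" by (simp add: s_def)
    have px: "poly ?p x = s * e * poly u x" using assms by simp
    have nz: "poly ?p x \<noteq> 0" unfolding px using e u by (auto simp: s_def)
    then have "?p \<noteq> 0" by (metis poly_0)
    then have hyp: "hyperbolic ?p" using pencilD[OF assms(1), of 1 "s * e"] by (simp only: hyp0_def) blast
    have su: "s * (poly u x * poly (pderiv (pderiv h)) x) \<ge> 0" by (simp add: s_def)
    have "poly (pderiv ?p) x ^ 2 - poly ?p x * poly (pderiv (pderiv ?p)) x =
       (s * s) * e^2 * (poly (pderiv u) x ^ 2 - poly u x * poly (pderiv (pderiv u)) x) - e * (s * (poly u x * poly (pderiv (pderiv h)) x))"
      using assms by (simp add: pderiv_add pderiv_smult algebra_simps power2_eq_square)
    also have "\<dots> \<le> e^2 * (K\<^sup>2 * poly u x ^ 2) - e * (s * (poly u x * poly (pderiv (pderiv h)) x))"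
      unfolding ss K2 by (intro diff_right_mono) (simp add: mult_left_mono)
    also have "\<dots> \<le> e^2 * (K\<^sup>2 * poly u x ^ 2)" using su e by simp
    also have "\<dots> = K\<^sup>2 * poly ?p x ^ 2" unfolding px using ss by (simp add: power2_eq_square)
    finally have "\<bar>poly ?p t\<bar> \<le> \<bar>poly ?p x\<bar> * (1 + K * \<bar>t - x\<bar>) ^ degree ?p"
      using laguerre_bound[OF hyp nz K0] by blast
    also have "\<dots> \<le> \<bar>poly ?p x\<bar> * (1 + K * \<bar>t - x\<bar>) ^ D"
    proof (intro mult_left_mono power_increasing)
      show "degree ?p \<le> D" unfolding D_def
        by (intro degree_add_le) (auto intro: order_trans[OF degree_smult_le])
    qed (use K0 in auto)
    also have "\<bar>poly ?p x\<bar> = e * \<bar>poly u x\<bar>" unfolding px using e by (simp add: s_def abs_mult)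
    finally show ?thesis by (simp add: algebra_simps)
  qed
  have lim1: "((\<lambda>e. \<bar>poly h t + s * e * poly u t\<bar>) \<longlongrightarrow> \<bar>poly h t + s * 0 * poly u t\<bar>) (at_right 0)"
    by (intro tendsto_intros)
  have lim2: "((\<lambda>e. e * (\<bar>poly u x\<bar> * (1 + K * \<bar>t - x\<bar>) ^ D)) \<longlongrightarrow> 0 * (\<bar>poly u x\<bar> * (1 + K * \<bar>t - x\<bar>) ^ D)) (at_right 0)"
    by (intro tendsto_intros)
  have "\<bar>poly h t + s * 0 * poly u t\<bar> \<le> 0 * (\<bar>poly u x\<bar> * (1 + K * \<bar>t - x\<bar>) ^ D)"
    by (rule tendsto_le[OF _ lim2 lim1])
       (auto intro!: eventually_at_rightI[of 0 1] bound)
  then show False using t by simp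
qed

text \<open>While the multiplicity in \<open>h\<close> is at least two, the zero is shared by
  \<open>u\<close> and can be divided out of both, which leaves a pencil.\<close>

lemma pencil_multiple_zero:
  assumes "pencil h u" "h \<noteq> 0" "[:- x, 1:] ^ m dvd h"
  shows "[:- x, 1:] ^ (m - 1) dvd u"
  using assms
proof (induction m arbitrary: h u)
  case (Suc m)
  show ?case
  proof (cases m)
    case (Suc k)
    from Suc.prems(3) obtain w where w: "h = [:- x, 1:] ^ Suc m * w" by (auto elim: dvdE)
    define h1 where "h1 = [:- x, 1:] ^ m * w"
    have h: "h = [:- x, 1:] * h1" by (simp add: w h1_def mult.assoc)
    have "poly h1 x = 0" by (simp add: h1_def Suc)
    then have "poly h x = 0" "poly (pderiv h) x = 0"
      by (simp_all add: h pderiv_mult pderiv_pCons)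
    then have "poly u x = 0" using pencil_double_zero Suc.prems by blast
    then obtain u1 where u: "u = [:- x, 1:] * u1" by (auto simp: poly_eq_0_iff_dvd)
    have "pencil h1 u1" using Suc.prems(1) unfolding h u by (subst (asm) pencil_mult_iff) auto
    then have "[:- x, 1:] ^ (m - 1) dvd u1" using Suc.IH[of h1 u1] Suc.prems(2) unfolding h by (auto simp: h1_def)
    then have "[:- x, 1:] * [:- x, 1:] ^ (m - 1) dvd u" unfolding u by (rule mult_dvd_mono[OF dvd_refl])
    then show ?thesis using Suc by simp
  qed auto
qed auto

subsection \<open>Limits of hyperbolic polynomials\<close>

text \<open>Factor by factor, the distance of \<open>t\<close> from a real zero is at most a fixed
  multiple of the distance of \<open>z\<close> from it. A single nonreal value thus controls all
  real values, which takes the place of Hurwitz's theorem and tolerates degrees that drop in the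
  limit.\<close>

lemma hyperbolic_lower_bound:
  assumes "hyperbolic p" "Im z \<noteq> 0"
  shows "\<bar>poly p t\<bar> \<le> (norm (of_real t - z) / \<bar>Im z\<bar> + 1) ^ degree p * norm (cpoly p z)"
  using assms(1)
proof (induction rule: hyperbolic_induct)
  case (linear c p)
  let ?k = "norm (of_real t - z) / \<bar>Im z\<bar> + 1"
  have "\<bar>Im z\<bar> \<le> norm (z - of_real c)" using abs_Im_le_cmod[of "z - of_real c"] by simp
  then have "norm (of_real t - z) / \<bar>Im z\<bar> * \<bar>Im z\<bar> \<le> norm (of_real t - z) / \<bar>Im z\<bar> * norm (z - of_real c)"
    by (intro mult_left_mono) auto
  then have 1: "norm (of_real t - z) \<le> norm (of_real t - z) / \<bar>Im z\<bar> * norm (z - of_real c)" using assms by simp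
  have "\<bar>t - c\<bar> = norm ((of_real t - z) + (z - of_real c))" by (simp flip: of_real_diff)
  also have "\<dots> \<le> norm (of_real t - z) + norm (z - of_real c)" by (rule norm_triangle_ineq)
  also have "\<dots> \<le> ?k * norm (z - of_real c)" using 1 by (simp add: algebra_simps)
  finally have "\<bar>t - c\<bar> * \<bar>poly p t\<bar> \<le> (?k * norm (z - of_real c)) * (?k ^ degree p * norm (cpoly p z))"
    using linear.IH by (intro mult_mono) auto
  moreover have "degree ([:- c, 1:] * p) = Suc (degree p)"
    using linear hyperbolic_nz by (subst degree_mult_eq) auto
  ultimately show ?case by (simp add: abs_mult norm_mult mult_ac)
qed auto

text \<open>A nonreal zero of the limit would force the limit to vanish on the whole real line. The
  filter is arbitrary because both sequences and a real scaling parameter tending to infinity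
  occur.\<close>

lemma hyp0_limit:
  fixes P :: "'b \<Rightarrow> real poly"
  assumes hyp: "\<forall>\<^sub>F i in F. hyp0 (P i)" and deg: "\<forall>\<^sub>F i in F. degree (P i) \<le> D"
    and lim: "\<And>z. ((\<lambda>i. cpoly (P i) z) \<longlongrightarrow> cpoly p z) F" and F: "F \<noteq> bot"
  shows "hyp0 p"
proof (rule ccontr)
  assume neg: "\<not> hyp0 p"
  then obtain z where z: "cpoly p z = 0" "Im z \<noteq> 0" using hyperbolicI by (auto simp: hyp0_def)
  have "poly p t = 0" for t
  proof -
    let ?k = "norm (of_real t - z) / \<bar>Im z\<bar> + 1"
    have l1: "((\<lambda>i. norm (cpoly (P i) (of_real t))) \<longlongrightarrow> norm (cpoly p (of_real t))) F"
      by (intro tendsto_norm lim)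
    have l2: "((\<lambda>i. ?k ^ D * norm (cpoly (P i) z)) \<longlongrightarrow> ?k ^ D * norm (cpoly p z)) F"
      by (intro tendsto_intros lim)
    have "\<forall>\<^sub>F i in F. norm (cpoly (P i) (of_real t)) \<le> ?k ^ D * norm (cpoly (P i) z)"
      using hyp deg
    proof eventually_elim
      case (elim i)
      show ?case
      proof (cases "P i = 0")
        case False
        then have "hyperbolic (P i)" using elim by (simp add: hyp0_def)
        then have "\<bar>poly (P i) t\<bar> \<le> ?k ^ degree (P i) * norm (cpoly (P i) z)"
          using hyperbolic_lower_bound z by blast
        also have "\<dots> \<le> ?k ^ D * norm (cpoly (P i) z)"
          using elim by (intro mult_right_mono power_increasing) auto
        finally show ?thesis by simp
      qed simp
    qed
    then have "norm (cpoly p (of_real t)) \<le> ?k ^ D * norm (cpoly p z)"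
      by (rule tendsto_le[OF F l2 l1])
    then show ?thesis using z by simp
  qed
  then show False using neg poly_all_0_iff_0[of p] by (simp add: hyp0_def)
qed

subsection \<open>Interlacing of the zeros in a pencil\<close>

text \<open>A zero of the Wronskian is a double zero of the combination \<open>h\<close> that
  vanishes at \<open>x\<close>, hence a common zero of \<open>P\<close> and \<open>G\<close>. The
  different degrees prevent \<open>h\<close> from being zero.\<close>

lemma pencil_wronskian_nonzero:
  assumes "pencil P G" "P \<noteq> 0" "G \<noteq> 0" "degree P \<noteq> degree G"
    and "\<not> (poly P x = 0 \<and> poly G x = 0)"
  shows "poly (pderiv P * G - P * pderiv G) x \<noteq> 0"
proof
  assume W: "poly (pderiv P * G - P * pderiv G) x = 0"
  define h where "h = smult (poly G x) P + smult (- poly P x) G"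
  have h0: "poly h x = 0" by (simp add: h_def)
  have h1: "poly (pderiv h) x = 0"
    using W by (simp add: h_def pderiv_add pderiv_smult pderiv_minus pderiv_diff algebra_simps)
  have hnz: "h \<noteq> 0"
  proof
    assume "h = 0"
    then have eq: "smult (poly G x) P = smult (poly P x) G" by (simp add: h_def)
    then have "poly G x \<noteq> 0" "poly P x \<noteq> 0" using assms by auto
    then have "degree P = degree G" using arg_cong[OF eq, of degree] by simp
    then show False using assms by simp
  qed
  have "pencil h P" "pencil h G"
    using pencil_comb[OF assms(1), of "poly G x" "- poly P x" 1 0]
      pencil_comb[OF assms(1), of "poly G x" "- poly P x" 0 1] by (simp_all add: h_def)
  then have "poly P x = 0" "poly G x = 0" using pencil_double_zero hnz h0 h1 by blast+
  then show False using assms by simp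
qed

lemma poly_same_sign:
  fixes p :: "real poly"
  assumes "a \<le> b" "\<And>x. a \<le> x \<Longrightarrow> x \<le> b \<Longrightarrow> poly p x \<noteq> 0"
  shows "poly p a * poly p b > 0"
proof (cases "a = b")
  case True
  then show ?thesis using assms(2)[of a] by (simp flip: power2_eq_square)
next
  case False
  then have "a < b" using assms by simp
  then have "\<not> poly p a * poly p b < 0" using poly_IVT[of a b p] assms(2) by force
  moreover have "poly p a * poly p b \<noteq> 0" using assms(2)[of a] assms(2)[of b] \<open>a < b\<close> by simp
  ultimately show ?thesis by linarith
qed

text \<open>The Wronskian has no zero, so it has constant sign. At zeros of \<open>P\<close> it
  equals P' G, and P' takes opposite signs at consecutive simple zeros, which is made explicit by
  the factorization P = (z - p) (z - q) K.\<close>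

lemma consecutive_zeros_alternate:
  assumes pen: "pencil P G" "P \<noteq> 0" "G \<noteq> 0" "degree P \<noteq> degree G"
    and cop: "\<And>x. \<not> (poly P x = 0 \<and> poly G x = 0)"
    and pq: "p < q" "poly P p = 0" "poly P q = 0"
    and no: "\<And>x. p < x \<Longrightarrow> x < q \<Longrightarrow> poly P x \<noteq> 0"
  shows "poly G p * poly G q < 0"
proof -
  define W where "W = pderiv P * G - P * pderiv G"
  have W: "poly W x \<noteq> 0" for x
    unfolding W_def by (intro pencil_wronskian_nonzero pen cop)
  obtain P1 where P1: "P = [:- p, 1:] * P1" using pq by (auto simp: poly_eq_0_iff_dvd)
  have "poly P1 q = 0" using pq by (simp add: P1 poly_linear_mult)
  then obtain K where K: "P1 = [:- q, 1:] * K" by (auto simp: poly_eq_0_iff_dvd)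
  have Pp: "poly (pderiv P) p = (p - q) * poly K p" and Pq: "poly (pderiv P) q = (q - p) * poly K q"
    unfolding P1 pderiv_linear_mult K by (simp_all add: algebra_simps pderiv_linear_mult)
  have Wp: "poly W p = (p - q) * poly K p * poly G p" and Wq: "poly W q = (q - p) * poly K q * poly G q"
    using pq by (simp_all add: W_def Pp Pq)
  have "poly K x \<noteq> 0" if "p \<le> x" "x \<le> q" for x
  proof (cases "x = p \<or> x = q")
    case True
    then show ?thesis using W[of p] W[of q] unfolding Wp Wq by auto
  next
    case False
    then show ?thesis using no[of x] that by (auto simp: P1 K)
  qed
  then have "poly K p * poly K q > 0" using poly_same_sign pq by simp
  moreover have "poly W p * poly W q > 0" using poly_same_sign W pq by simp
  ultimately have "- ((q - p)\<^sup>2 * (poly K p * poly K q) * (poly G p * poly G q)) > 0"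
    unfolding Wp Wq by (simp add: algebra_simps power2_eq_square)
  then have "(q - p)\<^sup>2 * (poly K p * poly K q) * (poly G p * poly G q) < 0" by linarith
  moreover have "(q - p)\<^sup>2 * (poly K p * poly K q) > 0" using \<open>poly K p * poly K q > 0\<close> pq by simp
  ultimately show ?thesis by (metis linorder_not_less mult_nonneg_nonneg less_imp_le)
qed

text \<open>The induction removes the largest point of \<open>A\<close> together with a point of
  \<open>B\<close> in the last gap; this point lies to the right of all other gaps.\<close>

lemma card_le_separated:
  fixes A B :: "real set"
  assumes "finite A" "finite B"
    and "\<And>a b. a \<in> A \<Longrightarrow> b \<in> A \<Longrightarrow> a < b \<Longrightarrow> (\<And>x. a < x \<Longrightarrow> x < b \<Longrightarrow> x \<notin> A) \<Longrightarrow> \<exists>c\<in>B. a < c \<and> c < b"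
  shows "card A \<le> card B + 1"
  using assms
proof (induction A arbitrary: B rule: finite_linorder_max_induct)
  case (insert b A)
  show ?case
  proof (cases "A = {}")
    case False
    define a where "a = Max A"
    have a: "a \<in> A" "\<And>x. x \<in> A \<Longrightarrow> x \<le> a" using insert False by (auto simp: a_def)
    have "\<exists>c\<in>B. a < c \<and> c < b"
    proof (rule insert.prems(2))
      fix x assume "a < x" "x < b" then show "x \<notin> insert b A" using a by force
    qed (use a insert in auto)
    then obtain c where c: "c \<in> B" "a < c" "c < b" by blast
    have "card A \<le> card (B - {c}) + 1"
    proof (rule insert.IH)
      fix s t assume st: "s \<in> A" "t \<in> A" "s < t" "\<And>x. s < x \<Longrightarrow> x < t \<Longrightarrow> x \<notin> A"
      have "\<exists>d\<in>B. s < d \<and> d < t"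
        by (rule insert.prems(2)) (use st insert.hyps in force)+
      moreover have "t < c" using st a c by force
      ultimately show "\<exists>d\<in>B - {c}. s < d \<and> d < t" by force
    qed (use insert in auto)
    moreover have "card B > 0" using c insert.prems card_gt_0_iff by blast
    moreover have "b \<notin> A" using insert.hyps by blast
    ultimately show ?thesis using c insert by (simp add: card_Diff_singleton)
  qed simp
qed simp

lemma proots_rsquarefree: "rsquarefree p \<Longrightarrow> proots (p :: real poly) = mset_set {x. poly p x = 0}"
proof (rule multiset_eqI)
  fix x assume p: "rsquarefree p"
  then have "p \<noteq> 0" by (simp add: rsquarefree_def)
  show "count (proots p) x = count (mset_set {x. poly p x = 0}) x"
  proof (cases "poly p x = 0")
    case True
    then have "order x p \<noteq> 0" using \<open>p \<noteq> 0\<close> order_root[of p x] by blast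
    moreover have "order x p = 0 \<or> order x p = 1" using p by (simp add: rsquarefree_def)
    ultimately have "order x p = 1" by simp
    moreover have "count (mset_set {x. poly p x = 0}) x = 1"
      using True poly_roots_finite[OF \<open>p \<noteq> 0\<close>] by (intro count_mset_set(1)) simp_all
    ultimately show ?thesis using \<open>p \<noteq> 0\<close> by simp
  next
    case False
    then show ?thesis using \<open>p \<noteq> 0\<close> by (simp add: order_0I)
  qed
qed

lemma card_zeros_le_size:
  assumes "p \<noteq> 0"
  shows "card {x. poly p x = 0 \<and> x \<in> S} \<le> size (filter_mset (\<lambda>x. x \<in> S) (proots p))"
proof -
  have eq: "{x. poly p x = 0 \<and> x \<in> S} = set_mset (filter_mset (\<lambda>x. x \<in> S) (proots p))"
    using assms by auto
  show ?thesis unfolding eq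
    by (metis mset_set_set_mset_msubset size_mset_mono size_mset_set)
qed

lemma pencil_rsquarefree:
  assumes pen: "pencil P G" "P \<noteq> 0" "G \<noteq> 0" "degree P \<noteq> degree G"
    and cop: "\<And>x. \<not> (poly P x = 0 \<and> poly G x = 0)"
  shows "rsquarefree P"
  unfolding rsquarefree_roots
proof safe
  fix x assume "poly P x = 0" "poly (pderiv P) x = 0"
  then show False using pencil_wronskian_nonzero[OF pen cop, of x] by simp
qed

lemma size_zeros_linear_mult:
  "p \<noteq> 0 \<Longrightarrow> size (filter_mset R (proots ([:- c, 1:] * p))) = (if R c then 1 else 0) + size (filter_mset R (proots p))"
  by (subst proots_mult) auto

text \<open>A common zero contributes equally to both counts and is cancelled first; without common
  zeros the previous lemmas put a zero of \<open>G\<close> between any two consecutive zeros of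
  \<open>P\<close>. The set \<open>S\<close> is convex, so such a zero stays in it; the cases used
  are half-lines and the whole line.\<close>

lemma pencil_zeros_separated:
  assumes "pencil P G" "P \<noteq> 0" "G \<noteq> 0" "degree P \<noteq> degree G"
    and conv: "\<And>a b c. a \<in> S \<Longrightarrow> c \<in> S \<Longrightarrow> a < b \<Longrightarrow> b < c \<Longrightarrow> b \<in> S"
  shows "size (filter_mset (\<lambda>x. x \<in> S) (proots P)) \<le> size (filter_mset (\<lambda>x. x \<in> S) (proots G)) + 1"
  using assms(1-4)
proof (induction "degree P" arbitrary: P G rule: less_induct)
  case less
  show ?case
  proof (cases "\<exists>x. poly P x = 0 \<and> poly G x = 0")
    case True
    then obtain x P1 G1 where P: "P = [:- x, 1:] * P1" and G: "G = [:- x, 1:] * G1"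
      by (auto simp: poly_eq_0_iff_dvd elim!: dvdE)
    have nz: "P1 \<noteq> 0" "G1 \<noteq> 0" using less.prems P G by auto
    have deg: "degree P = Suc (degree P1)" "degree G = Suc (degree G1)"
      unfolding P G using nz by (subst degree_mult_eq; simp)+
    have "pencil P1 G1" using less.prems(1) unfolding P G by (subst (asm) pencil_mult_iff) auto
    then have "size (filter_mset (\<lambda>x. x \<in> S) (proots P1)) \<le> size (filter_mset (\<lambda>x. x \<in> S) (proots G1)) + 1"
      using less.hyps[of P1 G1] less.prems deg nz by simp
    then show ?thesis unfolding P G size_zeros_linear_mult[OF nz(1)] size_zeros_linear_mult[OF nz(2)] by simp
  next
    case False
    define A B where "A = {x. poly P x = 0 \<and> x \<in> S}" and "B = {x. poly G x = 0 \<and> x \<in> S}"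
    have fin: "finite A" "finite B" unfolding A_def B_def using less.prems
      by (auto intro: finite_subset[OF _ poly_roots_finite[of P]] finite_subset[OF _ poly_roots_finite[of G]])
    have "card A \<le> card B + 1"
    proof (rule card_le_separated[OF fin])
      fix a b assume ab: "a \<in> A" "b \<in> A" "a < b" "\<And>x. a < x \<Longrightarrow> x < b \<Longrightarrow> x \<notin> A"
      have no: "poly P x \<noteq> 0" if "a < x" "x < b" for x
        using ab that conv[of a b x] by (auto simp: A_def)
      have "poly G a * poly G b < 0"
        using consecutive_zeros_alternate[OF less.prems, of a b] False ab no by (auto simp: A_def)
      then obtain c where "a < c" "c < b" "poly G c = 0" using poly_IVT ab by blast
      then show "\<exists>c\<in>B. a < c \<and> c < b" using ab conv[of a b c] by (auto simp: A_def B_def)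
    qed
    moreover have "card B \<le> size (filter_mset (\<lambda>x. x \<in> S) (proots G))"
      unfolding B_def using card_zeros_le_size less.prems by blast
    moreover have "rsquarefree P" using pencil_rsquarefree less.prems False by blast
    then have "size (filter_mset (\<lambda>x. x \<in> S) (proots P)) = card A"
      unfolding A_def using less.prems
      by (simp add: proots_rsquarefree poly_roots_finite)
    ultimately show ?thesis by simp
  qed
qed

text \<open>Sorted lists of zeros are compared through counting functions: the zero at position i is
  at most x if and only if \<open>i < cnt p x\<close>. Counts combine well with pencils, where
  positions do not.\<close>

definition cnt :: "real poly \<Rightarrow> real \<Rightarrow> nat" where
  "cnt p x = size (filter_mset (\<lambda>y. y \<le> x) (proots p))"

definition cnt_gt :: "real poly \<Rightarrow> real \<Rightarrow> nat" where
  "cnt_gt p x = size (filter_mset (\<lambda>y. y > x) (proots p))"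

lemma cnt_add_cnt_gt: "hyperbolic p \<Longrightarrow> cnt p x + cnt_gt p x = degree p"
proof -
  assume "hyperbolic p"
  moreover have "filter_mset (\<lambda>y. y > x) (proots p) = filter_mset (\<lambda>y. \<not> y \<le> x) (proots p)"
    by (simp add: not_le)
  ultimately show ?thesis unfolding cnt_def cnt_gt_def
    by (metis hyperbolic_size multiset_partition size_union)
qed

lemma cnt_linear_mult: "p \<noteq> 0 \<Longrightarrow> cnt ([:- c, 1:] * p) x = (if c \<le> x then 1 else 0) + cnt p x"
  and cnt_gt_linear_mult: "p \<noteq> 0 \<Longrightarrow> cnt_gt ([:- c, 1:] * p) x = (if c > x then 1 else 0) + cnt_gt p x"
  unfolding cnt_def cnt_gt_def by (auto simp: size_zeros_linear_mult)

lemma pencil_degree: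
  assumes "pencil P G" "P \<noteq> 0" "G \<noteq> 0"
  shows "degree P \<le> degree G + 1"
proof (cases "degree P = degree G")
  case False
  have "hyperbolic P" "hyperbolic G" using assms pencil_left pencil_right hyp0_def by blast+
  then show ?thesis using pencil_zeros_separated[OF assms False, of UNIV] by (simp add: hyperbolic_size)
qed simp

text \<open>Separation bounds the zeros of \<open>P\<close> on either side of \<open>x\<close>; the
  lower bound for \<open>cnt P x\<close> is the bound for the right side, read through
  complements.\<close>

lemma pencil_cnt:
  assumes "pencil P H" "H \<noteq> 0" "degree P = degree H + 1"
  shows "cnt H x \<le> cnt P x" "cnt P x \<le> cnt H x + 1"
proof -
  have nz: "P \<noteq> 0" using assms by auto
  have hyp: "hyperbolic P" "hyperbolic H" using assms nz pencil_left pencil_right hyp0_def by blast+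
  show "cnt P x \<le> cnt H x + 1"
    using pencil_zeros_separated[OF assms(1) nz assms(2), of "{..x}"] assms by (simp add: cnt_def)
  have "cnt_gt P x \<le> cnt_gt H x + 1"
    using pencil_zeros_separated[OF assms(1) nz assms(2), of "{x<..}"] assms by (simp add: cnt_gt_def)
  then show "cnt H x \<le> cnt P x"
    using cnt_add_cnt_gt[OF hyp(1), of x] cnt_add_cnt_gt[OF hyp(2), of x] assms by simp
qed

lemma hyperbolic_sgn:
  "hyperbolic p \<Longrightarrow> poly p x \<noteq> 0 \<Longrightarrow> sgn (poly p x) = sgn (lead_coeff p) * (-1) ^ cnt_gt p x"
proof (induction rule: hyperbolic_induct)
  case (linear c p)
  have nz: "p \<noteq> 0" using linear hyperbolic_nz by blast
  have lc: "lead_coeff ([:- c, 1:] * p) = lead_coeff p" by (subst lead_coeff_mult) simp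
  have "sgn (poly p x) = sgn (lead_coeff p) * (-1) ^ cnt_gt p x" using linear by simp
  moreover have "x \<noteq> c" using linear by auto
  ultimately show ?case unfolding lc cnt_gt_linear_mult[OF nz] poly_linear_mult
    by (auto simp: sgn_mult)
qed (auto simp: cnt_gt_def)

text \<open>Both counts lie in \<open>{cnt H x, cnt H x + 1}\<close>. If that of
  \<open>G = P - c H\<close> were the larger, then just to the right of \<open>x\<close> the signs
  of \<open>G\<close> and \<open>H\<close> would agree and that of \<open>P\<close> would be
  opposite, which contradicts \<open>c \<ge> 0\<close>.\<close>

lemma cnt_subtract_mono:
  assumes pen: "pencil P H" and nz: "H \<noteq> 0" and deg: "degree P = degree H + 1"
    and lc: "lead_coeff P * lead_coeff H > 0" and c: "c \<ge> 0"
  shows "cnt (P - smult c H) x \<le> cnt P x"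
proof (rule ccontr)
  define G where "G = P - smult c H"
  assume "\<not> cnt (P - smult c H) x \<le> cnt P x"
  then have gt: "cnt G x > cnt P x" by (simp add: G_def)
  have nzP: "P \<noteq> 0" using deg by auto
  have dG: "degree G = degree H + 1" unfolding G_def
  proof -
    have "degree (smult c H) \<le> degree H" by (rule degree_smult_le)
    then have "degree (- smult c H) < degree P" using deg by (simp only: degree_minus)
    then have "degree (P + - smult c H) = degree P" by (rule degree_add_eq_left)
    then show "degree (P - smult c H) = degree H + 1" using deg by simp
  qed
  have "coeff H (degree H + 1) = 0" by (simp add: coeff_eq_0)
  then have lG: "lead_coeff G = lead_coeff P" unfolding dG by (simp add: G_def deg)
  have pG: "pencil G H" using pencil_comb[OF pen, of 1 "- c" 0 1] by (simp add: G_def)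
  have nzG: "G \<noteq> 0" using dG by auto
  have hyp: "hyperbolic P" "hyperbolic H" "hyperbolic G"
    using pen pG nz nzP nzG pencil_left pencil_right hyp0_def by blast+
  have cP: "cnt P x = cnt H x" and cG: "cnt G x = cnt H x + 1"
    using pencil_cnt[OF pen nz deg, of x] pencil_cnt[OF pG nz dG, of x] gt by linarith+
  \<comment> \<open>The point \<open>y\<close> is taken beyond \<open>x\<close> but before every
    zero of the three polynomials to the right of \<open>x\<close>. None of them vanishes at
    \<open>y\<close>, and each has the same number of zeros beyond \<open>y\<close> as beyond
    \<open>x\<close>.\<close>
  define Z where "Z = {y. poly (P * H * G) y = 0 \<and> y > x}"
  have "finite Z" unfolding Z_def
    by (rule finite_subset[OF _ poly_roots_finite[of "P * H * G"]]) (use nz nzP nzG in auto)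
  obtain y where y: "y > x" "\<And>z. z \<in> Z \<Longrightarrow> y < z"
  proof (cases "Z = {}")
    case True
    then show ?thesis using that[of "x + 1"] by auto
  next
    case False
    then have "Min Z > x" using \<open>finite Z\<close> by (auto simp: Z_def)
    then obtain y where "x < y" "y < Min Z" using dense by blast
    then show ?thesis using that[of y] \<open>finite Z\<close> by (auto simp: less_le_trans)
  qed
  have ny: "poly P y \<noteq> 0" "poly H y \<noteq> 0" "poly G y \<noteq> 0"
    using y(2)[of y] y(1) by (auto simp: Z_def)
  have same: "cnt_gt p y = cnt_gt p x" if "p \<in> {P, H, G}" for p
  proof -
    have "p \<noteq> 0" using that nz nzP nzG by auto
    have "x < z \<longleftrightarrow> y < z" if "z \<in># proots p" for z
    proof
      assume "x < z"
      then have "z \<in> Z" using that \<open>p \<in> {P, H, G}\<close> \<open>p \<noteq> 0\<close> by (auto simp: Z_def)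
      then show "y < z" using y by blast
    qed (use y in auto)
    then have "filter_mset (\<lambda>z. y < z) (proots p) = filter_mset (\<lambda>z. x < z) (proots p)"
      by (intro filter_mset_cong) auto
    then show ?thesis by (simp add: cnt_gt_def)
  qed
  let ?m = "cnt_gt H x"
  have gP: "cnt_gt P x = Suc ?m" and gG: "cnt_gt G x = ?m"
    using cP cG cnt_add_cnt_gt[OF hyp(1), of x] cnt_add_cnt_gt[OF hyp(2), of x] cnt_add_cnt_gt[OF hyp(3), of x] deg dG
    by simp_all
  let ?s = "sgn (lead_coeff P) * (-1) ^ ?m"
  have sH: "sgn (lead_coeff H) = sgn (lead_coeff P)"
    using lc by (auto simp: zero_less_mult_iff sgn_if)
  have sg: "sgn (poly P y) = - ?s" "sgn (poly H y) = ?s" "sgn (poly G y) = ?s"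
    using hyperbolic_sgn[OF hyp(1) ny(1)] hyperbolic_sgn[OF hyp(2) ny(2)] hyperbolic_sgn[OF hyp(3) ny(3)]
    by (simp_all add: same gP gG lG sH)
  have "poly G y = poly P y - c * poly H y" by (simp add: G_def)
  then have "?s * poly G y = ?s * poly P y - c * (?s * poly H y)" by (simp only: right_diff_distrib mult.left_commute)
  moreover have "?s * poly G y = \<bar>poly G y\<bar>" "?s * poly H y = \<bar>poly H y\<bar>" "?s * poly P y = - \<bar>poly P y\<bar>"
    using abs_sgn[of "poly G y"] abs_sgn[of "poly H y"] abs_sgn[of "poly P y"] unfolding sg by (simp_all only: mult.commute mult_minus_right minus_minus)
  ultimately have "\<bar>poly G y\<bar> = - \<bar>poly P y\<bar> - c * \<bar>poly H y\<bar>" by simp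
  moreover have "c * \<bar>poly H y\<bar> \<ge> 0" using c by simp
  moreover have "\<bar>poly G y\<bar> > 0" using ny by simp
  ultimately show False by linarith
qed

subsection \<open>Operators of nonnegative Fuchs index\<close>

lemma coeff_mult_bounds:
  fixes p q :: "real poly"
  assumes "degree p \<le> a" "degree q \<le> b"
  shows "coeff (p * q) (a + b) = coeff p a * coeff q b"
proof -
  have "coeff (p * q) (a + b) = (\<Sum>i\<le>a + b. coeff p i * coeff q (a + b - i))"
    by (rule coeff_mult)
  also have "\<dots> = (\<Sum>i\<in>{a}. coeff p i * coeff q (a + b - i))"
  proof (rule sum.mono_neutral_right)
    show "\<forall>i\<in>{..a + b} - {a}. coeff p i * coeff q (a + b - i) = 0"
    proof
      fix i assume i: "i \<in> {..a + b} - {a}"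
      then have "i > a \<or> a + b - i > b" by auto
      then show "coeff p i * coeff q (a + b - i) = 0"
        using assms by (auto simp: coeff_eq_0)
    qed
  qed auto
  finally show ?thesis by simp
qed

definition falling :: "nat \<Rightarrow> nat \<Rightarrow> real" where
  "falling j k = (\<Prod>i<k. real j - real i)"

lemma falling_0 [simp]: "falling j 0 = 1"
  and falling_Suc: "falling j (Suc k) = falling j k * (real j - real k)"
  by (simp_all add: falling_def)

lemma falling_eq_0: "k > j \<Longrightarrow> falling j k = 0"
  by (auto simp: falling_def)

lemma falling_pos: "k \<le> j \<Longrightarrow> falling j k > 0"
  unfolding falling_def by (intro prod_pos) auto

lemma falling_mult_diff: "falling j k * real (j - k) = falling j (Suc k)"
  by (cases "k \<le> j") (auto simp: falling_Suc of_nat_diff falling_eq_0)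

lemma higher_pderiv_monom_falling: "(pderiv ^^ k) (monom c m) = monom (c * falling m k) (m - k)"
proof (induction k)
  case (Suc k)
  then have "(pderiv ^^ Suc k) (monom c m) = monom (c * (falling m k * real (m - k))) (m - Suc k)"
    by (simp add: pderiv_monom mult_ac)
  then show ?case by (simp add: falling_mult_diff)
qed auto

lemma higher_pderiv_linear_power:
  "(pderiv ^^ k) ([:- x, 1:] ^ m) = smult (falling m k) ([:- x, 1:] ^ (m - k))"
proof (induction k)
  case (Suc k)
  have p: "pderiv ([:- x, 1:] ^ n) = smult (real n) ([:- x, 1:] ^ (n - 1))" for n
    by (cases n) (auto simp: pderiv_power_Suc pderiv_pCons one_pCons[symmetric] simp del: power_Suc)
  have "(pderiv ^^ Suc k) ([:- x, 1:] ^ m) = smult (falling m k * real (m - k)) ([:- x, 1:] ^ (m - Suc k))"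
    using Suc by (simp add: pderiv_smult p)
  then show ?case by (simp add: falling_mult_diff)
qed auto

lemma coeff_higher_pderiv_top:
  assumes "degree f \<le> j" "k \<le> j"
  shows "coeff ((pderiv ^^ k) f) (j - k) = falling j k * coeff f j"
  using assms(2)
proof (induction k)
  case (Suc k)
  then have "coeff ((pderiv ^^ Suc k) f) (j - Suc k) = real (j - k) * coeff ((pderiv ^^ k) f) (j - k)"
    by (simp add: coeff_pderiv Suc_diff_Suc)
  then show ?case using Suc falling_mult_diff[of j k] by (simp add: mult_ac)
qed auto

lemma higher_pderiv_eq_0: "degree f < k \<Longrightarrow> (pderiv ^^ k) f = (0 :: real poly)"
proof -
  assume "degree f < k"
  then obtain k' where k: "k = Suc k'" "degree f \<le> k'" by (cases k) auto
  have "degree ((pderiv ^^ k') f) = 0" using k by (simp add: degree_higher_pderiv)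
  then show ?thesis using k by (simp add: pderiv_eq_0_iff)
qed

lemma higher_pderiv_X_mult:
  "(pderiv ^^ k) ([:0, 1:] * f) = [:0, 1:] * (pderiv ^^ k) f + smult (real k) ((pderiv ^^ (k - 1)) f)"
proof (induction k)
  case (Suc k)
  have p: "pderiv ([:0, 1:] * g) = [:0, 1:] * pderiv g + g" for g :: "real poly"
    using pderiv_linear_mult[of 0 g] by simp
  have "pderiv (smult (real k) ((pderiv ^^ (k - 1)) f)) = smult (real k) ((pderiv ^^ k) f)"
    by (cases k) (auto simp: pderiv_smult)
  then have "(pderiv ^^ Suc k) ([:0, 1:] * f) = [:0, 1:] * (pderiv ^^ Suc k) f + ((pderiv ^^ k) f + smult (real k) ((pderiv ^^ k) f))"
    using Suc by (simp only: funpow.simps comp_def p pderiv_add add.assoc)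
  also have "(pderiv ^^ k) f + smult (real k) ((pderiv ^^ k) f) = smult (real (Suc k)) ((pderiv ^^ (Suc k - 1)) f)"
    by (simp add: smult_add_left)
  finally show ?case .
qed auto

section \<open>Rescaling of the variable and limits at infinity\<close>

lemma cpoly_pcompose_scale: "cpoly (pcompose f [:0, c:]) z = cpoly f (of_real c * z)"
  by (induction f) (simp_all add: pcompose_pCons)

lemma hyperbolic_scale: "hyperbolic f \<Longrightarrow> c \<noteq> 0 \<Longrightarrow> hyperbolic (pcompose f [:0, c:])"
proof (rule hyperbolicI)
  assume *: "hyperbolic f" "c \<noteq> 0"
  then show "pcompose f [:0, c:] \<noteq> 0" using hyperbolic_nz by (auto simp: pcompose_eq_0_iff)
  show "cpoly (pcompose f [:0, c:]) z \<noteq> 0" if "Im z \<noteq> 0" for z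
    using hyperbolicD[OF *(1), of "of_real c * z"] that * by (auto simp: cpoly_pcompose_scale)
qed

lemma hyp0_scale: "hyp0 f \<Longrightarrow> c \<noteq> 0 \<Longrightarrow> hyp0 (pcompose f [:0, c:])"
  by (auto simp: hyp0_def hyperbolic_scale)

lemma hyp0_smult: "hyp0 f \<Longrightarrow> hyp0 (smult c f)"
  by (auto simp: hyp0_def hyperbolic_smult_iff)

lemma higher_pderiv_scale:
  "(pderiv ^^ k) (pcompose f [:0, c:]) = smult (c ^ k) (pcompose ((pderiv ^^ k) f) [:0, c:])"
  by (induction k) (simp_all add: pderiv_smult pderiv_pcompose pderiv_pCons mult_pCons_left mult.commute)

lemma cpoly_altdef: "degree q \<le> m \<Longrightarrow> cpoly q z = (\<Sum>i\<le>m. of_real (coeff q i) * z ^ i)"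
proof -
  assume m: "degree q \<le> m"
  have "cpoly q z = (\<Sum>i\<le>degree (map_poly complex_of_real q). of_real (coeff q i) * z ^ i)"
    unfolding cpoly_def poly_altdef by (simp add: coeff_map_poly)
  also have "degree (map_poly complex_of_real q) = degree q" by (rule degree_map_poly) auto
  also have "(\<Sum>i\<le>degree q. of_real (coeff q i) * z ^ i) = (\<Sum>i\<le>m. of_real (coeff q i) * z ^ i)"
    using m by (intro sum.mono_neutral_left) (auto simp: coeff_eq_0)
  finally show ?thesis .
qed

lemma cpoly_scale_limit:
  assumes "degree q \<le> m"
  shows "((\<lambda>l. cpoly q (of_real l * z) / of_real l ^ m) \<longlongrightarrow> of_real (coeff q m) * z ^ m) at_top"
proof -
  have "((\<lambda>l. \<Sum>i\<le>m. of_real (coeff q i) * z ^ i * of_real (l ^ i / l ^ m))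
     \<longlongrightarrow> (\<Sum>i\<le>m. of_real (coeff q i) * z ^ i * of_real (if i = m then 1 else 0))) at_top"
  proof (intro tendsto_sum tendsto_mult tendsto_const tendsto_of_real)
    fix i assume "i \<in> {..m}"
    then have i: "i \<le> m" by simp
    show "((\<lambda>l::real. l ^ i / l ^ m) \<longlongrightarrow> (if i = m then 1 else 0)) at_top"
    proof (cases "i = m")
      case True
      have "\<forall>\<^sub>F l in at_top. (l::real) ^ i / l ^ m = 1"
        using eventually_gt_at_top[of 0] by eventually_elim (simp add: True)
      then show ?thesis using True by (simp add: tendsto_eventually)
    next
      case False
      then have lim: "((\<lambda>l::real. inverse (l ^ (m - i))) \<longlongrightarrow> 0) at_top"
        using i by (intro tendsto_inverse_0_at_top filterlim_pow_at_top filterlim_ident) auto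
      have "\<forall>\<^sub>F l in at_top. inverse (l ^ (m - i)) = (l::real) ^ i / l ^ m"
        using eventually_gt_at_top[of 0] by eventually_elim (use i in \<open>simp add: power_diff field_simps\<close>)
      then show ?thesis using False Lim_transform_eventually[OF lim] by simp
    qed
  qed
  also have "(\<Sum>i\<le>m. of_real (coeff q i) * z ^ i * of_real (if i = m then 1 else 0)) = of_real (coeff q m) * z ^ m"
    by (subst sum.remove[of _ m]) auto
  finally have lim: "((\<lambda>l. \<Sum>i\<le>m. of_real (coeff q i) * z ^ i * of_real (l ^ i / l ^ m))
     \<longlongrightarrow> of_real (coeff q m) * z ^ m) at_top" .
  have "(\<Sum>i\<le>m. of_real (coeff q i) * z ^ i * of_real (l ^ i / l ^ m)) = cpoly q (of_real l * z) / of_real l ^ m" for l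
    unfolding cpoly_altdef[OF assms] sum_divide_distrib
    by (intro sum.cong) (auto simp: power_mult_distrib)
  then show ?thesis using lim by simp
qed

lemma hyp0_quadratic:
  assumes "hyp0 [:c, b, a:]"
  shows "4 * a * c \<le> b\<^sup>2"
proof (cases "a = 0")
  case False
  then have "hyperbolic [:c, b, a:]" using assms by (simp add: hyp0_def)
  then obtain x where "c + x * (b + x * a) = 0" using hyperbolic_real_root[of "[:c, b, a:]"] False by auto
  then have "(2 * a * x + b)\<^sup>2 = b\<^sup>2 - 4 * a * c" by (simp add: power2_eq_square) algebra
  then show ?thesis using zero_le_power2[of "2 * a * x + b"] by linarith
qed simp

lemma sgn_left_of_zeros:
  assumes "hyperbolic p" "\<And>x. poly p x = 0 \<Longrightarrow> g < x"
  shows "sgn (poly p g) = sgn (lead_coeff p) * (-1) ^ degree p"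
proof -
  have "filter_mset (\<lambda>y. y > g) (proots p) = proots p"
    using assms hyperbolic_nz by (auto simp: filter_mset_eq_conv)
  then have "cnt_gt p g = degree p" using assms(1) by (simp add: cnt_gt_def hyperbolic_size)
  then show ?thesis using hyperbolic_sgn[OF assms(1), of g] assms(2)[of g] by auto
qed

text \<open>If \<open>G / P\<close> behaves like \<open>\<kappa> z\<close> at infinity with \<open>\<kappa> \<ge> 1\<close>, then \<open>G / P - z\<close> still has only real
  zeros. For \<open>\<kappa> > 1\<close> the zeros are separated by those of \<open>G - x P\<close> with large \<open>x\<close>.\<close>
lemma pencil_minus_X_mult:
  assumes "pencil P G" "P \<noteq> 0" "degree G = Suc (degree P)"
    and "lead_coeff P * (lead_coeff G - lead_coeff P) \<ge> 0"
  shows "hyp0 (G - [:0, 1:] * P)"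
  using assms
proof (induction "degree P" arbitrary: P G rule: less_induct)
  case less
  have nzG: "G \<noteq> 0" using less.prems by auto
  show ?case
  proof (cases "\<exists>x. poly P x = 0 \<and> poly G x = 0")
    case True
    then obtain x P1 G1 where P: "P = [:- x, 1:] * P1" and G: "G = [:- x, 1:] * G1"
      by (auto simp: poly_eq_0_iff_dvd elim!: dvdE)
    have nz: "P1 \<noteq> 0" "G1 \<noteq> 0" using less.prems nzG P G by auto
    have deg: "degree P = Suc (degree P1)" "degree G = Suc (degree G1)"
      unfolding P G using nz by (subst degree_mult_eq; simp)+
    have lc: "lead_coeff P = lead_coeff P1" "lead_coeff G = lead_coeff G1"
      unfolding P G by (subst lead_coeff_mult; simp)+
    have "pencil P1 G1" using less.prems(1) unfolding P G by (subst (asm) pencil_mult_iff) auto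
    then have "hyp0 (G1 - [:0, 1:] * P1)"
      using less.hyps[of P1 G1] less.prems(3,4) deg nz unfolding lc by simp
    then have "hyp0 ([:- x, 1:] * (G1 - [:0, 1:] * P1))" by (subst hyp0_mult_iff) auto
    then show ?thesis unfolding P G by (simp add: right_diff_distrib mult.left_commute)
  next
    case False
    define H where "H = G - [:0, 1:] * P"
    have pH: "poly H y = poly G y - y * poly P y" for y by (simp add: H_def)
    have hyp: "hyperbolic P" "hyperbolic G" using less.prems nzG pencil_left pencil_right hyp0_def by blast+
    have dXP: "degree ([:0, 1:] * P) = Suc (degree P)" using less.prems by (subst degree_mult_eq) auto
    have lXP: "lead_coeff ([:0, 1:] * P) = lead_coeff P" by (subst lead_coeff_mult) simp
    have dH: "degree H \<le> Suc (degree P)" unfolding H_def using dXP less.prems by (intro degree_diff_le) auto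
    have cH: "coeff H (Suc (degree P)) = lead_coeff G - lead_coeff P"
      using lXP dXP less.prems by (simp add: H_def)
    have "hyperbolic H" if nzH: "H \<noteq> 0"
    proof (rule hyperbolicI_card_zeros[OF nzH])
      define B where "B = {x. poly H x = 0}"
      have fB: "finite B" unfolding B_def using nzH poly_roots_finite by blast
      have cB: "card B \<le> size (proots H)" using card_zeros_le_size[OF nzH, of UNIV] by (simp add: B_def)
      show "degree H \<le> size (proots H) + 1"
      proof (cases "lead_coeff G = lead_coeff P")
        case True
        \<comment> \<open>Equal leading coefficients cancel, so the degree of \<open>H\<close> is at
          most that of \<open>P\<close>. At zeros of \<open>P\<close> the values of \<open>H\<close>
          and \<open>G\<close> agree, hence \<open>H\<close> changes sign between consecutive
          ones.\<close>
        define A where "A = {x. poly P x = 0}"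
        have fA: "finite A" unfolding A_def using less.prems poly_roots_finite by blast
        have "rsquarefree P" by (rule pencil_rsquarefree[OF less.prems(1,2) nzG]) (use less.prems False in auto)
        then have cA: "card A = degree P" using hyperbolic_size[OF hyp(1)] by (simp add: proots_rsquarefree A_def)
        have "card A \<le> card B + 1"
        proof (rule card_le_separated[OF fA fB])
          fix a b assume ab: "a \<in> A" "b \<in> A" "a < b" "\<And>x. a < x \<Longrightarrow> x < b \<Longrightarrow> x \<notin> A"
          then have "poly G a * poly G b < 0"
            using less.prems False nzG by (intro consecutive_zeros_alternate[of P G]) (auto simp: A_def)
          then have "poly H a * poly H b < 0" using ab by (simp add: pH A_def)
          then show "\<exists>c\<in>B. a < c \<and> c < b" using poly_IVT[OF ab(3)] by (auto simp: B_def)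
        qed
        moreover have "degree H \<le> degree P" using dH cH True
          by (metis eq_zero_or_degree_less diff_self le_SucE less_Suc_eq_le nzH)
        ultimately show ?thesis using cA cB by linarith
      next
        case False
        define c where "c = lead_coeff P"
        have c0: "c \<noteq> 0" using less.prems by (simp add: c_def)
        have pos: "c * (lead_coeff G - lead_coeff P) > 0"
          using less.prems(4) c0 False by (simp add: c_def order_less_le)
        then have dH': "degree H = Suc (degree P)" using dH cH by (metis False le_antisym le_degree right_minus_eq)
        have lH: "lead_coeff (smult c H) > 0" using pos cH dH' c0 by simp
        have "lead_coeff (smult c P) = c\<^sup>2" by (simp add: c_def power2_eq_square)
        then have lP: "lead_coeff (smult c P) > 0" using c0 by (simp only: zero_less_power2) simp
        obtain n1 where n1: "\<And>y. y \<ge> n1 \<Longrightarrow> poly (smult c H) y > 0" using poly_pinfty_gt_lc[OF lH] lH by force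
        obtain n2 where n2: "\<And>y. y \<ge> n2 \<Longrightarrow> poly (smult c P) y > 0" using poly_pinfty_gt_lc[OF lP] lP by force
        \<comment> \<open>From \<open>x\<close> on, \<open>c * H\<close> and \<open>c * P\<close>
          are positive, so R(y) = H(y) + (y - x) P(y) cannot vanish there. All zeros a of
          \<open>R\<close> thus lie left of \<open>x\<close>, where H(a) = (x - a) P(a) has the sign
          of P(a).\<close>
        define x where "x = max n1 n2"
        define R where "R = G - smult x P"
        have Rpos: "poly R y \<noteq> 0" if "y \<ge> x" for y
        proof -
          have "c * poly H y > 0" "c * poly P y > 0" using n1[of y] n2[of y] that by (simp_all add: x_def)
          then have "c * poly H y + (y - x) * (c * poly P y) > 0" using that by (simp add: add_pos_nonneg)
          moreover have "c * poly H y + (y - x) * (c * poly P y) = c * poly R y" by (simp add: pH R_def algebra_simps)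
          ultimately show ?thesis by auto
        qed
        have dsx: "degree (smult x P) < degree G" using le_less_trans[OF degree_smult_le] less.prems(3) by simp
        have dR: "degree R = Suc (degree P)" unfolding R_def
          using degree_add_eq_left[of "- smult x P" G] dsx less.prems(3) by simp
        have nzR: "R \<noteq> 0" using dR by auto
        have penR: "pencil R P" using pencil_comb[OF less.prems(1), of "- x" 1 1 0] by (simp add: R_def)
        then have hypR: "hyperbolic R" using pencil_left nzR hyp0_def by blast
        have copR: "\<not> (poly R y = 0 \<and> poly P y = 0)" for y
          using \<open>\<nexists>x. poly P x = 0 \<and> poly G x = 0\<close> by (auto simp: R_def)
        define A where "A = {x. poly R x = 0}"
        have fA: "finite A" unfolding A_def using nzR poly_roots_finite by blast
        have dRP: "degree R \<noteq> degree P" using dR by simp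
        have "rsquarefree R" using pencil_rsquarefree[OF penR nzR less.prems(2) dRP copR] .
        then have cA: "card A = Suc (degree P)" using hyperbolic_size[OF hypR] dR by (simp add: proots_rsquarefree A_def)
        have "card A \<le> card B + 1"
        proof (rule card_le_separated[OF fA fB])
          fix a b assume ab: "a \<in> A" "b \<in> A" "a < b" "\<And>x. a < x \<Longrightarrow> x < b \<Longrightarrow> x \<notin> A"
          then have *: "poly P a * poly P b < 0"
            by (intro consecutive_zeros_alternate[OF penR nzR less.prems(2) dRP copR]) (auto simp: A_def)
          have "a < x" "b < x" using ab Rpos[of a] Rpos[of b] by (auto simp: A_def not_le[symmetric])
          then have "((x - a) * (x - b)) * (poly P a * poly P b) < 0" using * by (intro mult_pos_neg[OF mult_pos_pos]) auto
          moreover have "poly H a = (x - a) * poly P a" "poly H b = (x - b) * poly P b"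
            using ab by (simp_all add: A_def pH R_def algebra_simps)
          ultimately have "poly H a * poly H b < 0" by (simp only: mult_ac)
          then show "\<exists>c\<in>B. a < c \<and> c < b" using poly_IVT[OF ab(3)] by (auto simp: B_def)
        qed
        then show ?thesis using cA cB dH by linarith
      qed
    qed
    then show ?thesis unfolding H_def hyp0_def by blast
  qed
qed

text \<open>The degree bounds and the nonzero coefficient at \<open>N\<close> encode the Fuchs index
  and non-degeneracy without a maximum. Sums start at 0, with vanishing low coefficients allowed, so
  that the class is closed under the commutator with multiplication by z.\<close>

locale hyp_op =
  fixes Q :: "nat \<Rightarrow> real poly" and N r :: nat
  assumes Q_eq_0: "\<And>k. k > N \<Longrightarrow> Q k = 0"
    and top_coeff: "coeff (Q N) (N + r) \<noteq> 0"
    and degree_Q: "\<And>k. degree (Q k) \<le> k + r"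
    and preserves: "\<And>f. hyperbolic f \<Longrightarrow> hyp0 (diff_op Q 0 N f)"
begin

abbreviation T :: "real poly \<Rightarrow> real poly" where
  "T \<equiv> diff_op Q 0 N"

abbreviation lc :: "nat \<Rightarrow> real" where
  "lc k \<equiv> coeff (Q k) (k + r)"

abbreviation \<sigma> :: real where
  "\<sigma> \<equiv> lc N"

definition \<gamma> :: "nat \<Rightarrow> real" where
  "\<gamma> j = (\<Sum>k=0..N. lc k * falling j k)"

lemma T_add: "T (f + g) = T f + T g"
  by (simp add: diff_op_def higher_pderiv_add algebra_simps sum.distrib)

lemma T_smult: "T (smult c f) = smult c (T f)"
proof -
  have "smult c (T f) = [:c:] * T f" by (simp add: mult_pCons_left)
  also have "\<dots> = (\<Sum>k=0..N. [:c:] * (Q k * (pderiv ^^ k) f))"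
    unfolding diff_op_def sum_distrib_left ..
  also have "\<dots> = T (smult c f)" by (simp add: diff_op_def higher_pderiv_smult mult_pCons_left)
  finally show ?thesis ..
qed

lemma T_diff: "T (f - g) = T f - T g"
  using T_add[of f "smult (- 1) g"] unfolding T_smult by simp

lemma T_0 [simp]: "T 0 = 0"
  by (simp add: diff_op_def)

lemma preserves0: "hyp0 f \<Longrightarrow> hyp0 (T f)"
  using preserves by (auto simp: hyp0_def)

lemma T_pencil: "pencil f g \<Longrightarrow> pencil (T f) (T g)"
  unfolding pencil_def by (metis T_add T_smult preserves0)

lemma degree_T: "degree f \<le> j \<Longrightarrow> degree (T f) \<le> j + r"
  unfolding diff_op_def
proof (intro degree_sum_le)
  fix k assume j: "degree f \<le> j"
  show "degree (Q k * (pderiv ^^ k) f) \<le> j + r"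
  proof (cases "k \<le> degree f")
    case True
    have "degree (Q k * (pderiv ^^ k) f) \<le> (k + r) + (degree f - k)"
      by (intro order_trans[OF degree_mult_le] add_mono degree_Q) (simp add: degree_higher_pderiv)
    then show ?thesis using True j by simp
  qed (simp add: higher_pderiv_eq_0)
qed auto

lemma coeff_T_top: "degree f \<le> j \<Longrightarrow> coeff (T f) (j + r) = \<gamma> j * coeff f j"
proof -
  assume j: "degree f \<le> j"
  have "coeff (Q k * (pderiv ^^ k) f) (j + r) = lc k * falling j k * coeff f j" for k
  proof (cases "k \<le> j")
    case True
    then have "coeff (Q k * (pderiv ^^ k) f) ((k + r) + (j - k)) = lc k * coeff ((pderiv ^^ k) f) (j - k)"
      using j by (intro coeff_mult_bounds degree_Q) (simp add: degree_higher_pderiv)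
    then show ?thesis using True j by (simp add: coeff_higher_pderiv_top add_ac mult_ac)
  qed (use j in \<open>simp add: higher_pderiv_eq_0 falling_eq_0\<close>)
  then show ?thesis by (simp add: diff_op_def coeff_sum \<gamma>_def sum_distrib_right)
qed

section \<open>Growth, signs and nonvanishing of the leading coefficients
  \<open>\<gamma>\<close>\<close>

definition \<Gamma> :: "real poly" where
  "\<Gamma> = (\<Sum>k=0..N. smult (lc k) (\<Prod>i<k. [:- real i, 1:]))"

lemma poly_\<Gamma>: "poly \<Gamma> (real j) = \<gamma> j"
  by (simp add: \<Gamma>_def \<gamma>_def falling_def poly_sum poly_prod)

lemma degree_\<Gamma>: "degree \<Gamma> = N" and lead_\<Gamma>: "lead_coeff \<Gamma> = \<sigma>"
proof -
  have d: "degree (\<Prod>i<k. [:- real i, 1:]) = k" for k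
    by (subst degree_prod_eq_sum_degree) auto
  have l: "coeff (\<Prod>i<k. [:- real i, 1:]) k = 1" for k
    using lead_coeff_prod[of "\<lambda>i. [:- real i, 1:]" "{..<k}"] unfolding d by simp
  have "coeff \<Gamma> N = (\<Sum>k=0..N. lc k * coeff (\<Prod>i<k. [:- real i, 1:]) N)"
    by (simp add: \<Gamma>_def coeff_sum)
  also have "\<dots> = lc N * coeff (\<Prod>i<N. [:- real i, 1:]) N"
    by (subst sum.remove[of _ N]) (auto intro!: sum.neutral simp: coeff_eq_0 d)
  finally have c: "coeff \<Gamma> N = \<sigma>" by (simp add: l)
  have "degree \<Gamma> \<le> N" unfolding \<Gamma>_def
    by (intro degree_sum_le) (auto intro!: order_trans[OF degree_smult_le] simp: d)
  then show d: "degree \<Gamma> = N" using c top_coeff le_degree by (metis le_antisym)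
  then show "lead_coeff \<Gamma> = \<sigma>" using c by simp
qed

lemma \<gamma>_eventually: "\<exists>J. \<forall>j\<ge>J. \<gamma> j * \<sigma> \<ge> \<sigma>\<^sup>2"
proof -
  have "lead_coeff (smult \<sigma> \<Gamma>) = \<sigma>\<^sup>2"
    using lead_\<Gamma> by (simp add: power2_eq_square)
  moreover have "\<sigma>\<^sup>2 > 0" using top_coeff by simp
  ultimately obtain x where x: "\<And>y. y \<ge> x \<Longrightarrow> poly (smult \<sigma> \<Gamma>) y \<ge> \<sigma>\<^sup>2"
    using poly_pinfty_gt_lc[of "smult \<sigma> \<Gamma>"] by metis
  obtain J where "real J \<ge> x" using real_arch_simple by blast
  then have "\<gamma> j * \<sigma> \<ge> \<sigma>\<^sup>2" if "j \<ge> J" for j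
    using x[of "real j"] that by (simp add: poly_\<Gamma> mult.commute)
  then show ?thesis by blast
qed

text \<open>Conjugation by the dilation with factor l and division by \<open>l ^ r\<close> replaces
  \<open>Q k\<close> by Q_k(l z) / l^(k + r). As l tends to infinity, only the term of degree k + r
  survives.\<close>

lemma leading_part_preserves:
  assumes f: "hyperbolic f"
  shows "hyp0 (\<Sum>k=0..N. smult (lc k) (monom 1 (k + r)) * (pderiv ^^ k) f)"
proof (rule hyp0_limit)
  define P where "P l = smult (1 / l ^ r) (pcompose (T (pcompose f [:0, 1 / l:])) [:0, l:])" for l :: real
  show "\<forall>\<^sub>F l in at_top. hyp0 (P l)"
    using eventually_gt_at_top[of 0]
    by eventually_elim (auto simp: P_def intro!: hyp0_smult hyp0_scale preserves0[unfolded hyp0_def[of f]] preserves hyperbolic_scale f)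
  show "\<forall>\<^sub>F l in at_top. degree (P l) \<le> degree f + r"
    using eventually_gt_at_top[of 0]
    by eventually_elim (auto simp: P_def degree_pcompose intro!: degree_T)
  show "((\<lambda>l. cpoly (P l) z) \<longlongrightarrow> cpoly (\<Sum>k=0..N. smult (lc k) (monom 1 (k + r)) * (pderiv ^^ k) f) z) at_top" for z
  proof -
    have mon: "cpoly (monom 1 m) z = z ^ m" for m
      by (induction m) (auto simp: monom_Suc)
    have lim: "((\<lambda>l. \<Sum>k=0..N. cpoly (Q k) (of_real l * z) / of_real l ^ (k + r) * cpoly ((pderiv ^^ k) f) z)
       \<longlongrightarrow> (\<Sum>k=0..N. of_real (lc k) * z ^ (k + r) * cpoly ((pderiv ^^ k) f) z)) at_top"
      by (intro tendsto_sum tendsto_mult tendsto_const cpoly_scale_limit degree_Q)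
    have "\<forall>\<^sub>F l in at_top. (\<Sum>k=0..N. cpoly (Q k) (of_real l * z) / of_real l ^ (k + r) * cpoly ((pderiv ^^ k) f) z) = cpoly (P l) z"
      using eventually_gt_at_top[of 0]
    proof eventually_elim
      case (elim l)
      then show ?case
        by (simp add: P_def cpoly_pcompose_scale diff_op_def higher_pderiv_scale sum_distrib_left power_add power_divide field_simps)
    qed
    from Lim_transform_eventually[OF lim this] show ?thesis by (simp add: mon mult.assoc)
  qed
qed simp

lemma leading_part_monom:
  "(\<Sum>k=0..N. smult (lc k) (monom 1 (k + r)) * (pderiv ^^ k) (monom c m)) = monom (c * \<gamma> m) (m + r)"
proof -
  have "smult (lc k) (monom 1 (k + r)) * (pderiv ^^ k) (monom c m) = monom (c * (lc k * falling m k)) (m + r)" for k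
    by (cases "k \<le> m") (auto simp: higher_pderiv_monom_falling smult_monom mult_monom falling_eq_0 mult_ac)
  then show ?thesis by (simp add: \<gamma>_def sum_distrib_left flip: monom_sum)
qed

text \<open>The leading part is diagonal on monomials up to a shift by \<open>r\<close>, so it
  multiplies the coefficients of the quadratic factor by values of \<open>\<gamma>\<close>; the new
  discriminant is nonnegative. The quadratics z^2 - 1 and (z - 1)^2 yield
  \<open>\<gamma>_parity\<close> and \<open>\<gamma>_log_concave\<close>.\<close>

lemma leading_part_quadratic:
  assumes "hyperbolic (monom 1 j * [:c, b, a:])"
  shows "4 * (a * \<gamma> (j + 2)) * (c * \<gamma> j) \<le> (b * \<gamma> (j + 1))\<^sup>2"
proof -
  have split: "monom 1 j * [:c, b, a:] = monom c j + monom b (j + 1) + monom a (j + 2)" for a b c :: real and j :: nat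
    by (induction j) (auto simp: monom_Suc monom_0 mult_pCons_left algebra_simps numeral_2_eq_2)
  let ?L = "\<lambda>f. \<Sum>k=0..N. smult (lc k) (monom 1 (k + r)) * (pderiv ^^ k) f"
  have "?L (f + g) = ?L f + ?L g" for f g
    by (simp add: higher_pderiv_add algebra_simps smult_add_right sum.distrib)
  then have "?L (monom 1 j * [:c, b, a:]) = monom (c * \<gamma> j) (j + r) + monom (b * \<gamma> (j + 1)) (j + 1 + r) + monom (a * \<gamma> (j + 2)) (j + 2 + r)"
    unfolding split by (simp only: leading_part_monom)
  also have "\<dots> = monom 1 (j + r) * [:c * \<gamma> j, b * \<gamma> (j + 1), a * \<gamma> (j + 2):]"
    unfolding split by (simp add: add_ac)
  finally have "hyp0 (monom 1 (j + r) * [:c * \<gamma> j, b * \<gamma> (j + 1), a * \<gamma> (j + 2):])"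
    using leading_part_preserves[OF assms] by simp
  moreover have "hyperbolic (monom 1 (j + r))"
    using hyperbolic_power[of "[:0, 1:]" "j + r"] by (simp add: monom_altdef)
  ultimately have "hyp0 [:c * \<gamma> j, b * \<gamma> (j + 1), a * \<gamma> (j + 2):]"
    using hyp0_mult_iff by blast
  then show ?thesis by (rule hyp0_quadratic)
qed

lemma \<gamma>_parity: "\<gamma> j * \<gamma> (j + 2) \<ge> 0"
proof -
  have "[:-1, 0, 1:] = [:- 1, 1:] * [:1, 1:: real:]" by (simp add: mult_pCons_left)
  then have "hyperbolic (monom 1 j * [:-1, 0, 1:])"
    using hyperbolic_power[of "[:0, 1:]" j] by (simp add: hyperbolic_mult_iff monom_altdef)
  then show ?thesis using leading_part_quadratic[of j "-1" 0 1] by (simp add: mult_ac)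
qed

lemma \<gamma>_log_concave: "\<gamma> j * \<gamma> (j + 2) \<le> \<gamma> (j + 1) ^ 2"
proof -
  have "[:1, -2, 1:] = [:- 1, 1:] * [:- 1, 1:: real:]" by (simp add: mult_pCons_left)
  then have "hyperbolic (monom 1 j * [:1, -2, 1:])"
    using hyperbolic_power[of "[:0, 1:]" j] by (simp add: hyperbolic_mult_iff monom_altdef)
  then show ?thesis using leading_part_quadratic[of j 1 "-2" 1] by (simp add: mult_ac power_mult_distrib)
qed

text \<open>This is the dividing line for the degree j: below it \<open>T\<close> annihilates all
  polynomials of degree j, above it \<open>T\<close> raises the degree by exactly
  \<open>r\<close>.\<close>

definition nz :: "nat \<Rightarrow> bool" where
  "nz j \<longleftrightarrow> (\<exists>k\<le>j. Q k \<noteq> 0)"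

lemma nz_mono: "nz i \<Longrightarrow> i \<le> j \<Longrightarrow> nz j"
  unfolding nz_def by (meson order_trans)

lemma T_eq_0: "\<not> nz (degree f) \<Longrightarrow> T f = 0"
  unfolding diff_op_def nz_def
  by (intro sum.neutral) (metis higher_pderiv_eq_0 linorder_not_le mult_eq_0_iff)

lemma poly_T_linear_power:
  "poly (T ([:- x, 1:] ^ j)) z = (\<Sum>k=0..N. poly (Q k) z * falling j k * (z - x) ^ (j - k))"
  by (simp add: diff_op_def poly_sum higher_pderiv_linear_power poly_power algebra_simps)

text \<open>For fixed z with Q_m(z) nonzero, the value at z of the image of (z - x)^j is a
  polynomial in w = z - x with a nonzero coefficient at w^(j - m).\<close>

lemma T_linear_power_nonzero:
  assumes "nz j"
  shows "\<exists>x. T ([:- x, 1:] ^ j) \<noteq> 0"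
proof (rule ccontr)
  assume "\<not> ?thesis"
  then have T0: "T ([:- x, 1:] ^ j) = 0" for x by blast
  obtain m where m: "m \<le> j" "Q m \<noteq> 0" using assms by (auto simp: nz_def)
  then obtain z where z: "poly (Q m) z \<noteq> 0" using poly_all_0_iff_0 by blast
  have mN: "m \<le> N" using m Q_eq_0[of m] by (meson linorder_not_le)
  define R where "R = (\<Sum>k=0..N. monom (poly (Q k) z * falling j k) (j - k))"
  have "poly R w = 0" for w
    using poly_T_linear_power[of "z - w" j z] T0[of "z - w"] by (simp add: R_def poly_sum poly_monom)
  then have "R = 0" using poly_all_0_iff_0 by blast
  moreover have "coeff R (j - m) = poly (Q m) z * falling j m"
  proof -
    have "coeff R (j - m) = (\<Sum>k=0..N. if j - k = j - m then poly (Q k) z * falling j k else 0)"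
      by (auto simp: R_def coeff_sum intro!: sum.cong)
    \<comment> \<open>Since subtraction is truncated, \<open>j - k = j - m\<close> may also hold for
      some \<open>k > j\<close>; there \<open>falling j k = 0\<close>.\<close>
    also have "\<dots> = (\<Sum>k\<in>{m}. poly (Q k) z * falling j k)"
      using mN m by (intro sum.mono_neutral_cong_right) (auto simp: falling_eq_0 not_le)
    finally show ?thesis by simp
  qed
  ultimately show False using z falling_pos[OF m(1)] by simp
qed

lemma degree_T_eq: "\<gamma> (degree f) \<noteq> 0 \<Longrightarrow> f \<noteq> 0 \<Longrightarrow> degree (T f) = degree f + r"
  using coeff_T_top[of f "degree f"] degree_T[of f "degree f"] le_degree[of "T f" "degree f + r"] by simp

text \<open>Descent from large indices: degrees in a pencil differ by at most one, so the full
  degree of the image of (z - x)^(j + 1) forces the full degree of the image of (z - x)^j, provided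
  the latter is nonzero.\<close>

lemma \<gamma>_nonzero:
  assumes "nz j"
  shows "\<gamma> j \<noteq> 0"
proof -
  obtain J where J: "\<And>i. i \<ge> J \<Longrightarrow> \<gamma> i * \<sigma> \<ge> \<sigma>\<^sup>2" using \<gamma>_eventually by blast
  have big: "\<gamma> i \<noteq> 0" if "i \<ge> J" for i using J[OF that] top_coeff by auto
  have "nz j \<Longrightarrow> \<gamma> j \<noteq> 0" for j
  proof (induction "J - j" arbitrary: j)
    case 0
    then show ?case using big by simp
  next
    case (Suc d)
    then have g: "\<gamma> (Suc j) \<noteq> 0" using nz_mono by auto
    obtain x where x: "T ([:- x, 1:] ^ j) \<noteq> 0" using T_linear_power_nonzero Suc by blast
    define H where "H = [:- x, 1:] ^ j"
    define P where "P = [:- x, 1:] * H"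
    have dH: "degree H = j" "coeff H j = 1" unfolding H_def
      by (simp_all add: degree_power_eq lead_coeff_power coeff_linear_power)
    have dP: "degree P = Suc j" unfolding P_def using dH by (subst degree_mult_eq) auto
    have nzP: "P \<noteq> 0" using dP by auto
    have "pencil (T P) (T H)" unfolding P_def H_def by (intro T_pencil pencil_linear hyperbolic_power) simp
    moreover have dTP: "degree (T P) = Suc j + r" using degree_T_eq[of P] g dP nzP by simp
    moreover have "T P \<noteq> 0" using dTP by auto
    ultimately have "degree (T P) \<le> degree (T H) + 1" using x by (intro pencil_degree) (auto simp: H_def)
    then have "degree (T H) = j + r" using dTP degree_T[of H j] dH by simp
    moreover have "T H \<noteq> 0" using x by (simp add: H_def)
    ultimately have "coeff (T H) (j + r) \<noteq> 0" by (metis leading_coeff_0_iff)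
    then show ?case using coeff_T_top[of H j] dH by auto
  qed
  then show ?thesis using assms by blast
qed

text \<open>Nonzero values two steps apart have equal signs by \<open>\<gamma>_parity\<close>, so
  the sign of \<open>\<sigma>\<close> descends from large indices.\<close>

lemma \<gamma>_sign: "nz j \<Longrightarrow> \<gamma> j * \<sigma> > 0"
proof -
  assume nz: "nz j"
  obtain J where J: "\<And>i. i \<ge> J \<Longrightarrow> \<gamma> i * \<sigma> \<ge> \<sigma>\<^sup>2" using \<gamma>_eventually by blast
  have big: "\<gamma> i * \<sigma> > 0" if "i \<ge> J" for i
    using J[OF that] top_coeff by (meson less_le_trans zero_less_power2)
  have "nz i \<Longrightarrow> \<gamma> i * \<sigma> > 0" for i
  proof (induction "J - i" arbitrary: i rule: less_induct)
    case less
    show ?case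
    proof (cases "i \<ge> J")
      case False
      then have 1: "\<gamma> (i + 2) * \<sigma> > 0" using less nz_mono[of i "i + 2"] by simp
      have "\<gamma> i \<noteq> 0" "\<gamma> i * \<gamma> (i + 2) \<ge> 0" using \<gamma>_nonzero less.prems \<gamma>_parity by auto
      then show ?thesis using 1 by (auto simp: zero_less_mult_iff zero_le_mult_iff)
    qed (use big in auto)
  qed
  then show ?thesis using nz by blast
qed

lemma degree_T_nz: "nz (degree f) \<Longrightarrow> f \<noteq> 0 \<Longrightarrow> degree (T f) = degree f + r"
  and lead_coeff_T: "nz (degree f) \<Longrightarrow> lead_coeff (T f) = \<gamma> (degree f) * lead_coeff f"
proof -
  show *: "nz (degree f) \<Longrightarrow> f \<noteq> 0 \<Longrightarrow> degree (T f) = degree f + r"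
    using degree_T_eq \<gamma>_nonzero by blast
  show "nz (degree f) \<Longrightarrow> lead_coeff (T f) = \<gamma> (degree f) * lead_coeff f"
    using * coeff_T_top[of f "degree f"] by (cases "f = 0") auto
qed

lemma T_nonzero: "nz (degree f) \<Longrightarrow> f \<noteq> 0 \<Longrightarrow> T f \<noteq> 0"
  using lead_coeff_T[of f] \<gamma>_nonzero by auto

lemma T_hyperbolic: "nz (degree f) \<Longrightarrow> hyperbolic f \<Longrightarrow> hyperbolic (T f)"
  using T_nonzero preserves hyp0_def hyperbolic_nz by blast

text \<open>Log-concavity makes the ratios \<open>\<gamma> (j + 1) / \<gamma> j\<close> decrease, so a single ratio below 1 would
  force exponential decay, which is impossible for a polynomial.\<close>
lemma \<gamma>_mono:
  assumes "nz j"
  shows "\<gamma> j * \<sigma> \<le> \<gamma> (Suc j) * \<sigma>"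
proof (rule ccontr)
  define a where "a i = \<gamma> (j + i) * \<sigma>" for i
  assume "\<not> ?thesis"
  then have less: "a 1 < a 0" by (simp add: a_def)
  have pos: "a i > 0" for i unfolding a_def using \<gamma>_sign nz_mono[OF assms] by simp
  have conc: "a i * a (i + 2) \<le> a (i + 1) ^ 2" for i
  proof -
    have "(\<gamma> (j + i) * \<gamma> (j + i + 2)) * \<sigma>\<^sup>2 \<le> (\<gamma> (j + i + 1))\<^sup>2 * \<sigma>\<^sup>2"
      by (intro mult_right_mono \<gamma>_log_concave) simp
    then show ?thesis by (simp add: a_def power2_eq_square mult_ac)
  qed
  define q where "q = a 1 / a 0"
  have q: "0 < q" "q < 1" using less pos by (auto simp: q_def)
  have step: "a (Suc i) \<le> q * a i" for i
  proof (induction i)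
    case 0
    then show ?case using pos[of 0] by (simp add: q_def)
  next
    case (Suc i)
    have "a i * a (i + 2) \<le> a (i + 1) * a (i + 1)" using conc[of i] by (simp add: power2_eq_square)
    also have "\<dots> \<le> a (i + 1) * (q * a i)" using Suc pos[of "i + 1"] by (intro mult_left_mono) auto
    finally show ?case using pos[of i] by (simp add: mult_ac)
  qed
  have bound: "a i \<le> q ^ i * a 0" for i
  proof (induction i)
    case (Suc i)
    have "a (Suc i) \<le> q * a i" by (rule step)
    also have "\<dots> \<le> q * (q ^ i * a 0)" using Suc q by (intro mult_left_mono) auto
    finally show ?case by (simp add: mult_ac)
  qed simp
  obtain J where J: "\<And>i. i \<ge> J \<Longrightarrow> \<gamma> i * \<sigma> \<ge> \<sigma>\<^sup>2" using \<gamma>_eventually by blast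
  have l: "(\<lambda>i. q ^ i * a 0) \<longlonglongrightarrow> 0 * a 0" using q by (intro tendsto_intros) auto
  have "\<sigma>\<^sup>2 \<le> 0 * a 0"
  proof (rule tendsto_lowerbound[OF l])
    have "\<sigma>\<^sup>2 \<le> q ^ i * a 0" if "i \<ge> J" for i
      using J[of "j + i"] bound[of i] that unfolding a_def by linarith
    then show "\<forall>\<^sub>F i in sequentially. \<sigma>\<^sup>2 \<le> q ^ i * a 0"
      unfolding eventually_sequentially by blast
  qed simp
  then show False using top_coeff by simp
qed

section \<open>The commutator of \<open>T\<close> with multiplication by z\<close>

lemma T_X_mult:
  "T ([:0, 1:] * f) = [:0, 1:] * T f + (\<Sum>k=0..N. smult (real k) (Q k) * (pderiv ^^ (k - 1)) f)"
  unfolding diff_op_def higher_pderiv_X_mult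
  by (simp add: distrib_left sum.distrib sum_distrib_left mult.left_commute)

text \<open>The images of f and z f form a pencil whose leading coefficients have the ratio
  \<open>\<gamma> (d + 1) / \<gamma> d\<close>, where d is the degree of \<open>f\<close>. By
  \<open>\<gamma>_mono\<close> it is at least 1, as \<open>pencil_minus_X_mult\<close>
  requires.\<close>

lemma commutator_preserves:
  assumes f: "hyperbolic f"
  shows "hyp0 (T ([:0, 1:] * f) - [:0, 1:] * T f)"
proof (cases "T f = 0")
  case True
  then show ?thesis using f by (simp add: preserves hyperbolic_mult_iff)
next
  case False
  then have nz: "nz (degree f)" using T_eq_0 by blast
  have f0: "f \<noteq> 0" using f hyperbolic_nz by blast
  have dX: "degree ([:0, 1:] * f) = Suc (degree f)" using f0 by (subst degree_mult_eq) auto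
  have lX: "lead_coeff ([:0, 1:] * f) = lead_coeff f" by (subst lead_coeff_mult) simp
  have nz': "nz (degree ([:0, 1:] * f))" unfolding dX using nz_mono[OF nz] by simp
  have X0: "[:0, 1:] * f \<noteq> 0" using f0 by simp
  have "lead_coeff (T f) * (lead_coeff (T ([:0, 1:] * f)) - lead_coeff (T f)) =
        (lead_coeff f)\<^sup>2 * (\<gamma> (degree f) * (\<gamma> (Suc (degree f)) - \<gamma> (degree f)))"
    unfolding lead_coeff_T[OF nz] lead_coeff_T[OF nz'] lX unfolding dX by (simp add: power2_eq_square algebra_simps)
  moreover have "\<gamma> (degree f) * (\<gamma> (Suc (degree f)) - \<gamma> (degree f)) \<ge> 0"
    using \<gamma>_sign[OF nz] \<gamma>_mono[OF nz] by (auto simp: zero_less_mult_iff mult_le_cancel_right zero_le_mult_iff)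
  ultimately show ?thesis
    using degree_T_nz[OF nz f0] degree_T_nz[OF nz' X0] dX False
    by (intro pencil_minus_X_mult[OF pencil_sym[OF T_pencil[OF pencil_linear[OF f, of 0]]]]) auto
qed

text \<open>The commutator is the formal derivative of \<open>T\<close> with respect to D. Iterating
  it moves every coefficient, up to a positive factor, to position 0.\<close>

lemma shift: "N = Suc N' \<Longrightarrow> hyp_op (\<lambda>k. smult (real (Suc k)) (Q (Suc k))) N' (Suc r)"
proof
  assume N: "N = Suc N'"
  show "smult (real (Suc k)) (Q (Suc k)) = 0" if "k > N'" for k using Q_eq_0[of "Suc k"] that N by simp
  show "coeff (smult (real (Suc N')) (Q (Suc N'))) (N' + Suc r) \<noteq> 0" using top_coeff N by simp
  show "degree (smult (real (Suc k)) (Q (Suc k))) \<le> k + Suc r" for k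
    using degree_Q[of "Suc k"] by (intro order_trans[OF degree_smult_le]) simp
  fix f assume f: "hyperbolic f"
  have "(\<Sum>k=0..N. smult (real k) (Q k) * (pderiv ^^ (k - 1)) f) = diff_op (\<lambda>k. smult (real (Suc k)) (Q (Suc k))) 0 N' f"
    unfolding diff_op_def N by (subst sum.atLeast0_atMost_Suc_shift) simp
  then show "hyp0 (diff_op (\<lambda>k. smult (real (Suc k)) (Q (Suc k))) 0 N' f)"
    using commutator_preserves[OF f] unfolding T_X_mult by simp
qed

end

subsection \<open>The coefficients of the operator\<close>

context hyp_op
begin

lemma nz_0: "Q 0 \<noteq> 0 \<Longrightarrow> nz j"
  by (auto simp: nz_def)

lemma T_1: "T 1 = Q 0"
proof -
  have "T 1 = (\<Sum>k=0..N. if k = 0 then Q 0 else 0)"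
    unfolding diff_op_def by (intro sum.cong) (auto simp: higher_pderiv_eq_0)
  then show ?thesis by simp
qed

lemma \<gamma>_0: "\<gamma> 0 = lc 0"
proof -
  have "\<gamma> 0 = (\<Sum>k=0..N. if k = 0 then lc 0 else 0)"
    unfolding \<gamma>_def by (intro sum.cong) (auto simp: falling_eq_0)
  then show ?thesis by simp
qed

lemma T_linear: "N \<ge> 1 \<Longrightarrow> T [:- x, 1:] = [:- x, 1:] * Q 0 + Q 1"
proof -
  assume N: "N \<ge> 1"
  have "T [:- x, 1:] = (\<Sum>k=0..N. if k = 0 then [:- x, 1:] * Q 0 else if k = 1 then Q 1 else 0)"
    unfolding diff_op_def
  proof (intro sum.cong refl)
    fix k
    show "Q k * (pderiv ^^ k) [:- x, 1:] = (if k = 0 then [:- x, 1:] * Q 0 else if k = 1 then Q 1 else 0)"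
      by (auto simp: higher_pderiv_eq_0 pderiv_pCons one_pCons[symmetric] mult.commute)
  qed
  also have "\<dots> = (\<Sum>k\<in>{0, 1::nat}. if k = 0 then [:- x, 1:] * Q 0 else if k = 1 then Q 1 else 0)"
    by (rule sum.mono_neutral_right) (use N in auto)
  finally show ?thesis by simp
qed

lemma Q_0_hyperbolic: "Q 0 \<noteq> 0 \<Longrightarrow> hyperbolic (Q 0)" and Q_0_sign: "Q 0 \<noteq> 0 \<Longrightarrow> lc 0 * \<sigma> > 0"
  using T_1 preserves[of 1] \<gamma>_0 \<gamma>_sign[of 0] nz_0[of 0] by (auto simp: hyp0_def)

text \<open>If \<open>Q 1 = 0\<close>, then \<open>\<gamma> 0 = \<gamma> 1\<close>, and by monotonicity and log-concavity \<open>\<gamma>\<close> is constant.\<close>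
lemma Q_1_nonzero:
  assumes "Q 0 \<noteq> 0" "N \<ge> 1"
  shows "Q 1 \<noteq> 0"
proof
  assume Q1: "Q 1 = 0"
  have "\<gamma> 1 = (\<Sum>k=0..N. if k = 0 then lc 0 else 0)"
    unfolding \<gamma>_def
  proof (intro sum.cong refl)
    fix k show "lc k * falling 1 k = (if k = 0 then lc 0 else 0)"
      using Q1 by (cases "k = 0 \<or> k = 1") (auto simp: falling_eq_0)
  qed
  then have g1: "\<gamma> 1 = \<gamma> 0" by (simp add: \<gamma>_0)
  have pos: "\<gamma> i * \<sigma> > 0" for i using \<gamma>_sign nz_0 assms by blast
  have "\<gamma> (Suc i) * \<sigma> = \<gamma> i * \<sigma>" for i
  proof (induction i)
    case (Suc i)
    have "(\<gamma> i * \<sigma>) * (\<gamma> (Suc (Suc i)) * \<sigma>) = (\<gamma> i * \<gamma> (i + 2)) * \<sigma>\<^sup>2"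
      by (simp add: power2_eq_square mult_ac)
    also have "\<dots> \<le> (\<gamma> (i + 1))\<^sup>2 * \<sigma>\<^sup>2" by (intro mult_right_mono \<gamma>_log_concave) simp
    also have "\<dots> = (\<gamma> i * \<sigma>) * (\<gamma> i * \<sigma>)" using Suc top_coeff by (simp add: power2_eq_square mult_ac)
    finally have "\<gamma> (Suc (Suc i)) * \<sigma> \<le> \<gamma> i * \<sigma>"
      using mult_le_cancel_left_pos[OF pos[of i]] by blast
    moreover have "\<gamma> (Suc i) * \<sigma> \<le> \<gamma> (Suc (Suc i)) * \<sigma>" using \<gamma>_mono nz_0 assms by blast
    ultimately show ?case using Suc by linarith
  qed (use g1 in simp)
  then have "\<gamma> (Suc i) = \<gamma> i" for i using top_coeff by (metis mult_cancel_right)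
  then have "\<gamma> i = \<gamma> 0" for i by (induction i) auto
  then have "range real \<subseteq> {x. poly (\<Gamma> - [:\<gamma> 0:]) x = 0}" by (auto simp: poly_\<Gamma>)
  moreover have "infinite (range real)" using range_inj_infinite[of real] by (simp add: inj_on_def)
  ultimately have "\<Gamma> - [:\<gamma> 0:] = 0" using poly_roots_finite finite_subset by blast
  then have "\<Gamma> = [:\<gamma> 0:]" by simp
  then have "degree \<Gamma> = 0" by simp
  then show False using degree_\<Gamma> assms by simp
qed

text \<open>Let \<open>a\<close> be the smallest zero of \<open>Q 0\<close> and suppose
  \<open>a \<le> y\<close>. The image (z - a) Q_0 + Q_1 of z - a forms a pencil with
  \<open>Q 0\<close>, hence has a zero \<open>g \<le> a\<close>. Left of all zeros involved both
  summands have the same sign, so they cannot cancel at \<open>g\<close>; if \<open>g = a\<close>,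
  then \<open>Q 1\<close> would vanish at \<open>a\<close>.\<close>

lemma zeros_Q_0_Q_1:
  assumes Q0: "Q 0 \<noteq> 0" and N: "N \<ge> 1" and h1: "hyperbolic (Q 1)" and l1: "lc 1 * \<sigma> > 0"
    and y: "\<And>x. poly (Q 1) x = 0 \<Longrightarrow> y < x" and x: "poly (Q 0) x = 0"
  shows "y < x"
proof (rule ccontr)
  assume "\<not> y < x"
  define a where "a = Min {x. poly (Q 0) x = 0}"
  have fin: "finite {x. poly (Q 0) x = 0}" using Q0 poly_roots_finite by blast
  have a: "poly (Q 0) a = 0" "\<And>x. poly (Q 0) x = 0 \<Longrightarrow> a \<le> x"
    using Min_in[OF fin] x fin unfolding a_def by auto
  have ay: "a \<le> y" using a(2)[OF x] \<open>\<not> y < x\<close> by simp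
  have h0: "hyperbolic (Q 0)" and l0: "lc 0 * \<sigma> > 0" using Q_0_hyperbolic Q_0_sign Q0 by auto
  have d0: "degree (Q 0) = r" using degree_Q[of 0] l0 le_degree[of "Q 0" r] by force
  have d1: "degree (Q 1) = Suc r" using degree_Q[of 1] l1 le_degree[of "Q 1" "Suc r"] by force
  define G where "G = T [:- a, 1:]"
  have G: "G = [:- a, 1:] * Q 0 + Q 1" unfolding G_def using T_linear N by blast
  have dG: "degree G = Suc r" unfolding G_def using degree_T_nz[of "[:- a, 1:]"] nz_0[OF Q0] by simp
  have "pencil G (Q 0)" using T_pencil[OF pencil_linear[of 1 "- a"]] by (simp add: G_def T_1)
  then have "cnt (Q 0) a \<le> cnt G a" using pencil_cnt(1)[of G "Q 0" a] Q0 dG d0 by simp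
  moreover have "a \<in># filter_mset (\<lambda>y. y \<le> a) (proots (Q 0))" using a Q0 by simp
  then have "filter_mset (\<lambda>y. y \<le> a) (proots (Q 0)) \<noteq> {#}" by force
  then have "cnt (Q 0) a > 0" unfolding cnt_def by (simp only: nonempty_has_size)
  ultimately have "cnt G a > 0" by simp
  then have "filter_mset (\<lambda>y. y \<le> a) (proots G) \<noteq> {#}" unfolding cnt_def by (simp only: nonempty_has_size)
  then obtain g where "g \<in># filter_mset (\<lambda>y. y \<le> a) (proots G)" by (rule multiset_nonemptyE)
  moreover have "G \<noteq> 0" using dG by auto
  ultimately have g: "g \<le> a" "poly G g = 0" by auto
  have s1: "sgn (poly (Q 1) g) = sgn (lc 1) * (-1) ^ Suc r"
    using sgn_left_of_zeros[OF h1, of g] y ay g d1 by force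
  have "sgn (lc 0) = sgn (lc 1)" using l0 l1 by (auto simp: sgn_if zero_less_mult_iff)
  then have s0: "sgn (poly (Q 0) g) = sgn (lc 1) * (-1) ^ r" if "g < a"
    using sgn_left_of_zeros[OF h0, of g] a that d0 by force
  have eq: "(g - a) * poly (Q 0) g + poly (Q 1) g = 0" using g(2) by (simp add: G algebra_simps)
  have n1: "poly (Q 1) g \<noteq> 0" using y ay g by force
  show False
  proof (cases "g = a")
    case True
    then show False using eq n1 by simp
  next
    case False
    then have "sgn ((g - a) * poly (Q 0) g) = sgn (poly (Q 1) g)"
      using s0 s1 g by (simp add: sgn_mult)
    moreover have "sgn ((g - a) * poly (Q 0) g) = - sgn (poly (Q 1) g)"
      using eq by (metis add_eq_0_iff2 sgn_minus)
    ultimately show False using n1 by (simp add: sgn_if split: if_splits)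
  qed
qed

end

text \<open>The induction generalizes over the operator: the claim for \<open>Suc k\<close> is the
  claim for \<open>k\<close> about the commutator provided by \<open>shift\<close>. The next two
  lemmas follow the same scheme.\<close>

lemma hyp_op_coeffs:
  assumes "hyp_op Q N r" "k \<le> N" "Q k \<noteq> 0"
  shows "hyperbolic (Q k) \<and> coeff (Q k) (k + r) * coeff (Q N) (N + r) > 0"
  using assms
proof (induction k arbitrary: Q N r)
  case 0
  then interpret hyp_op Q N r by simp
  show ?case using Q_0_hyperbolic Q_0_sign 0 by simp
next
  case (Suc k)
  then interpret hyp_op Q N r by simp
  obtain N' where N: "N = Suc N'" using Suc by (cases N) auto
  have cancel: "x * y > 0" if "(a * x) * (b * y) > 0" "a > 0" "b > 0" for a b x y :: real
  proof -
    have "(a * b) * (x * y) > 0" using that(1) by (simp only: mult_ac)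
    then show ?thesis using that by (metis mult_pos_pos zero_less_mult_pos)
  qed
  have "hyperbolic (smult (real (Suc k)) (Q (Suc k))) \<and>
      coeff (smult (real (Suc k)) (Q (Suc k))) (k + Suc r) * coeff (smult (real (Suc N')) (Q (Suc N'))) (N' + Suc r) > 0"
    using Suc.prems N by (intro Suc.IH[OF shift[OF N]]) auto
  then show ?case using cancel[of "real (Suc k)" "coeff (Q (Suc k)) (Suc (k + r))" "real (Suc N')" "coeff (Q (Suc N')) (Suc (N' + r))"] N
    by (simp add: hyperbolic_smult_iff)
qed

lemma hyp_op_no_gap:
  assumes "hyp_op Q N r" "k < N" "Q k \<noteq> 0"
  shows "Q (Suc k) \<noteq> 0"
  using assms
proof (induction k arbitrary: Q N r)
  case 0
  then interpret hyp_op Q N r by simp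
  show ?case using Q_1_nonzero 0 by simp
next
  case (Suc k)
  then interpret hyp_op Q N r by simp
  obtain N' where N: "N = Suc N'" using Suc by (cases N) auto
  show ?case using Suc.IH[OF shift[OF N]] Suc.prems N by simp
qed

lemma hyp_op_zeros:
  assumes "hyp_op Q N r" "k < N" "Q k \<noteq> 0"
    and "\<And>x. poly (Q (Suc k)) x = 0 \<Longrightarrow> y < x" and "poly (Q k) x = 0"
  shows "y < x"
  using assms
proof (induction k arbitrary: Q N r)
  case 0
  then interpret hyp_op Q N r by simp
  have "Q 1 \<noteq> 0" using Q_1_nonzero 0 by simp
  moreover have N: "N \<ge> 1" using 0(2) by simp
  ultimately have Q1: "hyperbolic (Q 1)" "lc 1 * \<sigma> > 0" using hyp_op_coeffs[OF 0(1), of 1] by blast+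
  show ?case
  proof (rule zeros_Q_0_Q_1[OF 0(3) N Q1])
    show "y < u" if "poly (Q 1) u = 0" for u using 0(4)[of u] that by simp
  qed (rule 0(5))
next
  case (Suc k)
  then interpret hyp_op Q N r by simp
  obtain N' where N: "N = Suc N'" using Suc by (cases N) auto
  show ?case
  proof (rule Suc.IH[OF shift[OF N]])
    show "y < u" if "poly (smult (real (Suc (Suc k))) (Q (Suc (Suc k)))) u = 0" for u
      using Suc.prems(4)[of u] that by (simp del: of_nat_Suc)
    show "poly (smult (real (Suc k)) (Q (Suc k))) x = 0" using Suc.prems(5) by simp
    show "smult (real (Suc k)) (Q (Suc k)) \<noteq> 0" using Suc.prems(3) by (simp del: of_nat_Suc)
    show "k < N'" using Suc.prems(2) N by simp
  qed
qed

context hyp_op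
begin

lemma Q_hyperbolic: "Q k \<noteq> 0 \<Longrightarrow> hyperbolic (Q k)"
  and lc_sign: "Q k \<noteq> 0 \<Longrightarrow> lc k * \<sigma> > 0"
proof -
  assume *: "Q k \<noteq> 0"
  then have "k \<le> N" using Q_eq_0[of k] by (meson linorder_not_le)
  then have "hyperbolic (Q k) \<and> lc k * \<sigma> > 0" using hyp_op_coeffs[OF hyp_op_axioms] * by blast
  then show "hyperbolic (Q k)" "lc k * \<sigma> > 0" by auto
qed

lemma degree_Q_eq: "Q k \<noteq> 0 \<Longrightarrow> degree (Q k) = k + r"
proof -
  assume "Q k \<noteq> 0"
  then have "coeff (Q k) (k + r) \<noteq> 0" using lc_sign[of k] by auto
  then show ?thesis using degree_Q[of k] le_degree[of "Q k" "k + r"] by (intro antisym)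
qed

lemma Q_nonzero: "Q i \<noteq> 0 \<Longrightarrow> i \<le> k \<Longrightarrow> k \<le> N \<Longrightarrow> Q k \<noteq> 0"
proof (induction k)
  case (Suc k)
  show ?case
  proof (cases "i = Suc k")
    case False
    then have "Q k \<noteq> 0" using Suc by simp
    then show ?thesis using hyp_op_no_gap[OF hyp_op_axioms, of k] Suc.prems by simp
  qed (use Suc in simp)
qed auto

text \<open>This explains the start of the iteration: the smallest zero of \<open>Q e\<close> is not
  to the right of any zero of a nonzero \<open>Q k\<close> with \<open>k \<le> e\<close>.\<close>

lemma Q_zeros_lower_bound:
  assumes "k \<le> e" "e \<le> N" "Q k \<noteq> 0" "\<And>x. poly (Q e) x = 0 \<Longrightarrow> y < x" "poly (Q k) x = 0"
  shows "y < x"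
  using assms
proof (induction "e - k" arbitrary: k x)
  case 0
  then show ?case by simp
next
  case (Suc d)
  have k: "k < N" using Suc.hyps(2) Suc.prems(2) by linarith
  have nz: "Q (Suc k) \<noteq> 0" using hyp_op_no_gap[OF hyp_op_axioms k] Suc.prems(3) by blast
  show ?case
  proof (rule hyp_op_zeros[OF hyp_op_axioms k Suc.prems(3) _ Suc.prems(5)])
    fix u assume u: "poly (Q (Suc k)) u = 0"
    show "y < u"
    proof (rule Suc.hyps(1)[OF _ _ Suc.prems(2) nz Suc.prems(4) u])
      show "d = e - Suc k" "Suc k \<le> e" using Suc.hyps(2) by linarith+
    qed
  qed
qed

end

section \<open>Nonvanishing of \<open>T f\<close> to the left of all zeros\<close>

lemma higher_pderiv_linear_mult:
  "(pderiv ^^ k) ([:- c, 1:] * f) = [:- c, 1:] * (pderiv ^^ k) f + smult (real k) ((pderiv ^^ (k - 1)) f)"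
proof -
  have e: "[:- c, 1:] * g = [:0, 1:] * g + smult (- c) g" for g :: "real poly"
    by (simp add: mult_pCons_left)
  show ?thesis unfolding e[of f] higher_pderiv_add higher_pderiv_X_mult higher_pderiv_smult e[of "(pderiv ^^ k) f"]
    by (simp add: algebra_simps)
qed

lemma higher_pderiv_sign_step:
  fixes s :: real
  shows "(-1) ^ (Suc d + k) * s * poly ((pderiv ^^ k) ([:- c, 1:] * f)) x =
    (c - x) * ((-1) ^ (d + k) * s * poly ((pderiv ^^ k) f) x) +
    real k * ((-1) ^ (d + (k - 1)) * s * poly ((pderiv ^^ (k - 1)) f) x)"
  unfolding higher_pderiv_linear_mult by (cases k) (simp_all add: algebra_simps)

text \<open>By Leibniz' rule a new factor z - c contributes two terms to each derivative, and to the
  left of all zeros they have the same sign.\<close>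

lemma higher_pderiv_sign_left:
  assumes "hyperbolic f" "\<And>y. poly f y = 0 \<Longrightarrow> x \<le> y"
  shows "(-1) ^ (degree f + k) * lead_coeff f * poly ((pderiv ^^ k) f) x \<ge> 0"
  using assms
proof (induction arbitrary: k rule: hyperbolic_induct)
  case (const c)
  then show ?case by (cases k) (auto simp: higher_pderiv_eq_0 simp del: funpow.simps)
next
  case (linear c f)
  have IH: "(-1) ^ (degree f + k) * lead_coeff f * poly ((pderiv ^^ k) f) x \<ge> 0" for k
    using linear by simp
  have d: "degree ([:- c, 1:] * f) = Suc (degree f)"
    using hyperbolic_nz[OF linear(1)] by (subst degree_mult_eq) auto
  have l: "lead_coeff ([:- c, 1:] * f) = lead_coeff f" by (subst lead_coeff_mult) simp
  have "x \<le> c" using linear.prems[of c] by simp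
  then have "(c - x) * ((- 1) ^ (degree f + k) * lead_coeff f * poly ((pderiv ^^ k) f) x) \<ge> 0"
    using IH by (intro mult_nonneg_nonneg[OF _ IH]) auto
  moreover have "real k * ((- 1) ^ (degree f + (k - 1)) * lead_coeff f * poly ((pderiv ^^ (k - 1)) f) x) \<ge> 0"
    by (intro mult_nonneg_nonneg[OF _ IH]) auto
  ultimately show ?case unfolding l unfolding d higher_pderiv_sign_step by linarith
qed

lemma higher_pderiv_sign_left_strict:
  assumes "hyperbolic f" "\<And>y. poly f y = 0 \<Longrightarrow> x < y" "k \<le> degree f"
  shows "(-1) ^ (degree f + k) * lead_coeff f * poly ((pderiv ^^ k) f) x > 0"
  using assms
proof (induction arbitrary: k rule: hyperbolic_induct)
  case (const c)
  then show ?case by (auto simp: zero_less_mult_iff)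
next
  case (linear c f)
  have IH: "(-1) ^ (degree f + k) * lead_coeff f * poly ((pderiv ^^ k) f) x > 0" if "k \<le> degree f" for k
    using linear that by simp
  have weak: "(-1) ^ (degree f + k) * lead_coeff f * poly ((pderiv ^^ k) f) x \<ge> 0" for k
    using linear by (intro higher_pderiv_sign_left) (auto intro: less_imp_le)
  have d: "degree ([:- c, 1:] * f) = Suc (degree f)"
    using hyperbolic_nz[OF linear(1)] by (subst degree_mult_eq) auto
  have l: "lead_coeff ([:- c, 1:] * f) = lead_coeff f" by (subst lead_coeff_mult) simp
  have c: "x < c" using linear.prems(1)[of c] by simp
  have "0 < (c - x) * ((- 1) ^ (degree f + k) * lead_coeff f * poly ((pderiv ^^ k) f) x) +
        real k * ((- 1) ^ (degree f + (k - 1)) * lead_coeff f * poly ((pderiv ^^ (k - 1)) f) x)"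
  proof (cases "k \<le> degree f")
    case True
    show ?thesis
      using c True by (intro add_pos_nonneg mult_pos_pos[OF _ IH] mult_nonneg_nonneg[OF _ weak]) auto
  next
    case False
    then have k: "k > 0" "k - 1 \<le> degree f" using linear.prems(2) d by auto
    then show ?thesis
      using c by (intro add_nonneg_pos mult_pos_pos[OF _ IH] mult_nonneg_nonneg[OF _ weak]) auto
  qed
  then show ?case unfolding l unfolding d higher_pderiv_sign_step .
qed

context hyp_op
begin

text \<open>At \<open>y\<close> all summands of \<open>T f\<close> have the same weak sign, and the
  one for \<open>k = e\<close> is nonzero. If the degree of \<open>f\<close> is at most
  \<open>N\<close>, that summand contains the constant derivative of top order, so \<open>y\<close>
  may itself be a zero of \<open>f\<close>; otherwise \<open>y\<close> must lie strictly to the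
  left.\<close>

lemma T_nonzero_left:
  assumes nz: "nz (degree f)" and f: "hyperbolic f" and e: "e = min (degree f) N"
    and yQ: "\<And>x. poly (Q e) x = 0 \<Longrightarrow> y < x" and yf: "\<And>x. poly f x = 0 \<Longrightarrow> y \<le> x"
    and strict: "degree f \<le> N \<or> (\<forall>x. poly f x = 0 \<longrightarrow> y < x)"
  shows "poly (T f) y \<noteq> 0"
proof -
  define n where "n = degree f"
  define s where "s = (-1) ^ (n + r) * \<sigma> * lead_coeff f"
  have Qs: "poly (Q k) y * \<sigma> * (-1) ^ (k + r) > 0" if "Q k \<noteq> 0" "k \<le> e" for k
  proof -
    have "\<And>x. poly (Q k) x = 0 \<Longrightarrow> y < x" using Q_zeros_lower_bound[of k e y] that yQ e by auto
    then have sg: "sgn (poly (Q k) y) = sgn (lc k) * (-1) ^ (k + r)"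
      using sgn_left_of_zeros[OF Q_hyperbolic[OF that(1)]] degree_Q_eq[OF that(1)] by simp
    have pm: "sgn ((-1 :: real) ^ m) = (-1) ^ m" for m :: nat by (cases "even m") simp_all
    have "sgn (poly (Q k) y * \<sigma> * (-1) ^ (k + r)) = sgn (lc k * \<sigma>) * ((-1) ^ (k + r) * (-1) ^ (k + r))"
      by (simp only: sgn_mult sg pm mult_ac)
    also have "\<dots> = 1" using lc_sign[OF that(1)] by (simp only: sgn_pos flip: power_mult_distrib) simp
    finally show ?thesis by (simp add: sgn_1_pos)
  qed
  have fs: "(-1) ^ (n + k) * lead_coeff f * poly ((pderiv ^^ k) f) y \<ge> 0" for k
    unfolding n_def by (rule higher_pderiv_sign_left[OF f yf])
  have fe: "(-1) ^ (n + e) * lead_coeff f * poly ((pderiv ^^ e) f) y > 0"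
  proof (cases "degree f \<le> N")
    case True
    then have en: "e = n" using e n_def by simp
    have "degree ((pderiv ^^ n) f) = 0" by (simp add: degree_higher_pderiv n_def)
    then obtain c where "(pderiv ^^ n) f = [:c:]" using degree_eq_zeroE by metis
    then have "poly ((pderiv ^^ n) f) y = coeff ((pderiv ^^ n) f) (n - n)" by simp
    also have "\<dots> = falling n n * lead_coeff f"
      using coeff_higher_pderiv_top[of f n n] by (simp add: n_def)
    finally have val: "poly ((pderiv ^^ n) f) y = falling n n * lead_coeff f" .
    have "(-1) ^ (n + n) * lead_coeff f * (falling n n * lead_coeff f) = falling n n * (lead_coeff f)\<^sup>2"
      by (simp add: power2_eq_square mult_ac flip: mult_2)
    also have "\<dots> > 0" using falling_pos[of n n] hyperbolic_nz[OF f] by simp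
    finally show ?thesis unfolding en val .
  next
    case False
    then have "e \<le> degree f" "\<And>x. poly f x = 0 \<Longrightarrow> y < x" using strict e by simp_all
    then show ?thesis unfolding n_def by (intro higher_pderiv_sign_left_strict[OF f])
  qed
  have summand: "s * poly (Q k * (pderiv ^^ k) f) y = (poly (Q k) y * \<sigma> * (-1) ^ (k + r)) * ((-1) ^ (n + k) * lead_coeff f * poly ((pderiv ^^ k) f) y)" for k
  proof -
    have "(-1::real) ^ (k + r) * (-1) ^ (n + k) = (-1) ^ (n + r) * ((-1) ^ k * (-1) ^ k)"
      by (simp add: power_add mult_ac)
    also have "(-1::real) ^ k * (-1) ^ k = 1" by (simp flip: power_add)
    finally have "s * poly (Q k * (pderiv ^^ k) f) y = ((-1) ^ (k + r) * (-1) ^ (n + k)) * \<sigma> * lead_coeff f * poly (Q k * (pderiv ^^ k) f) y"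
      by (simp add: s_def)
    then show ?thesis by (simp add: mult_ac)
  qed
  have nonneg: "s * poly (Q k * (pderiv ^^ k) f) y \<ge> 0" for k
  proof (cases "Q k = 0 \<or> k > e")
    case True
    then have "Q k = 0 \<or> (pderiv ^^ k) f = 0" using e Q_eq_0[of k] by (auto simp: higher_pderiv_eq_0 min_def split: if_splits)
    then show ?thesis by auto
  next
    case False
    then show ?thesis unfolding summand using Qs[of k] by (intro mult_nonneg_nonneg[OF _ fs]) auto
  qed
  obtain i where "i \<le> n" "Q i \<noteq> 0" using nz by (auto simp: nz_def n_def)
  then have Qe: "Q e \<noteq> 0" using Q_nonzero[of i e] Q_eq_0[of i] e n_def
    by (metis linorder_not_le min.cobounded2 min.boundedI)
  have "0 < s * poly (Q e * (pderiv ^^ e) f) y" unfolding summand by (intro mult_pos_pos[OF _ fe] Qs Qe order_refl)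
  also have "\<dots> \<le> (\<Sum>k=0..N. s * poly (Q k * (pderiv ^^ k) f) y)"
    using e nonneg by (intro member_le_sum) auto
  also have "\<dots> = s * poly (T f) y" by (simp only: diff_op_def poly_sum sum_distrib_left)
  finally show ?thesis by auto
qed

end

subsection \<open>Monic polynomials with prescribed zeros\<close>

definition rpoly :: "real list \<Rightarrow> real poly" where
  "rpoly xs = (\<Prod>x\<leftarrow>xs. [:- x, 1:])"

lemma rpoly_Nil [simp]: "rpoly [] = 1"
  and rpoly_Cons: "rpoly (x # xs) = [:- x, 1:] * rpoly xs"
  and rpoly_append: "rpoly (xs @ ys) = rpoly xs * rpoly ys"
  by (simp_all add: rpoly_def)

lemma rpoly_nonzero [simp]: "rpoly xs \<noteq> 0"
  by (induction xs) (auto simp: rpoly_Cons)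

lemma rpoly_hyperbolic [simp]: "hyperbolic (rpoly xs)"
  by (induction xs) (auto simp: rpoly_Cons hyperbolic_mult_iff)

lemma degree_rpoly [simp]: "degree (rpoly xs) = length xs"
proof (induction xs)
  case (Cons x xs)
  then show ?case unfolding rpoly_Cons by (subst degree_mult_eq) auto
qed simp

lemma lead_coeff_rpoly: "coeff (rpoly xs) (length xs) = 1"
proof -
  have "lead_coeff (rpoly xs) = 1"
  proof (induction xs)
    case (Cons x xs)
    then show ?case unfolding rpoly_Cons by (subst lead_coeff_mult) simp
  qed simp
  then show ?thesis by simp
qed

lemma proots_rpoly [simp]: "proots (rpoly xs) = mset xs"
proof (induction xs)
  case (Cons x xs)
  then show ?case unfolding rpoly_Cons by (subst proots_mult) auto
qed simp

lemma poly_rpoly_eq_0_iff: "poly (rpoly xs) x = 0 \<longleftrightarrow> x \<in> set xs"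
  by (induction xs) (auto simp: rpoly_Cons poly_linear_mult)

lemma rpoly_mset_cong: "mset xs = mset ys \<Longrightarrow> rpoly xs = rpoly ys"
  unfolding rpoly_def by (metis mset_map prod_mset_prod_list)

lemma sorted_zeros_list: "sorted (zeros_list p)" and mset_zeros_list: "mset (zeros_list p) = proots p"
  by (simp_all add: zeros_list_def)

lemma length_zeros_list: "length (zeros_list p) = size (proots p)"
  by (metis mset_zeros_list size_mset)

lemma length_zeros_list_hyperbolic: "hyperbolic p \<Longrightarrow> length (zeros_list p) = degree p"
  by (simp add: length_zeros_list hyperbolic_size)

lemma zeros_list_rpoly: "sorted xs \<Longrightarrow> zeros_list (rpoly xs) = xs"
  by (simp add: zeros_list_def sorted_list_of_multiset_mset sorted_sort_id)

lemma zeros_list_smult: "c \<noteq> 0 \<Longrightarrow> zeros_list (smult c p) = zeros_list p"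
  by (simp add: zeros_list_def)

lemma rpoly_zeros: "hyperbolic p \<Longrightarrow> smult (lead_coeff p) (rpoly (zeros_list p)) = p"
proof -
  have "hyperbolic p \<Longrightarrow> mset xs = proots p \<Longrightarrow> smult (lead_coeff p) (rpoly xs) = p" for xs
  proof (induction arbitrary: xs rule: hyperbolic_induct)
    case (const c)
    then show ?case by simp
  next
    case (linear c p)
    have nz: "p \<noteq> 0" using linear hyperbolic_nz by blast
    obtain ys where ys: "mset ys = proots p" using ex_mset by blast
    have "mset xs = mset (c # ys)" using linear.prems nz ys by (subst (asm) proots_mult) auto
    then have "rpoly xs = [:- c, 1:] * rpoly ys" using rpoly_mset_cong rpoly_Cons by metis
    moreover have "lead_coeff ([:- c, 1:] * p) = lead_coeff p" by (subst lead_coeff_mult) simp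
    ultimately show ?case using linear.IH[OF ys] by (metis mult_smult_right)
  qed
  then show "hyperbolic p \<Longrightarrow> smult (lead_coeff p) (rpoly (zeros_list p)) = p"
    using mset_zeros_list by blast
qed

lemma nth_le_iff_filter:
  "sorted xs \<Longrightarrow> i < length xs \<Longrightarrow> xs ! i \<le> x \<longleftrightarrow> i < length (filter (\<lambda>y. y \<le> x) xs)"
proof (induction xs arbitrary: i)
  case (Cons a xs)
  show ?case
  proof (cases "a \<le> x")
    case True
    then show ?thesis using Cons by (cases i) auto
  next
    case False
    then have "filter (\<lambda>y. y \<le> x) (a # xs) = []" using Cons by (auto simp: filter_empty_conv)
    moreover have "(a # xs) ! i \<ge> a" using Cons.prems by (cases i) auto
    ultimately show ?thesis using False by simp
  qed
qed simp

lemma zeros_list_nth_le_iff: "i < length (zeros_list p) \<Longrightarrow> zeros_list p ! i \<le> x \<longleftrightarrow> i < cnt p x"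
  using nth_le_iff_filter[OF sorted_zeros_list, of i p x]
  by (simp add: cnt_def flip: mset_zeros_list mset_filter)

lemma zeros_list_mono:
  assumes "\<And>x. cnt q x \<le> cnt p x" "i < length (zeros_list p)" "i < length (zeros_list q)"
  shows "zeros_list p ! i \<le> zeros_list q ! i"
proof -
  have "i < cnt q (zeros_list q ! i)" using zeros_list_nth_le_iff[OF assms(3)] by blast
  then have "i < cnt p (zeros_list q ! i)" using assms(1) less_le_trans by blast
  then show ?thesis using zeros_list_nth_le_iff[OF assms(2)] by blast
qed

lemma zeros_list_mono_Suc:
  assumes "\<And>x. cnt p x \<le> cnt q x + 1" "Suc i < length (zeros_list p)" "i < length (zeros_list q)"
  shows "zeros_list q ! i \<le> zeros_list p ! Suc i"
proof -
  have "Suc i < cnt p (zeros_list p ! Suc i)" using zeros_list_nth_le_iff[OF assms(2)] by blast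
  then have "i < cnt q (zeros_list p ! Suc i)" using assms(1)[of "zeros_list p ! Suc i"] by linarith
  then show ?thesis using zeros_list_nth_le_iff[OF assms(3)] by blast
qed

subsection \<open>Monotonicity of the operator\<close>

context hyp_op
begin

text \<open>Moving a zero from \<open>\<alpha>\<close> to \<open>\<beta>\<close> subtracts a
  nonnegative multiple of \<open>h\<close>, and \<open>\<gamma>_sign\<close> supplies the sign
  condition of \<open>cnt_subtract_mono\<close> for the images.\<close>

lemma cnt_T_move_zero:
  assumes h: "hyperbolic h" and ab: "\<alpha> \<le> \<beta>"
  shows "cnt (T ([:- \<beta>, 1:] * h)) x \<le> cnt (T ([:- \<alpha>, 1:] * h)) x"
proof -
  have eq: "[:- \<beta>, 1:] * h = [:- \<alpha>, 1:] * h - smult (\<beta> - \<alpha>) h"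
    by (simp add: mult_pCons_left smult_diff_left)
  then have eqT: "T ([:- \<beta>, 1:] * h) = T ([:- \<alpha>, 1:] * h) - smult (\<beta> - \<alpha>) (T h)"
    by (metis T_diff T_smult)
  show ?thesis
  proof (cases "nz (degree h)")
    case False
    then show ?thesis unfolding eqT by (simp add: T_eq_0)
  next
    case True
    have h0: "h \<noteq> 0" using h hyperbolic_nz by blast
    have d: "degree ([:- \<alpha>, 1:] * h) = Suc (degree h)" using h0 by (subst degree_mult_eq) auto
    have l: "lead_coeff ([:- \<alpha>, 1:] * h) = lead_coeff h" by (subst lead_coeff_mult) simp
    have nz': "nz (degree ([:- \<alpha>, 1:] * h))" using nz_mono[OF True] d by simp
    have nz0: "[:- \<alpha>, 1:] * h \<noteq> 0" using h0 by simp
    have g: "\<gamma> (Suc (degree h)) * \<gamma> (degree h) > 0"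
      using \<gamma>_sign[OF True] \<gamma>_sign[OF nz_mono[OF True, of "Suc (degree h)"]] by (auto simp: zero_less_mult_iff)
    have "lead_coeff h * lead_coeff h > 0" using h0 by (simp flip: power2_eq_square)
    then have "(\<gamma> (Suc (degree h)) * \<gamma> (degree h)) * (lead_coeff h * lead_coeff h) > 0" using g by (rule mult_pos_pos[rotated])
    then have lead: "lead_coeff (T ([:- \<alpha>, 1:] * h)) * lead_coeff (T h) > 0"
      unfolding lead_coeff_T[OF True] lead_coeff_T[OF nz'] l unfolding d by (simp only: mult_ac)
    have deg: "degree (T ([:- \<alpha>, 1:] * h)) = degree (T h) + 1"
      using degree_T_nz[OF True h0] degree_T_nz[OF nz' nz0] d by simp
    show ?thesis unfolding eqT
      by (rule cnt_subtract_mono[OF T_pencil[OF pencil_linear[OF h]] T_nonzero[OF True h0] deg lead]) (use ab in simp)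
  qed
qed

text \<open>Zeros are moved one at a time; \<open>h\<close> collects the factors that stay fixed
  meanwhile.\<close>

lemma cnt_T_mono:
  "list_all2 (\<le>) xs ys \<Longrightarrow> hyperbolic h \<Longrightarrow> cnt (T (h * rpoly ys)) x \<le> cnt (T (h * rpoly xs)) x"
proof (induction arbitrary: h rule: list_all2_induct)
  case (Cons a as b bs)
  have "cnt (T (([:- b, 1:] * h) * rpoly bs)) x \<le> cnt (T (([:- b, 1:] * h) * rpoly as)) x"
    using Cons by (intro Cons.IH) (simp add: hyperbolic_mult_iff)
  also have "\<dots> = cnt (T ([:- b, 1:] * (h * rpoly as))) x" by (simp only: mult.assoc)
  also have "\<dots> \<le> cnt (T ([:- a, 1:] * (h * rpoly as))) x"
    using Cons by (intro cnt_T_move_zero) (simp_all add: hyperbolic_mult_iff)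
  finally show ?case by (simp only: rpoly_Cons mult_ac)
qed simp

lemma zeros_T_mono:
  assumes "list_all2 (\<le>) xs ys" "nz (length xs)" "i < length xs + r"
  shows "zeros_list (T (rpoly xs)) ! i \<le> zeros_list (T (rpoly ys)) ! i"
proof (rule zeros_list_mono)
  have len: "length ys = length xs" using assms(1) list_all2_lengthD by metis
  show "cnt (T (rpoly ys)) x \<le> cnt (T (rpoly xs)) x" for x using cnt_T_mono[OF assms(1), of 1 x] by simp
  show "i < length (zeros_list (T (rpoly xs)))" "i < length (zeros_list (T (rpoly ys)))"
    using assms len by (simp_all add: length_zeros_list_hyperbolic T_hyperbolic degree_T_nz)
qed

text \<open>Adding the last entry of \<open>xs\<close> to \<open>ys\<close> gives a list above
  \<open>xs\<close>, adding the first entry gives one below. Monotonicity compares the images of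
  these lists with that of \<open>xs\<close>, and each of them forms a pencil with the image of
  \<open>ys\<close>.\<close>

lemma zeros_T_interlace:
  assumes len: "length xs = Suc (length ys)" and nz: "nz (length ys)"
    and le: "\<And>i. i < length ys \<Longrightarrow> xs ! i \<le> ys ! i" "\<And>i. i < length ys \<Longrightarrow> ys ! i \<le> xs ! Suc i"
    and i: "i < length ys + r"
  shows "zeros_list (T (rpoly xs)) ! i \<le> zeros_list (T (rpoly ys)) ! i"
    and "zeros_list (T (rpoly ys)) ! i \<le> zeros_list (T (rpoly xs)) ! Suc i"
proof -
  have nz': "nz (Suc (length ys))" using nz_mono[OF nz] by simp
  let ?n = "length ys"
  have all1: "list_all2 (\<le>) xs (ys @ [xs ! ?n])"
    unfolding list_all2_conv_all_nth using len le(1) by (auto simp: nth_append less_Suc_eq)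
  have all2: "list_all2 (\<le>) (xs ! 0 # ys) xs"
    unfolding list_all2_conv_all_nth using len le(2) by (auto simp: nth_Cons' gr0_conv_Suc)
  have deg: "degree (T (rpoly ys)) = ?n + r" "degree (T (rpoly xs)) = Suc ?n + r"
    using nz nz' len by (simp_all add: degree_T_nz)
  have H0: "T (rpoly ys) \<noteq> 0" using nz by (simp add: T_nonzero)
  have lengths: "length (zeros_list (T (rpoly ys))) = ?n + r" "length (zeros_list (T (rpoly xs))) = Suc ?n + r"
    using nz nz' len by (simp_all add: length_zeros_list_hyperbolic T_hyperbolic deg)
  have c: "cnt (T (rpoly ys)) x \<le> cnt (T (rpoly ([y] @ ys))) x"
      "cnt (T (rpoly ([y] @ ys))) x \<le> cnt (T (rpoly ys)) x + 1" for x y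
  proof -
    have "pencil (T (rpoly ([y] @ ys))) (T (rpoly ys))"
      unfolding append_Cons append_Nil rpoly_Cons by (intro T_pencil pencil_linear) simp
    moreover have "degree (T (rpoly ([y] @ ys))) = degree (T (rpoly ys)) + 1"
      using nz' deg by (simp add: degree_T_nz)
    ultimately show "cnt (T (rpoly ys)) x \<le> cnt (T (rpoly ([y] @ ys))) x"
      "cnt (T (rpoly ([y] @ ys))) x \<le> cnt (T (rpoly ys)) x + 1"
      using pencil_cnt H0 by blast+
  qed
  have comm: "rpoly (ys @ [y]) = rpoly ([y] @ ys)" for y by (rule rpoly_mset_cong) simp
  have "cnt (T (rpoly ys)) x \<le> cnt (T (rpoly xs)) x" for x
    using c(1)[of x "xs ! ?n"] cnt_T_mono[OF all1, of 1 x] comm by simp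
  then show "zeros_list (T (rpoly xs)) ! i \<le> zeros_list (T (rpoly ys)) ! i"
    using i lengths by (intro zeros_list_mono) auto
  have "cnt (T (rpoly xs)) x \<le> cnt (T (rpoly ys)) x + 1" for x
    using c(2)[where y = "xs ! 0" and x = x] cnt_T_mono[OF all2, of 1 x] by simp
  then show "zeros_list (T (rpoly ys)) ! i \<le> zeros_list (T (rpoly xs)) ! Suc i"
    using i lengths by (intro zeros_list_mono_Suc) auto
qed

end

subsection \<open>Zero patterns\<close>

definition sel :: "nat set \<Rightarrow> 'a list \<Rightarrow> 'a list" where
  "sel A zs = map (\<lambda>i. zs ! (i - 1)) (sorted_list_of_set A)"

lemma length_sel [simp]: "length (sel A zs) = card A"
  by (simp add: sel_def)

lemma sel_nth: "j < card A \<Longrightarrow> sel A zs ! j = zs ! (sorted_list_of_set A ! j - 1)"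
  by (simp add: sel_def)

lemma mset_sel: "finite A \<Longrightarrow> mset (sel A zs) = image_mset (\<lambda>i. zs ! (i - 1)) (mset_set A)"
proof -
  assume "finite A"
  then have "mset (sorted_list_of_set A) = mset_set A"
    using mset_set_set[of "sorted_list_of_set A"] by simp
  then show ?thesis by (simp add: sel_def)
qed

lemma index_bounds:
  fixes A :: "nat set"
  assumes "A \<subseteq> {1..m}" "j < card A"
  shows "sorted_list_of_set A ! j \<in> {1..m}"
proof -
  have "finite A" using finite_subset[OF assms(1)] by simp
  then have "sorted_list_of_set A ! j \<in> A" using assms nth_mem[of j "sorted_list_of_set A"] by simp
  then show ?thesis using assms by blast
qed

lemma index_less:
  fixes A :: "nat set"
  shows "Suc j < card A \<Longrightarrow> sorted_list_of_set A ! j < sorted_list_of_set A ! Suc j"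
  using sorted_wrt_nth_less[OF strict_sorted_list_of_set[of A], of j "Suc j"] by simp

lemma sorted_sel:
  assumes "sorted zs" "A \<subseteq> {1..length zs}"
  shows "sorted (sel A zs)"
  unfolding sorted_iff_nth_mono
proof safe
  fix i j assume ij: "i \<le> j" "j < length (sel A zs)"
  have "sorted_list_of_set A ! i \<le> sorted_list_of_set A ! j"
    using ij sorted_nth_mono[OF sorted_sorted_list_of_set[of A], of i j] by simp
  moreover have "sorted_list_of_set A ! j - 1 < length zs"
    using index_bounds[OF assms(2), of j] ij by auto
  ultimately show "sel A zs ! i \<le> sel A zs ! j"
    using ij assms(1) by (auto simp: sel_nth intro!: sorted_nth_mono)
qed

lemma set_sel_subset: "A \<subseteq> {1..length zs} \<Longrightarrow> set (sel A zs) \<subseteq> set zs"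
proof
  fix x assume A: "A \<subseteq> {1..length zs}" and "x \<in> set (sel A zs)"
  then obtain j where j: "j < card A" "x = sel A zs ! j" by (auto simp: in_set_conv_nth)
  then show "x \<in> set zs" using index_bounds[OF A j(1)] by (auto simp: sel_nth)
qed

lemma mset_sel_Un:
  assumes "A \<inter> B = {}" "A \<union> B = {1..length zs}"
  shows "mset (sel A zs) + mset (sel B zs) = mset zs"
proof -
  have fin: "finite A" "finite B" using assms(2) by (metis finite_Un finite_atLeastAtMost)+
  have "mset (sel A zs) + mset (sel B zs) = image_mset (\<lambda>i. zs ! (i - 1)) (mset_set (A \<union> B))"
    by (simp only: mset_sel[OF fin(1)] mset_sel[OF fin(2)] mset_set_Union[OF fin assms(1)] image_mset_union)
  also have "mset_set (A \<union> B) = mset [1..<Suc (length zs)]"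
    unfolding assms(2) by (metis atLeastLessThanSuc_atLeastAtMost mset_upt)
  also have "image_mset (\<lambda>i. zs ! (i - 1)) \<dots> = mset (map (\<lambda>i. zs ! (i - 1)) [1..<Suc (length zs)])"
    by simp
  also have "map (\<lambda>i. zs ! (i - 1)) [1..<Suc (length zs)] = zs"
    by (intro nth_equalityI) (auto simp: nth_append simp del: upt_Suc)
  finally show ?thesis .
qed

text \<open>The pattern fixes both multisets of zeros, and monicity of the second factor assigns the
  leading coefficient to the first; hence the description is unique.\<close>

lemma pattern_factors_eq:
  assumes g: "hyperbolic g" and AB: "A \<inter> B = {}" "A \<union> B = {1..degree g}"
  defines "zs \<equiv> zeros_list g"
  shows "pattern_factors A B g = (smult (lead_coeff g) (rpoly (sel A zs)), rpoly (sel B zs))"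
proof -
  have lg: "lead_coeff g \<noteq> 0" using g hyperbolic_nz by simp
  have fin: "finite A" "finite B" using AB(2) by (metis finite_Un finite_atLeastAtMost)+
  have len: "length zs = degree g" unfolding zs_def by (rule length_zeros_list_hyperbolic[OF g])
  have "rpoly (sel A zs) * rpoly (sel B zs) = rpoly zs"
    using mset_sel_Un[of A B zs] AB len by (simp flip: rpoly_append, intro rpoly_mset_cong) simp
  then have prod: "smult (lead_coeff g) (rpoly (sel A zs)) * rpoly (sel B zs) = g"
    using rpoly_zeros[OF g] by (simp add: zs_def)
  have card: "card A + card B = degree g"
    using AB fin by (metis card_Un_disjoint card_atLeastAtMost diff_Suc_1)
  show ?thesis unfolding pattern_factors_def
  proof (rule the_equality, goal_cases)
    case 1
    have "zero_pattern A B (smult (lead_coeff g) (rpoly (sel A zs))) (rpoly (sel B zs))"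
      unfolding zero_pattern_def prod using AB lg card mset_sel[OF fin(1), of zs] mset_sel[OF fin(2), of zs]
      by (auto simp: hyperbolic_smult_iff zs_def add.commute)
    then show ?case using prod lead_coeff_rpoly[of "sel B zs"] by simp
  next
    case (2 p)
    obtain v f where p: "p = (v, f)" by (cases p)
    then have *: "g = v * f" "lead_coeff f = 1" "zero_pattern A B v f" using 2 by auto
    then have hyp: "hyperbolic v" "hyperbolic f" by (auto simp: zero_pattern_def)
    have "mset (zeros_list f) = mset (sel B zs)" "mset (zeros_list v) = mset (sel A zs)"
      using * mset_sel[OF fin(1), of zs] mset_sel[OF fin(2), of zs]
      unfolding zero_pattern_def mset_zeros_list zs_def by simp_all
    then have "rpoly (zeros_list f) = rpoly (sel B zs)" "rpoly (zeros_list v) = rpoly (sel A zs)"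
      using rpoly_mset_cong by blast+
    moreover have "lead_coeff v = lead_coeff g" using *(1,2) by (simp add: lead_coeff_mult)
    ultimately show ?case using rpoly_zeros[OF hyp(1)] rpoly_zeros[OF hyp(2)] *(2) p by simp
  qed
qed

lemma rpoly_coeff_tendsto:
  fixes X :: "nat \<Rightarrow> real list"
  assumes "\<And>i. length (X i) = length L" "\<And>j. j < length L \<Longrightarrow> (\<lambda>i. X i ! j) \<longlonglongrightarrow> L ! j"
  shows "(\<lambda>i. coeff (rpoly (X i)) k) \<longlonglongrightarrow> coeff (rpoly L) k"
  using assms
proof (induction L arbitrary: X k)
  case (Cons a L)
  have X: "X i = X i ! 0 # tl (X i)" for i
    using Cons.prems(1)[of i] by (cases "X i") auto
  have tl: "length (tl (X i)) = length L" for i using Cons.prems(1)[of i] by simp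
  have IH: "(\<lambda>i. coeff (rpoly (tl (X i))) m) \<longlonglongrightarrow> coeff (rpoly L) m" for m
  proof (rule Cons.IH[OF tl])
    fix j assume j: "j < length L"
    have "tl (X i) ! j = X i ! Suc j" for i using tl[of i] j by (intro nth_tl) simp
    then show "(\<lambda>i. tl (X i) ! j) \<longlonglongrightarrow> L ! j" using Cons.prems(2)[of "Suc j"] j by simp
  qed
  have X0: "(\<lambda>i. X i ! 0) \<longlonglongrightarrow> a" using Cons.prems(2)[of 0] by simp
  have co: "coeff (rpoly (x # xs)) k = (if k = 0 then 0 else coeff (rpoly xs) (k - 1)) - x * coeff (rpoly xs) k" for x xs
    unfolding rpoly_Cons by (simp add: mult_pCons_left coeff_pCons split: nat.split)
  have "(\<lambda>i. (if k = 0 then 0 else coeff (rpoly (tl (X i))) (k - 1)) - X i ! 0 * coeff (rpoly (tl (X i))) k)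
    \<longlonglongrightarrow> (if k = 0 then 0 else coeff (rpoly L) (k - 1)) - a * coeff (rpoly L) k"
    by (cases "k = 0") (auto intro!: tendsto_intros IH X0)
  then show ?case unfolding co[symmetric] X[symmetric] .
qed auto

lemma poly_lim_eq:
  assumes "\<And>k. (\<lambda>i. coeff (X i) k) \<longlonglongrightarrow> coeff p k"
  shows "poly_lim X = p"
  unfolding poly_lim_def
proof (rule the_equality)
  fix q assume "\<forall>k. (\<lambda>i. coeff (X i) k) \<longlonglongrightarrow> coeff q k"
  then show "q = p" using assms by (intro poly_eqI) (blast intro: LIMSEQ_unique)
qed (use assms in blast)

lemma diff_op_from_0:
  assumes "\<And>k. k < M \<Longrightarrow> Q k = 0"
  shows "diff_op Q M N = diff_op Q 0 N"
proof
  fix f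
  show "diff_op Q M N f = diff_op Q 0 N f" unfolding diff_op_def
    by (intro sum.mono_neutral_left) (use assms in auto)
qed

subsection \<open>The iteration\<close>

context hyp_op
begin

lemma coeff_T_tendsto:
  assumes "\<And>k. (\<lambda>i. coeff (X i) k) \<longlonglongrightarrow> coeff p k"
  shows "(\<lambda>i. coeff (T (X i)) k) \<longlonglongrightarrow> coeff (T p) k"
  unfolding diff_op_def coeff_sum coeff_mult coeff_higher_pderiv
  by (intro tendsto_intros assms)

text \<open>The iteration is followed on sorted lists of zeros, where monotonicity can be stated
  entrywise. The start \<open>c\<close> is a parameter so that the iterations for n and n + 1 can be
  started at the same point.\<close>

primrec f_zeros :: "nat set \<Rightarrow> nat \<Rightarrow> real \<Rightarrow> nat \<Rightarrow> real list" where
  "f_zeros B n c 0 = replicate n c"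
| "f_zeros B n c (Suc i) = sel B (zeros_list (T (rpoly (f_zeros B n c i))))"

definition admissible :: "nat \<Rightarrow> real \<Rightarrow> bool" where
  "admissible n c \<longleftrightarrow> (\<forall>x. poly (Q (min n N)) x = 0 \<longrightarrow> c \<le> x)"

abbreviation Tf_zeros :: "nat set \<Rightarrow> nat \<Rightarrow> real \<Rightarrow> nat \<Rightarrow> real list" where
  "Tf_zeros B n c i \<equiv> zeros_list (T (rpoly (f_zeros B n c i)))"

lemma length_f_zeros: "card B = n \<Longrightarrow> length (f_zeros B n c i) = n"
  by (cases i) auto

lemma T_rpoly:
  assumes "nz (length xs)"
  shows "hyperbolic (T (rpoly xs))" "degree (T (rpoly xs)) = length xs + r"
    "lead_coeff (T (rpoly xs)) = \<gamma> (length xs)" "length (zeros_list (T (rpoly xs))) = length xs + r"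
    "T (rpoly xs) = smult (\<gamma> (length xs)) (rpoly (zeros_list (T (rpoly xs))))"
proof -
  show h: "hyperbolic (T (rpoly xs))" using assms by (intro T_hyperbolic) auto
  show d: "degree (T (rpoly xs)) = length xs + r" using assms by (simp add: degree_T_nz)
  show l: "lead_coeff (T (rpoly xs)) = \<gamma> (length xs)" using lead_coeff_T[of "rpoly xs"] assms lead_coeff_rpoly[of xs] by simp
  show "length (zeros_list (T (rpoly xs))) = length xs + r" using h d by (simp add: length_zeros_list_hyperbolic)
  show "T (rpoly xs) = smult (\<gamma> (length xs)) (rpoly (zeros_list (T (rpoly xs))))"
    using rpoly_zeros[OF h] l by simp
qed

lemma sel_zeros_T_mono:
  assumes "list_all2 (\<le>) xs ys" "nz (length xs)" "B \<subseteq> {1..length xs + r}"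
  shows "list_all2 (\<le>) (sel B (zeros_list (T (rpoly xs)))) (sel B (zeros_list (T (rpoly ys))))"
  unfolding list_all2_conv_all_nth
proof safe
  fix j assume "j < length (sel B (zeros_list (T (rpoly xs))))"
  then show "sel B (zeros_list (T (rpoly xs))) ! j \<le> sel B (zeros_list (T (rpoly ys))) ! j"
    using index_bounds[OF assms(3), of j] by (auto simp: sel_nth intro!: zeros_T_mono assms)
qed simp

text \<open>A zero of the image to the left of \<open>c\<close> would lie left of the zeros of
  \<open>f\<close> and of \<open>Q e\<close>, against \<open>T_nonzero_left\<close>. Hence the first
  step of the iteration moves to the right.\<close>

lemma zeros_T_ge:
  assumes nz: "nz n" and admissible: "admissible n c" and j: "j < n + r"
  shows "c \<le> zeros_list (T (rpoly (replicate n c))) ! j"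
proof (rule ccontr)
  define y where "y = zeros_list (T (rpoly (replicate n c))) ! j"
  assume "\<not> ?thesis"
  then have y: "y < c" by (simp add: y_def)
  have len: "length (zeros_list (T (rpoly (replicate n c)))) = n + r"
    using T_rpoly(4)[of "replicate n c"] nz by simp
  then have "y \<in> set (zeros_list (T (rpoly (replicate n c))))" using j by (simp add: y_def)
  then have "poly (T (rpoly (replicate n c))) y = 0"
    using T_rpoly(5)[of "replicate n c"] nz by (metis length_replicate poly_smult poly_rpoly_eq_0_iff mult_zero_right)
  moreover have "poly (T (rpoly (replicate n c))) y \<noteq> 0"
  proof (rule T_nonzero_left)
    show "y < x" if "poly (Q (min n N)) x = 0" for x
      using admissible y that unfolding admissible_def by force
    show "y \<le> x" if "poly (rpoly (replicate n c)) x = 0" for x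
      using y that by (auto simp: poly_rpoly_eq_0_iff)
    show "degree (rpoly (replicate n c)) \<le> N \<or> (\<forall>x. poly (rpoly (replicate n c)) x = 0 \<longrightarrow> y < x)"
      using y by (auto simp: poly_rpoly_eq_0_iff)
  qed (use nz in auto)
  ultimately show False by simp
qed

text \<open>To the right of \<open>b\<close> all summands of the image of (z - b)^n have the sign of
  \<open>\<sigma>\<close>. This polynomial serves as a barrier for the iteration.\<close>

lemma zeros_T_le:
  assumes nz: "nz n" and b: "\<And>k x. Q k \<noteq> 0 \<Longrightarrow> poly (Q k) x = 0 \<Longrightarrow> x \<le> b" and j: "j < n + r"
  shows "zeros_list (T (rpoly (replicate n b))) ! j \<le> b"
proof (rule ccontr)
  define y where "y = zeros_list (T (rpoly (replicate n b))) ! j"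
  assume "\<not> ?thesis"
  then have y: "b < y" by (simp add: y_def)
  have len: "length (zeros_list (T (rpoly (replicate n b)))) = n + r"
    using T_rpoly(4)[of "replicate n b"] nz by simp
  then have "y \<in> set (zeros_list (T (rpoly (replicate n b))))" using j by (simp add: y_def)
  then have "poly (T (rpoly (replicate n b))) y = 0"
    using T_rpoly(5)[of "replicate n b"] nz by (metis length_replicate poly_smult poly_rpoly_eq_0_iff mult_zero_right)
  moreover have "rpoly (replicate n b) = [:- b, 1:] ^ n" by (induction n) (auto simp: rpoly_Cons)
  ultimately have zero: "(\<Sum>k=0..N. poly (Q k) y * falling n k * (y - b) ^ (n - k)) = 0"
    by (simp add: poly_T_linear_power)
  have Qpos: "\<sigma> * poly (Q k) y > 0" if k: "Q k \<noteq> 0" for k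
  proof -
    have ny: "poly (Q k) y \<noteq> 0" using b[OF k, of y] y by auto
    have "cnt_gt (Q k) y = 0" using b[OF k] y k by (force simp: cnt_gt_def filter_mset_eq_conv)
    then have "sgn (poly (Q k) y) = sgn (lc k)"
      using hyperbolic_sgn[OF Q_hyperbolic[OF k] ny] degree_Q_eq[OF k] by simp
    then show ?thesis using lc_sign[OF k] by (auto simp: sgn_if zero_less_mult_iff split: if_splits)
  qed
  have nonneg: "\<sigma> * (poly (Q k) y * falling n k * (y - b) ^ (n - k)) \<ge> 0" for k
  proof (cases "Q k = 0 \<or> k > n")
    case False
    then have "(\<sigma> * poly (Q k) y) * (falling n k * (y - b) ^ (n - k)) \<ge> 0"
      using Qpos[of k] falling_pos[of k n] y by (intro mult_nonneg_nonneg[of "\<sigma> * poly (Q k) y"]) auto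
    then show ?thesis by (simp add: mult_ac)
  qed (auto simp: falling_eq_0)
  obtain i where i: "i \<le> n" "Q i \<noteq> 0" using nz by (auto simp: nz_def)
  then have iN: "i \<le> N" using Q_eq_0[of i] by (meson linorder_not_le)
  have "0 < (\<sigma> * poly (Q i) y) * (falling n i * (y - b) ^ (n - i))"
    using Qpos[OF i(2)] falling_pos[OF i(1)] y by (intro mult_pos_pos[of "\<sigma> * poly (Q i) y"]) auto
  also have "\<dots> = \<sigma> * (poly (Q i) y * falling n i * (y - b) ^ (n - i))" by (simp add: mult_ac)
  also have "\<dots> \<le> (\<Sum>k=0..N. \<sigma> * (poly (Q k) y * falling n k * (y - b) ^ (n - k)))"
    using iN nonneg by (intro member_le_sum) auto
  also have "\<dots> = 0" using zero by (simp flip: sum_distrib_left)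
  finally show False by simp
qed

lemma f_zeros_mono_start:
  assumes "c \<le> d" "nz n" "card B = n" "B \<subseteq> {1..n + r}"
  shows "list_all2 (\<le>) (f_zeros B n c i) (f_zeros B n d i)"
proof (induction i)
  case 0
  then show ?case using assms by (simp add: list_all2_conv_all_nth)
next
  case (Suc i)
  then show ?case unfolding f_zeros.simps using assms length_f_zeros[OF assms(3)]
    by (intro sel_zeros_T_mono) auto
qed

lemma f_zeros_mono:
  assumes "nz n" "admissible n c" "card B = n" "B \<subseteq> {1..n + r}"
  shows "list_all2 (\<le>) (f_zeros B n c i) (f_zeros B n c (Suc i))"
proof (induction i)
  case 0
  show ?case unfolding list_all2_conv_all_nth
  proof safe
    fix j assume "j < length (f_zeros B n c 0)"
    then show "f_zeros B n c 0 ! j \<le> f_zeros B n c (Suc 0) ! j"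
      using index_bounds[OF assms(4), of j] assms
      by (auto simp: sel_nth intro!: zeros_T_ge)
  qed (use assms in simp)
next
  case (Suc i)
  then show ?case unfolding f_zeros.simps(2) using assms length_f_zeros[OF assms(3), of c i]
    by (intro sel_zeros_T_mono) (auto simp: length_f_zeros)
qed

lemma Tf_zeros_mono:
  assumes "nz n" "admissible n c" "card B = n" "B \<subseteq> {1..n + r}" "j < n + r"
  shows "Tf_zeros B n c i ! j \<le> Tf_zeros B n c (Suc i) ! j"
  using f_zeros_mono[OF assms(1-4), of i] assms length_f_zeros[OF assms(3), of c i] by (intro zeros_T_mono) auto

lemma Tf_zeros_bounded:
  assumes "nz n" "card B = n" "B \<subseteq> {1..n + r}"
  shows "\<exists>b. \<forall>i. \<forall>j<n + r. Tf_zeros B n c i ! j \<le> b"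
proof -
  \<comment> \<open>Including \<open>c\<close> makes the barrier dominate the start as well and
    keeps the set nonempty.\<close>
  define b where "b = Max (insert c (\<Union>k\<in>{k. k \<le> N \<and> Q k \<noteq> 0}. {x. poly (Q k) x = 0}))"
  have fin: "finite (insert c (\<Union>k\<in>{k. k \<le> N \<and> Q k \<noteq> 0}. {x. poly (Q k) x = 0}))"
    by (auto intro: poly_roots_finite)
  have bQ: "x \<le> b" if "Q k \<noteq> 0" "poly (Q k) x = 0" for k x
    unfolding b_def using that Q_eq_0[of k] by (intro Max_ge[OF fin]) (auto simp: not_less[symmetric])
  have cb: "c \<le> b" unfolding b_def by (intro Max_ge[OF fin]) auto
  have up: "Tf_zeros B n c i ! j \<le> b" if z: "list_all2 (\<le>) (f_zeros B n c i) (replicate n b)" and j: "j < n + r" for i j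
  proof -
    have "Tf_zeros B n c i ! j \<le> zeros_list (T (rpoly (replicate n b))) ! j"
      using assms j length_f_zeros[OF assms(2), of c i] by (intro zeros_T_mono z) auto
    also have "\<dots> \<le> b" using assms(1) bQ j by (rule zeros_T_le)
    finally show ?thesis .
  qed
  have "list_all2 (\<le>) (f_zeros B n c i) (replicate n b)" for i
  proof (induction i)
    case 0
    then show ?case using cb by (simp add: list_all2_conv_all_nth)
  next
    case (Suc i)
    show ?case unfolding list_all2_conv_all_nth
    proof safe
      fix j assume "j < length (f_zeros B n c (Suc i))"
      then show "f_zeros B n c (Suc i) ! j \<le> replicate n b ! j"
        using index_bounds[OF assms(3), of j] assms up[OF Suc, of "sorted_list_of_set B ! j - 1"]
        by (auto simp: sel_nth)
    qed (use assms in simp)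
  qed
  then show ?thesis using up by blast
qed

text \<open>\<open>L\<close> and \<open>W\<close> list the zeros of the limits of \<open>f\<^sub>i\<close> and of \<open>T f\<^sub>i\<close>.\<close>

definition limits :: "nat set \<Rightarrow> nat \<Rightarrow> real \<Rightarrow> real list \<Rightarrow> real list \<Rightarrow> bool" where
  "limits B n c L W \<longleftrightarrow> length L = n \<and> length W = n + r \<and> sorted W \<and> L = sel B W \<and>
     (\<forall>j<n. (\<lambda>i. f_zeros B n c i ! j) \<longlonglongrightarrow> L ! j) \<and>
     (\<forall>j<n + r. (\<lambda>i. Tf_zeros B n c i ! j) \<longlonglongrightarrow> W ! j) \<and>
     T (rpoly L) = smult (\<gamma> n) (rpoly W)"

lemma limitsD:
  assumes "limits B n c L W"
  shows "length L = n" "length W = n + r" "sorted W" "L = sel B W"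
    "\<And>j. j < n \<Longrightarrow> (\<lambda>i. f_zeros B n c i ! j) \<longlonglongrightarrow> L ! j"
    "\<And>j. j < n + r \<Longrightarrow> (\<lambda>i. Tf_zeros B n c i ! j) \<longlonglongrightarrow> W ! j"
    "T (rpoly L) = smult (\<gamma> n) (rpoly W)"
  using assms unfolding limits_def by blast+

lemma limits_exist:
  assumes nz: "nz n" and admissible: "admissible n c" and B: "card B = n" "B \<subseteq> {1..n + r}"
  shows "\<exists>L W. limits B n c L W"
proof -
  obtain b where b: "\<And>i j. j < n + r \<Longrightarrow> Tf_zeros B n c i ! j \<le> b" using Tf_zeros_bounded[OF nz B] by blast
  have lenw: "length (Tf_zeros B n c i) = n + r" for i using T_rpoly(4)[of "f_zeros B n c i"] nz length_f_zeros[OF B(1)] by simp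
  have "\<exists>l. (\<lambda>i. Tf_zeros B n c i ! j) \<longlonglongrightarrow> l" if j: "j < n + r" for j
  proof -
    have "incseq (\<lambda>i. Tf_zeros B n c i ! j)" by (intro incseq_SucI Tf_zeros_mono nz admissible B j)
    then show ?thesis using b[OF j] incseq_convergent[of "\<lambda>i. Tf_zeros B n c i ! j" b] by metis
  qed
  then obtain l where l: "\<And>j. j < n + r \<Longrightarrow> (\<lambda>i. Tf_zeros B n c i ! j) \<longlonglongrightarrow> l j" by metis
  define W where "W = map l [0..<n + r]"
  define L where "L = sel B W"
  have W: "length W = n + r" "\<And>j. j < n + r \<Longrightarrow> (\<lambda>i. Tf_zeros B n c i ! j) \<longlonglongrightarrow> W ! j"
    using l by (simp_all add: W_def)
  have "sorted W" unfolding sorted_iff_nth_mono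
  proof safe
    fix j k assume jk: "j \<le> k" "k < length W"
    have "Tf_zeros B n c i ! j \<le> Tf_zeros B n c i ! k" for i using jk W(1) lenw by (intro sorted_nth_mono sorted_zeros_list) auto
    then show "W ! j \<le> W ! k" using jk W by (intro LIMSEQ_le[of "\<lambda>i. Tf_zeros B n c i ! j" _ "\<lambda>i. Tf_zeros B n c i ! k"]) auto
  qed
  moreover have lenL: "length L = n" using B by (simp add: L_def)
  moreover have limL: "(\<lambda>i. f_zeros B n c i ! j) \<longlonglongrightarrow> L ! j" if j: "j < n" for j
  proof -
    have "sorted_list_of_set B ! j - 1 < n + r" using index_bounds[OF B(2), of j] j B by auto
    then have "(\<lambda>i. f_zeros B n c (Suc i) ! j) \<longlonglongrightarrow> L ! j" using W(2) j B by (simp add: L_def sel_nth)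
    then show ?thesis by (rule LIMSEQ_imp_Suc)
  qed
  moreover have "T (rpoly L) = smult (\<gamma> n) (rpoly W)"
  proof (rule poly_eqI)
    fix k
    have 1: "(\<lambda>i. coeff (T (rpoly (f_zeros B n c i))) k) \<longlonglongrightarrow> coeff (T (rpoly L)) k"
      by (intro coeff_T_tendsto rpoly_coeff_tendsto) (use length_f_zeros[OF B(1)] lenL limL in auto)
    have "T (rpoly (f_zeros B n c i)) = smult (\<gamma> n) (rpoly (Tf_zeros B n c i))" for i
      using T_rpoly(5)[of "f_zeros B n c i"] nz length_f_zeros[OF B(1)] by simp
    then have "coeff (T (rpoly (f_zeros B n c i))) k = \<gamma> n * coeff (rpoly (Tf_zeros B n c i)) k" for i
      by (metis coeff_smult)
    then have "(\<lambda>i. \<gamma> n * coeff (rpoly (Tf_zeros B n c i)) k) \<longlonglongrightarrow> coeff (T (rpoly L)) k" using 1 by (simp only:)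
    moreover have "(\<lambda>i. \<gamma> n * coeff (rpoly (Tf_zeros B n c i)) k) \<longlonglongrightarrow> \<gamma> n * coeff (rpoly W) k"
      by (intro tendsto_intros rpoly_coeff_tendsto) (use lenw W in auto)
    ultimately show "coeff (T (rpoly L)) k = coeff (smult (\<gamma> n) (rpoly W)) k"
      using LIMSEQ_unique by fastforce
  qed
  ultimately show ?thesis unfolding limits_def L_def using W by blast
qed

lemma limits_W_eq: "limits B n c L W \<Longrightarrow> nz n \<Longrightarrow> W = zeros_list (T (rpoly L))"
  using \<gamma>_nonzero[of n] limitsD(3,7)[of B n c L W] by (metis zeros_list_smult zeros_list_rpoly)

text \<open>For \<open>n \<le> N\<close> a fixed point of the iteration has no zero to the left of the zeros of \<open>Q n\<close>, hence
  every admissible starting point leads to the same (smallest) fixed point.\<close>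
lemma limits_start_independent:
  assumes nz: "nz n" and nN: "n \<le> N" and B: "card B = n" "B \<subseteq> {1..n + r}"
    and c: "c \<le> d" "admissible n c" "admissible n d" and L: "limits B n c L W" "limits B n d L' W'"
  shows "L = L'"
proof (rule nth_equalityI)
  have lenL: "length L = n" by (rule limitsD(1)[OF L(1)])
  then show len: "length L = length L'" using limitsD(1)[OF L(2)] by simp
  \<comment> \<open>The smallest zero of the fixed point is also a zero of its image. If it lay left
    of \<open>d\<close>, this would contradict \<open>T_nonzero_left\<close>, which applies at a
    zero of the argument because \<open>n \<le> N\<close>.\<close>
  have ge: "d \<le> x" if x: "x \<in> set L" for x
  proof (rule ccontr)
    define y where "y = Min (set L)"
    assume "\<not> d \<le> x"
    then have yd: "y < d" unfolding y_def using Min_le[OF finite_set x] by linarith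
    have "set L \<noteq> {}" using x by auto
    then have y: "y \<in> set L" unfolding y_def by (rule Min_in[OF finite_set])
    have "poly (T (rpoly L)) y \<noteq> 0"
    proof (rule T_nonzero_left)
      show "y < u" if "poly (Q (min n N)) u = 0" for u
      proof -
        have "d \<le> u" using c(3) that unfolding admissible_def by blast
        then show ?thesis using yd by linarith
      qed
      show "y \<le> u" if "poly (rpoly L) u = 0" for u
        using that unfolding poly_rpoly_eq_0_iff y_def by (rule Min_le[OF finite_set])
      show "nz (degree (rpoly L))" "min n N = min (degree (rpoly L)) N" using nz lenL by simp_all
      show "degree (rpoly L) \<le> N \<or> (\<forall>x. poly (rpoly L) x = 0 \<longrightarrow> y < x)" using nN lenL by simp
    qed simp
    moreover have "y \<in> set W" using y limitsD(2,4)[OF L(1)] set_sel_subset[of B W] B by auto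
    then have "poly (T (rpoly L)) y = 0" using limitsD(7)[OF L(1)] by (simp add: poly_rpoly_eq_0_iff)
    ultimately show False by simp
  qed
  \<comment> \<open>The fixed point \<open>L\<close> dominates the start at \<open>d\<close>, hence
    all iterates from there; these in turn dominate the iterates from \<open>c\<close>, which
    converge to \<open>L\<close>.\<close>
  have zL: "list_all2 (\<le>) (f_zeros B n d i) L" for i
  proof (induction i)
    case 0
    show ?case unfolding list_all2_conv_all_nth
    proof safe
      fix k assume "k < length (f_zeros B n d 0)"
      then show "f_zeros B n d 0 ! k \<le> L ! k" using ge[of "L ! k"] lenL by simp
    qed (use lenL in simp)
  next
    case (Suc i)
    have "list_all2 (\<le>) (f_zeros B n d (Suc i)) (sel B (zeros_list (T (rpoly L))))"
      unfolding f_zeros.simps using Suc length_f_zeros[OF B(1)] nz B by (intro sel_zeros_T_mono) auto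
    also have "sel B (zeros_list (T (rpoly L))) = L"
      by (subst limits_W_eq[OF L(1) nz, symmetric]) (rule limitsD(4)[OF L(1), symmetric])
    finally show ?case .
  qed
  fix j assume j: "j < length L"
  have l1: "(\<lambda>i. f_zeros B n c i ! j) \<longlonglongrightarrow> L ! j" and l2: "(\<lambda>i. f_zeros B n d i ! j) \<longlonglongrightarrow> L' ! j"
    using limitsD(5)[OF L(1)] limitsD(5)[OF L(2)] j lenL by blast+
  have le: "f_zeros B n c i ! j \<le> f_zeros B n d i ! j" "f_zeros B n d i ! j \<le> L ! j" for i
    using list_all2_nthD[OF f_zeros_mono_start[OF c(1) nz B, of i], of j] list_all2_nthD[OF zL[of i], of j] j lenL
      length_f_zeros[OF B(1), of c i] length_f_zeros[OF B(1), of d i] by simp_all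
  have "L ! j \<le> L' ! j" by (rule LIMSEQ_le[OF l1 l2]) (use le(1) in blast)
  moreover have "L' ! j \<le> L ! j" by (rule LIMSEQ_le_const2[OF l2]) (use le(2) in blast)
  ultimately show "L ! j = L' ! j" by simp
qed

text \<open>The interlacing of \<open>X\<close> and \<open>Y\<close> survives the passage to the zeros of \<open>T\<close> and the selection
  of the positions \<open>B'\<close> and \<open>B\<close>, provided these positions interlace strictly themselves.\<close>

definition chain :: "real list \<Rightarrow> real list \<Rightarrow> bool" where
  "chain X Y \<longleftrightarrow> length X = Suc (length Y) \<and> (\<forall>j<length Y. X ! j \<le> Y ! j \<and> Y ! j \<le> X ! Suc j)"

definition pattern_chain :: "nat set \<Rightarrow> nat set \<Rightarrow> nat \<Rightarrow> bool" where
  "pattern_chain B' B n \<longleftrightarrow> card B = n \<and> card B' = Suc n \<and> B \<subseteq> {1..n + r} \<and> B' \<subseteq> {1..Suc n + r} \<and>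
     (\<forall>j<n. sorted_list_of_set B' ! j \<le> sorted_list_of_set B ! j \<and>
        sorted_list_of_set B ! j < sorted_list_of_set B' ! Suc j)"

lemma chain_T: "chain X Y \<Longrightarrow> nz (length Y) \<Longrightarrow> chain (zeros_list (T (rpoly X))) (zeros_list (T (rpoly Y)))"
proof -
  assume c: "chain X Y" and nz: "nz (length Y)"
  have nz': "nz (length X)" using c nz_mono[OF nz] by (simp add: chain_def)
  show ?thesis unfolding chain_def T_rpoly(4)[OF nz] T_rpoly(4)[OF nz']
    using c nz zeros_T_interlace[of X Y] by (simp add: chain_def)
qed

lemma chain_sel:
  assumes c: "chain P H" and sorted: "sorted P" "sorted H" and pc: "pattern_chain B' B n" and len: "length H = n + r"
  shows "chain (sel B' P) (sel B H)"
  unfolding chain_def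
proof safe
  show "length (sel B' P) = Suc (length (sel B H))" using pc by (simp add: pattern_chain_def)
  fix j assume "j < length (sel B H)"
  then have j: "j < n" "j < card B" "j < card B'" "Suc j < card B'" using pc by (auto simp: pattern_chain_def)
  let ?b = "sorted_list_of_set B ! j" and ?b' = "sorted_list_of_set B' ! j" and ?c = "sorted_list_of_set B' ! Suc j"
  have b: "?b' \<le> ?b" "?b < ?c" using pc j by (auto simp: pattern_chain_def)
  have bounds: "?b \<in> {1..n + r}" "?b' \<in> {1..Suc n + r}" "?c \<in> {1..Suc n + r}"
    using pc j index_bounds by (auto simp: pattern_chain_def)
  have lenP: "length P = Suc (n + r)" using c len by (simp add: chain_def)
  have bH: "?b - 1 < length H" using bounds len by auto
  have "P ! (?b' - 1) \<le> P ! (?b - 1)" using b bounds lenP by (intro sorted_nth_mono sorted) auto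
  also have "\<dots> \<le> H ! (?b - 1)" using c bH unfolding chain_def by blast
  finally show "sel B' P ! j \<le> sel B H ! j" using j by (simp add: sel_nth)
  \<comment> \<open>The chain only reaches the next entry of \<open>P\<close>; strictness of
    \<open>?b < ?c\<close> places that entry no later than position \<open>?c - 1\<close>.\<close>
  have "H ! (?b - 1) \<le> P ! Suc (?b - 1)" using c bH unfolding chain_def by blast
  also have "\<dots> \<le> P ! (?c - 1)" using b bounds lenP by (intro sorted_nth_mono sorted) auto
  finally show "sel B H ! j \<le> sel B' P ! Suc j" using j by (simp add: sel_nth)
qed

lemma chain_f_zeros:
  assumes nz: "nz n" and pc: "pattern_chain B' B n"
  shows "chain (f_zeros B' (Suc n) c i) (f_zeros B n c i)"
proof (induction i)
  case 0
  then show ?case by (auto simp: chain_def nth_Cons' simp flip: replicate_Suc)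
next
  case (Suc i)
  have len: "length (f_zeros B n c i) = n" using pc by (intro length_f_zeros) (auto simp: pattern_chain_def)
  then show ?case unfolding f_zeros.simps(2) using nz T_rpoly(4)[of "f_zeros B n c i"]
    by (intro chain_sel[OF chain_T[OF Suc] _ _ pc] sorted_zeros_list) auto
qed

lemma chain_limits:
  assumes nz: "nz n" and pc: "pattern_chain B' B n"
    and L: "limits B n c L W" and L': "limits B' (Suc n) c L' W'"
  shows "chain L' L" "chain W' W"
proof -
  have lenB: "card B = n" using pc by (simp add: pattern_chain_def)
  have 1: "chain (f_zeros B' (Suc n) c i) (f_zeros B n c i)" for i by (rule chain_f_zeros[OF nz pc])
  then have 2: "chain (Tf_zeros B' (Suc n) c i) (Tf_zeros B n c i)" for i
    using nz length_f_zeros[OF lenB] by (intro chain_T) auto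
  have lenz: "length (f_zeros B n c i) = n" for i by (rule length_f_zeros[OF lenB])
  have lenw: "length (Tf_zeros B n c i) = n + r" for i using T_rpoly(4)[of "f_zeros B n c i"] nz lenz by simp
  show "chain L' L" unfolding chain_def
  proof safe
    show "length L' = Suc (length L)" using limitsD(1)[OF L] limitsD(1)[OF L'] by simp
    fix j assume "j < length L"
    then have j: "j < n" using limitsD(1)[OF L] by simp
    have l: "(\<lambda>i. f_zeros B n c i ! j) \<longlonglongrightarrow> L ! j" "(\<lambda>i. f_zeros B' (Suc n) c i ! j) \<longlonglongrightarrow> L' ! j"
       "(\<lambda>i. f_zeros B' (Suc n) c i ! Suc j) \<longlonglongrightarrow> L' ! Suc j"
      using limitsD(5)[OF L] limitsD(5)[OF L'] j by simp_all
    show "L' ! j \<le> L ! j" using 1 lenz j by (intro LIMSEQ_le[OF l(2) l(1)]) (auto simp: chain_def)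
    show "L ! j \<le> L' ! Suc j" using 1 lenz j by (intro LIMSEQ_le[OF l(1) l(3)]) (auto simp: chain_def)
  qed
  show "chain W' W" unfolding chain_def
  proof safe
    show "length W' = Suc (length W)" using limitsD(2)[OF L] limitsD(2)[OF L'] by simp
    fix j assume "j < length W"
    then have j: "j < n + r" using limitsD(2)[OF L] by simp
    have l: "(\<lambda>i. Tf_zeros B n c i ! j) \<longlonglongrightarrow> W ! j" "(\<lambda>i. Tf_zeros B' (Suc n) c i ! j) \<longlonglongrightarrow> W' ! j"
       "(\<lambda>i. Tf_zeros B' (Suc n) c i ! Suc j) \<longlonglongrightarrow> W' ! Suc j"
      using limitsD(6)[OF L] limitsD(6)[OF L'] j by simp_all
    show "W' ! j \<le> W ! j" using 2 lenw j by (intro LIMSEQ_le[OF l(2) l(1)]) (auto simp: chain_def)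
    show "W ! j \<le> W' ! Suc j" using 2 lenw j by (intro LIMSEQ_le[OF l(1) l(3)]) (auto simp: chain_def)
  qed
qed

end

subsection \<open>Interlacing and arguments in the upper half-plane\<close>

text \<open>The argument of z - x for z in the upper half-plane, written with the arctangent so that
  its bounds and its monotonicity in x are immediate.\<close>

definition ang :: "complex \<Rightarrow> real \<Rightarrow> real" where
  "ang z x = pi / 2 - arctan ((Re z - x) / Im z)"

lemma ang_bounds: "0 < ang z x" "ang z x < pi"
  using arctan_bounded[of "(Re z - x) / Im z"] by (auto simp: ang_def)

lemma ang_mono: "Im z > 0 \<Longrightarrow> x \<le> y \<Longrightarrow> ang z x \<le> ang z y"
  unfolding ang_def by (intro diff_left_mono arctan_monotone' divide_right_mono) auto

lemma cis_ang: "Im z > 0 \<Longrightarrow> \<exists>R>0. z - of_real x = of_real R * cis (ang z x)"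
proof -
  assume z: "Im z > 0"
  define t where "t = (Re z - x) / Im z"
  have c: "cos (ang z x) = t / sqrt (1 + t\<^sup>2)" "sin (ang z x) = 1 / sqrt (1 + t\<^sup>2)"
    unfolding ang_def t_def[symmetric] by (simp_all add: cos_diff sin_diff sin_arctan cos_arctan)
  have s: "sqrt (1 + t\<^sup>2) > 0" by (simp add: add_pos_nonneg)
  have "z - of_real x = of_real (Im z * sqrt (1 + t\<^sup>2)) * cis (ang z x)"
    using z s by (simp add: complex_eq_iff c) (simp add: t_def)
  moreover have "Im z * sqrt (1 + t\<^sup>2) > 0" using z s by simp
  ultimately show ?thesis by blast
qed

lemma cpoly_rpoly_cis:
  "Im z > 0 \<Longrightarrow> \<exists>R>0. cpoly (rpoly xs) z = of_real R * cis (\<Sum>i<length xs. ang z (xs ! i))"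
proof (induction xs)
  case Nil
  show ?case by (intro exI[of _ 1]) simp
next
  case (Cons x xs)
  obtain R where R: "R > 0" "cpoly (rpoly xs) z = of_real R * cis (\<Sum>i<length xs. ang z (xs ! i))"
    using Cons by blast
  obtain S where S: "S > 0" "z - of_real x = of_real S * cis (ang z x)" using cis_ang Cons by blast
  have "cpoly (rpoly (x # xs)) z = (z - of_real x) * cpoly (rpoly xs) z" by (simp add: rpoly_Cons)
  also have "\<dots> = of_real (S * R) * (cis (ang z x) * cis (\<Sum>i<length xs. ang z (xs ! i)))"
    unfolding R S by simp
  also have "cis (ang z x) * cis (\<Sum>i<length xs. ang z (xs ! i)) = cis (\<Sum>i<length (x # xs). ang z ((x # xs) ! i))"
    by (simp only: cis_mult length_Cons sum.lessThan_Suc_shift nth_Cons_0 nth_Cons_Suc)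
  finally show ?case using R S by (intro exI[of _ "S * R"]) auto
qed

lemma Im_cpoly_rpoly:
  assumes "Im z > 0"
  shows "\<exists>R>0. Im (cpoly (rpoly xs) z * cnj (cpoly (rpoly ys) z)) =
    R * sin ((\<Sum>i<length xs. ang z (xs ! i)) - (\<Sum>i<length ys. ang z (ys ! i)))"
proof -
  let ?a = "\<Sum>i<length xs. ang z (xs ! i)" and ?b = "\<Sum>i<length ys. ang z (ys ! i)"
  obtain R where R: "R > 0" "cpoly (rpoly xs) z = of_real R * cis ?a" using cpoly_rpoly_cis assms by blast
  obtain S where S: "S > 0" "cpoly (rpoly ys) z = of_real S * cis ?b" using cpoly_rpoly_cis assms by blast
  have "cpoly (rpoly xs) z * cnj (cpoly (rpoly ys) z) = of_real (R * S) * cis (?a - ?b)"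
  proof -
    have "cis ?a * cnj (cis ?b) = cis (?a - ?b)" by (simp add: cis_cnj cis_mult)
    moreover have "cpoly (rpoly xs) z * cnj (cpoly (rpoly ys) z) = of_real (R * S) * (cis ?a * cnj (cis ?b))"
      unfolding R S by (simp only: complex_cnj_mult complex_cnj_complex_of_real of_real_mult mult_ac)
    ultimately show ?thesis by simp
  qed
  then have "Im (cpoly (rpoly xs) z * cnj (cpoly (rpoly ys) z)) = (R * S) * sin (?a - ?b)"
    by simp
  then show ?thesis using R S by (intro exI[of _ "R * S"]) auto
qed

lemma cpoly_cnj: "cpoly p (cnj z) = cnj (cpoly p z)"
  by (induction p) auto

lemma hyperbolicI_upper:
  assumes "p \<noteq> 0" "\<And>z. Im z > 0 \<Longrightarrow> cpoly p z \<noteq> 0"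
  shows "hyperbolic p"
proof (rule hyperbolicI[OF assms(1)])
  fix z assume "Im z \<noteq> 0"
  then show "cpoly p z \<noteq> 0"
    using assms(2)[of z] assms(2)[of "cnj z"] by (cases "Im z > 0") (auto simp: cpoly_cnj)
qed

text \<open>In the upper half-plane the arguments of the two polynomials differ by an amount
  strictly between 0 and pi, because paired angles compare termwise. Their quotient is therefore
  nonreal, and no nontrivial real combination vanishes there.\<close>

lemma chain_pencil:
  assumes len: "length xs = Suc (length ys)"
    and le: "\<And>j. j < length ys \<Longrightarrow> xs ! j \<le> ys ! j \<and> ys ! j \<le> xs ! Suc j"
  shows "pencil (rpoly xs) (rpoly ys)"
  unfolding pencil_def
proof safe
  fix a b
  let ?p = "smult a (rpoly xs) + smult b (rpoly ys)"
  have "cpoly ?p z \<noteq> 0" if nz: "?p \<noteq> 0" and z: "Im z > 0" for z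
  proof
    assume zero: "cpoly ?p z = 0"
    let ?n = "length ys"
    let ?S = "(\<Sum>i<length xs. ang z (xs ! i)) - (\<Sum>i<length ys. ang z (ys ! i))"
    have "?S = ang z (xs ! 0) + (\<Sum>i<?n. ang z (xs ! Suc i) - ang z (ys ! i))"
      by (simp add: len sum.lessThan_Suc_shift sum_subtractf del: sum.lessThan_Suc)
    moreover have "(\<Sum>i<?n. ang z (xs ! Suc i) - ang z (ys ! i)) \<ge> 0"
      using ang_mono[OF z] le by (intro sum_nonneg) auto
    ultimately have pos: "?S > 0" using ang_bounds(1)[of z "xs ! 0"] by linarith
    have "?S = ang z (xs ! ?n) + (\<Sum>i<?n. ang z (xs ! i) - ang z (ys ! i))"
      by (simp add: len sum_subtractf)
    moreover have "(\<Sum>i<?n. ang z (xs ! i) - ang z (ys ! i)) \<le> 0"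
      using ang_mono[OF z] le by (intro sum_nonpos) auto
    ultimately have "?S < pi" using ang_bounds(2)[of z "xs ! ?n"] by linarith
    then have sin: "sin ?S > 0" using pos by (intro sin_gt_zero)
    obtain R where R: "R > 0" "Im (cpoly (rpoly xs) z * cnj (cpoly (rpoly ys) z)) = R * sin ?S"
      using Im_cpoly_rpoly[OF z] by blast
    have "a * Im (cpoly (rpoly xs) z * cnj (cpoly (rpoly ys) z)) = Im (cpoly ?p z * cnj (cpoly (rpoly ys) z))"
      by (simp add: algebra_simps)
    also have "\<dots> = 0" by (simp only: zero mult_zero_left zero_complex.sel)
    finally have "a * (R * sin ?S) = 0" unfolding R(2) .
    then have a: "a = 0" using R sin by simp
    then have "of_real b * cpoly (rpoly ys) z = 0" using zero by simp
    moreover have "cpoly (rpoly ys) z \<noteq> 0" using hyperbolicD[OF rpoly_hyperbolic] z by force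
    ultimately show False using nz a by simp
  qed
  then show "hyp0 ?p" unfolding hyp0_def using hyperbolicI_upper by blast
qed

lemma cpoly_has_field_derivative: "(cpoly p has_field_derivative cpoly (pderiv p) z) (at z)"
proof (induction p)
  case (pCons a p)
  have eq: "cpoly (pCons a p) = (\<lambda>z. of_real a + z * cpoly p z)" by (rule ext) simp
  show ?case unfolding eq by (rule derivative_eq_intros pCons refl)+ (simp add: pderiv_pCons algebra_simps)
qed (simp add: cpoly_0[abs_def])

text \<open>Here the difference of arguments lies in (-pi, 0], so the imaginary part
  \<open>w\<close> of f times the conjugate of g is nonpositive above the real axis. It vanishes on
  the axis, and its derivative in the vertical direction is the Wronskian.\<close>

lemma wronskian_nonpos:
  assumes len: "length xs = length ys"
    and le: "\<And>j. j < length ys \<Longrightarrow> xs ! j \<le> ys ! j" "\<And>j. Suc j < length xs \<Longrightarrow> ys ! j \<le> xs ! Suc j"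
  shows "poly (pderiv (rpoly xs) * rpoly ys - rpoly xs * pderiv (rpoly ys)) x \<le> 0"
proof (rule ccontr)
  define f g where "f = rpoly xs" and "g = rpoly ys"
  define w where "w e = Im (cpoly f (of_real x + \<i> * of_real e) * cnj (cpoly g (of_real x + \<i> * of_real e)))" for e
  assume "\<not> ?thesis"
  then have pos: "poly (pderiv f * g - f * pderiv g) x > 0" by (simp add: f_def g_def)
  have line: "((\<lambda>e. of_real x + \<i> * of_real e) has_vector_derivative \<i>) (at 0)"
    by (auto intro!: derivative_eq_intros)
  have dv: "((\<lambda>e. cpoly p (of_real x + \<i> * of_real e)) has_vector_derivative (\<i> * of_real (poly (pderiv p) x))) (at 0)" for p
    using field_vector_diff_chain_at[OF line, of "cpoly p" "cpoly (pderiv p) (of_real x)"]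
      cpoly_has_field_derivative[of p "of_real x"] by (simp add: o_def)
  have dc: "((\<lambda>e. cnj (cpoly g (of_real x + \<i> * of_real e))) has_vector_derivative cnj (\<i> * of_real (poly (pderiv g) x))) (at 0)"
    by (rule has_vector_derivative_cnj[OF dv])
  have "((\<lambda>e. cpoly f (of_real x + \<i> * of_real e) * cnj (cpoly g (of_real x + \<i> * of_real e)))
     has_vector_derivative (of_real (poly f x) * cnj (\<i> * of_real (poly (pderiv g) x)) + \<i> * of_real (poly (pderiv f) x) * of_real (poly g x))) (at 0)"
    using has_vector_derivative_mult[OF dv[of f] dc] by simp
  then have "(w has_vector_derivative Im (of_real (poly f x) * cnj (\<i> * of_real (poly (pderiv g) x)) + \<i> * of_real (poly (pderiv f) x) * of_real (poly g x))) (at 0)"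
    unfolding w_def by (rule bounded_linear.has_vector_derivative[OF bounded_linear_Im])
  then have "(w has_real_derivative poly (pderiv f * g - f * pderiv g) x) (at 0)"
    by (simp add: has_real_derivative_iff_has_vector_derivative algebra_simps)
  then obtain d where d: "d > 0" "\<And>h. 0 < h \<Longrightarrow> h < d \<Longrightarrow> w 0 < w (0 + h)"
    using DERIV_pos_inc_right pos by blast
  have w0: "w 0 = 0" by (simp add: w_def)
  define e where "e = d / 2"
  have e: "e > 0" "w e > 0" using d(1) d(2)[of e] w0 by (simp_all add: e_def)
  define z where "z = of_real x + \<i> * of_real e"
  have z: "Im z > 0" using e by (simp add: z_def)
  let ?S = "(\<Sum>i<length xs. ang z (xs ! i)) - (\<Sum>i<length ys. ang z (ys ! i))"
  have "?S = (\<Sum>i<length ys. ang z (xs ! i) - ang z (ys ! i))" by (simp add: len sum_subtractf)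
  also have "\<dots> \<le> 0" using ang_mono[OF z] le by (intro sum_nonpos) auto
  finally have S0: "?S \<le> 0" .
  have "?S > - pi"
  proof (cases "length ys")
    case (Suc m)
    have "?S = ang z (xs ! 0) - ang z (ys ! m) + (\<Sum>i<m. ang z (xs ! Suc i) - ang z (ys ! i))"
      unfolding len Suc by (subst sum.lessThan_Suc_shift) (simp add: sum_subtractf)
    moreover have "(\<Sum>i<m. ang z (xs ! Suc i) - ang z (ys ! i)) \<ge> 0"
      using ang_mono[OF z] le(2) len Suc by (intro sum_nonneg) auto
    ultimately show ?thesis using ang_bounds(1)[of z "xs ! 0"] ang_bounds(2)[of z "ys ! m"] by linarith
  qed (use len in simp)
  then have "sin (- ?S) \<ge> 0" using S0 by (intro sin_ge_zero) auto
  then have "sin ?S \<le> 0" by (simp only: sin_minus)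
  moreover obtain R where "R > 0" "Im (cpoly (rpoly xs) z * cnj (cpoly (rpoly ys) z)) = R * sin ?S"
    using Im_cpoly_rpoly[OF z] by blast
  ultimately have "w e \<le> 0" by (simp add: w_def z_def f_def g_def mult_nonneg_nonpos)
  then show False using e by simp
qed

subsection \<open>Real-rooted symbols at a fixed point\<close>

text \<open>Real and imaginary part of \<open>(z - (u + \<i> v))\<^sup>m\<close> for real \<open>z\<close>.\<close>
fun re_im_power :: "real \<Rightarrow> real \<Rightarrow> nat \<Rightarrow> real poly \<times> real poly" where
  "re_im_power u v 0 = (1, 0)"
| "re_im_power u v (Suc m) = (let (F, G) = re_im_power u v m in
     ([:- u, 1:] * F + smult v G, [:- u, 1:] * G - smult v F))"

definition re_pow :: "real \<Rightarrow> real \<Rightarrow> nat \<Rightarrow> real poly" where "re_pow u v m = fst (re_im_power u v m)"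
definition im_pow :: "real \<Rightarrow> real \<Rightarrow> nat \<Rightarrow> real poly" where "im_pow u v m = snd (re_im_power u v m)"

lemma re_im_pow_0: "re_pow u v 0 = 1" "im_pow u v 0 = 0"
  and re_pow_Suc: "re_pow u v (Suc m) = [:- u, 1:] * re_pow u v m + smult v (im_pow u v m)"
  and im_pow_Suc: "im_pow u v (Suc m) = [:- u, 1:] * im_pow u v m - smult v (re_pow u v m)"
  by (simp_all add: re_pow_def im_pow_def case_prod_beta Let_def)

lemma cpoly_re_im_pow:
  "cpoly (re_pow u v m) z + \<i> * cpoly (im_pow u v m) z = (z - Complex u v) ^ m"
  "cpoly (re_pow u v m) z - \<i> * cpoly (im_pow u v m) z = (z - Complex u (- v)) ^ m"
proof (induction m)
  case (Suc m)
  have "Complex u v = of_real u + \<i> * of_real v" "Complex u (- v) = of_real u - \<i> * of_real v"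
    by (simp_all add: complex_eq_iff)
  then have c: "z - Complex u v = (z - of_real u) - \<i> * of_real v" "z - Complex u (- v) = (z - of_real u) + \<i> * of_real v"
    by simp_all
  have r: "cpoly (re_pow u v (Suc m)) z = (z - of_real u) * cpoly (re_pow u v m) z + of_real v * cpoly (im_pow u v m) z"
    and i: "cpoly (im_pow u v (Suc m)) z = (z - of_real u) * cpoly (im_pow u v m) z - of_real v * cpoly (re_pow u v m) z"
    by (simp_all add: re_pow_Suc im_pow_Suc)
  have ii: "\<i> * (\<i> * y) = - y" for y by (simp add: mult.assoc[symmetric])
  show "cpoly (re_pow u v (Suc m)) z + \<i> * cpoly (im_pow u v (Suc m)) z = (z - Complex u v) ^ Suc m"
    unfolding r i power_Suc Suc(1)[symmetric] unfolding c by (simp add: algebra_simps ii)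
  show "cpoly (re_pow u v (Suc m)) z - \<i> * cpoly (im_pow u v (Suc m)) z = (z - Complex u (- v)) ^ Suc m"
    unfolding r i power_Suc Suc(2)[symmetric] unfolding c by (simp add: algebra_simps ii)
qed (simp_all add: re_im_pow_0)

lemma pderiv_re_im_pow:
  "pderiv (re_pow u v (Suc m)) = smult (real (Suc m)) (re_pow u v m) \<and>
   pderiv (im_pow u v (Suc m)) = smult (real (Suc m)) (im_pow u v m)"
proof (induction m)
  case 0
  then show ?case by (simp add: re_pow_Suc im_pow_Suc re_im_pow_0 pderiv_pCons pderiv_add pderiv_diff pderiv_minus pderiv_smult one_pCons[symmetric])
next
  case (Suc m)
  have "pderiv (re_pow u v (Suc (Suc m))) = [:- u, 1:] * pderiv (re_pow u v (Suc m)) + re_pow u v (Suc m) + smult v (pderiv (im_pow u v (Suc m)))"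
    unfolding re_pow_Suc[of u v "Suc m"] pderiv_add pderiv_linear_mult pderiv_smult ..
  also have "\<dots> = re_pow u v (Suc m) + smult (real (Suc m)) ([:- u, 1:] * re_pow u v m + smult v (im_pow u v m))"
    using Suc by (simp add: smult_add_right mult.commute)
  also have "\<dots> = smult (real (Suc (Suc m))) (re_pow u v (Suc m))"
    unfolding re_pow_Suc[of u v m, symmetric] by (simp only: of_nat_Suc[of "Suc m"] smult_add_left smult_1_left)
  finally have 1: "pderiv (re_pow u v (Suc (Suc m))) = smult (real (Suc (Suc m))) (re_pow u v (Suc m))" .
  have "pderiv (im_pow u v (Suc (Suc m))) = [:- u, 1:] * pderiv (im_pow u v (Suc m)) + im_pow u v (Suc m) - smult v (pderiv (re_pow u v (Suc m)))"
    unfolding im_pow_Suc[of u v "Suc m"] pderiv_diff pderiv_linear_mult pderiv_smult ..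
  also have "\<dots> = im_pow u v (Suc m) + smult (real (Suc m)) ([:- u, 1:] * im_pow u v m - smult v (re_pow u v m))"
    using Suc by (simp add: smult_diff_right mult.commute)
  also have "\<dots> = smult (real (Suc (Suc m))) (im_pow u v (Suc m))"
    unfolding im_pow_Suc[of u v m, symmetric] by (simp only: of_nat_Suc[of "Suc m"] smult_add_left smult_1_left)
  finally show ?case using 1 by simp
qed

lemma higher_pderiv_re_im_pow:
  "k \<le> m \<Longrightarrow> (pderiv ^^ k) (re_pow u v m) = smult (falling m k) (re_pow u v (m - k)) \<and>
             (pderiv ^^ k) (im_pow u v m) = smult (falling m k) (im_pow u v (m - k))"
proof (induction k)
  case (Suc k)
  then obtain j where j: "m - k = Suc j" "m - Suc k = j" by (metis Suc_diff_Suc Suc_le_eq)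
  have "falling m (Suc k) = falling m k * real (Suc j)" using falling_mult_diff[of m k] j by simp
  then show ?case using Suc j pderiv_re_im_pow[of u v j] by (simp add: pderiv_smult)
qed auto

text \<open>Twice the combination is a sum of the m-th powers for u + i v and its conjugate with
  conjugate coefficients. A zero is equidistant from both points, hence real.\<close>

lemma re_im_pow_combination_nonzero:
  assumes v: "v \<noteq> 0" and m: "m > 0" and ab: "a \<noteq> 0 \<or> b \<noteq> 0" and z: "Im z \<noteq> 0"
  shows "cpoly (smult a (re_pow u v m) + smult b (im_pow u v m)) z \<noteq> 0"
proof
  assume "cpoly (smult a (re_pow u v m) + smult b (im_pow u v m)) z = 0"
  then have *: "of_real a * cpoly (re_pow u v m) z + of_real b * cpoly (im_pow u v m) z = 0" by simp
  let ?p = "(z - Complex u v) ^ m" and ?q = "(z - Complex u (- v)) ^ m"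
  have ii: "\<i> * (\<i> * y) = - y" for y by (simp add: mult.assoc[symmetric])
  have "Complex a (- b) * ?p + Complex a b * ?q = 2 * (of_real a * cpoly (re_pow u v m) z + of_real b * cpoly (im_pow u v m) z)"
  proof -
    have c: "Complex a b = of_real a + \<i> * of_real b" "Complex a (- b) = of_real a - \<i> * of_real b"
      by (simp_all add: complex_eq_iff)
    show ?thesis unfolding c cpoly_re_im_pow(1)[of u v m z, symmetric] cpoly_re_im_pow(2)[of u v m z, symmetric]
      by (simp add: algebra_simps ii)
  qed
  then have "Complex a (- b) * ?p = - (Complex a b * ?q)" using * by (simp add: add_eq_0_iff)
  then have "norm (Complex a (- b)) * norm (z - Complex u v) ^ m = norm (Complex a b) * norm (z - Complex u (- v)) ^ m"
    by (metis norm_minus_cancel norm_mult norm_power)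
  moreover have "norm (Complex a (- b)) = norm (Complex a b)" "norm (Complex a b) \<noteq> 0"
    using ab by (auto simp: complex_norm complex_eq_iff)
  ultimately have "norm (z - Complex u v) ^ m = norm (z - Complex u (- v)) ^ m" by simp
  then have "norm (z - Complex u v) = norm (z - Complex u (- v))"
    using m by (metis norm_ge_zero power_eq_imp_eq_base)
  then have "(Im z - v)\<^sup>2 = (Im z + v)\<^sup>2" by (simp add: cmod_def)
  then have "Im z * v = 0" by (simp add: power2_eq_square algebra_simps)
  then show False using v z by simp
qed

lemma re_im_pow_pencil: "v \<noteq> 0 \<Longrightarrow> m > 0 \<Longrightarrow> pencil (re_pow u v m) (im_pow u v m)"
  and re_im_pow_independent: "v \<noteq> 0 \<Longrightarrow> m > 0 \<Longrightarrow> a \<noteq> 0 \<or> b \<noteq> 0 \<Longrightarrow> smult a (re_pow u v m) + smult b (im_pow u v m) \<noteq> 0"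
proof -
  assume *: "v \<noteq> 0" "m > 0"
  show "pencil (re_pow u v m) (im_pow u v m)" unfolding pencil_def
  proof safe
    fix a b
    show "hyp0 (smult a (re_pow u v m) + smult b (im_pow u v m))"
    proof (cases "a \<noteq> 0 \<or> b \<noteq> 0")
      case True
      then show ?thesis unfolding hyp0_def using re_im_pow_combination_nonzero[OF * True] hyperbolicI by blast
    qed (auto simp: hyp0_def)
  qed
  show "smult a (re_pow u v m) + smult b (im_pow u v m) \<noteq> 0" if "a \<noteq> 0 \<or> b \<noteq> 0"
    using re_im_pow_combination_nonzero[OF * that, of \<i> u] by (metis cpoly_0 imaginary_unit.simps(2) one_neq_zero)
qed

text \<open>At a double zero the real and the imaginary part of (a - i b) (x - u - i v)^m both
  vanish, which is impossible for \<open>v \<noteq> 0\<close>.\<close>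

lemma re_im_pow_simple:
  assumes v: "v \<noteq> 0" and ab: "a \<noteq> 0 \<or> b \<noteq> 0"
    and p: "p = smult a (re_pow u v (Suc m)) + smult b (im_pow u v (Suc m))" and x: "poly p x = 0"
  shows "poly (pderiv p) x \<noteq> 0"
proof
  assume "poly (pderiv p) x = 0"
  then have "real (Suc m) * (a * poly (re_pow u v m) x + b * poly (im_pow u v m) x) = 0"
    using pderiv_re_im_pow[of u v m] by (simp add: p pderiv_add pderiv_smult algebra_simps)
  then have 1: "a * poly (re_pow u v m) x + b * poly (im_pow u v m) x = 0" by (simp only: mult_eq_0_iff of_nat_eq_0_iff) auto
  have "poly p x = (x - u) * (a * poly (re_pow u v m) x + b * poly (im_pow u v m) x) + v * (a * poly (im_pow u v m) x - b * poly (re_pow u v m) x)"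
    by (simp add: p re_pow_Suc im_pow_Suc algebra_simps)
  then have 2: "a * poly (im_pow u v m) x - b * poly (re_pow u v m) x = 0" using 1 x v by simp
  have "(a\<^sup>2 + b\<^sup>2) * poly (re_pow u v m) x = a * (a * poly (re_pow u v m) x + b * poly (im_pow u v m) x) - b * (a * poly (im_pow u v m) x - b * poly (re_pow u v m) x)"
    "(a\<^sup>2 + b\<^sup>2) * poly (im_pow u v m) x = b * (a * poly (re_pow u v m) x + b * poly (im_pow u v m) x) + a * (a * poly (im_pow u v m) x - b * poly (re_pow u v m) x)"
    by (simp_all add: algebra_simps power2_eq_square)
  then have "(a\<^sup>2 + b\<^sup>2) * poly (re_pow u v m) x = 0" "(a\<^sup>2 + b\<^sup>2) * poly (im_pow u v m) x = 0"
    unfolding 1 2 by simp_all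
  moreover have "a\<^sup>2 + b\<^sup>2 \<noteq> 0" using ab by (simp add: sum_power2_eq_zero_iff)
  ultimately have "poly (re_pow u v m) x = 0" "poly (im_pow u v m) x = 0" by (metis mult_eq_0_iff)+
  then have "(of_real x - Complex u v) ^ m = 0" using cpoly_re_im_pow(1)[of u v m "of_real x"] by simp
  then have "of_real x = Complex u v" by simp
  then show False using v by (simp add: complex_eq_iff)
qed

text \<open>Dividing out the zeros of a polynomial with simple zeros one by one yields polynomials of all
  smaller degrees.\<close>
lemma functional_vanishes:
  fixes \<psi> :: "real poly \<Rightarrow> real"
  assumes lin: "\<And>f g. \<psi> (f - g) = \<psi> f - \<psi> g" "\<And>c f. \<psi> (smult c f) = c * \<psi> f"
    and xs: "distinct xs" "\<psi> (rpoly xs) = 0" "\<And>b. b \<in> set xs \<Longrightarrow> \<psi> (rpoly (remove1 b xs)) = 0"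
    and deg: "degree f \<le> length xs"
  shows "\<psi> f = 0"
  using xs deg
proof (induction xs arbitrary: f)
  case Nil
  then obtain c where "f = [:c:]" using degree_eq_zeroE by (metis le_zero_eq list.size(3))
  then have "f = smult c (rpoly [])" by (simp add: one_pCons)
  then have "\<psi> f = c * \<psi> (rpoly [])" by (simp only: lin(2))
  then show ?case using Nil by simp
next
  case (Cons b ys)
  have ys: "\<psi> (rpoly ys) = 0" using Cons.prems(3)[of b] by simp
  have rem: "\<psi> (rpoly (remove1 c ys)) = 0" if c: "c \<in> set ys" for c
  proof -
    have cb: "c \<noteq> b" using c Cons.prems(1) by auto
    have "\<psi> (rpoly (b # remove1 c ys)) = 0" using Cons.prems(3)[of c] c cb by simp
    moreover have "rpoly ys = rpoly (c # remove1 c ys)" using c by (intro rpoly_mset_cong) simp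
    \<comment> \<open>Two polynomials that differ only in the factors z - b and z - c have a
      multiple of the common cofactor as difference; so the functional also vanishes when two zeros
      are divided out.\<close>
    ultimately have "\<psi> (rpoly (b # remove1 c ys) - rpoly (c # remove1 c ys)) = 0" using lin ys by simp
    also have "rpoly (b # remove1 c ys) - rpoly (c # remove1 c ys) = smult (c - b) (rpoly (remove1 c ys))"
      unfolding rpoly_Cons by (simp add: mult_pCons_left smult_diff_left)
    finally show ?thesis using lin cb by simp
  qed
  have small: "\<psi> g = 0" if "degree g \<le> length ys" for g
    using Cons.IH[of g] Cons.prems(1) ys rem that by simp
  define c where "c = coeff f (Suc (length ys))"
  have "degree (f - smult c (rpoly (b # ys))) \<le> length ys"
  proof (rule degree_le, safe)
    fix i assume i: "length ys < i"
    show "coeff (f - smult c (rpoly (b # ys))) i = 0"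
    proof (cases "i = Suc (length ys)")
      case True
      then show ?thesis using lead_coeff_rpoly[of "b # ys"] by (simp add: c_def)
    next
      case False
      then have "i > degree f" "i > degree (rpoly (b # ys))" using i Cons.prems(4) by simp_all
      then show ?thesis by (simp only: coeff_diff coeff_smult coeff_eq_0)
    qed
  qed
  then have "\<psi> (f - smult c (rpoly (b # ys))) = 0" by (rule small)
  then show ?case using Cons.prems(2) lin by simp
qed

lemma falling_div_power_tendsto: "(\<lambda>m. falling m k / real m ^ k) \<longlonglongrightarrow> 1"
proof -
  have "(\<lambda>m. \<Prod>i<k. 1 - real i / real m) \<longlonglongrightarrow> (\<Prod>i<k. 1 - 0)"
    by (intro tendsto_prod tendsto_diff tendsto_const lim_const_over_n)
  then have lim: "(\<lambda>m. \<Prod>i<k. 1 - real i / real m) \<longlonglongrightarrow> 1" by simp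
  have "\<forall>\<^sub>F m in sequentially. (\<Prod>i<k. 1 - real i / real m) = falling m k / real m ^ k"
    using eventually_gt_at_top[of 0]
  proof eventually_elim
    case (elim m)
    have "falling m k / real m ^ k = (\<Prod>i<k. (real m - real i) / real m)"
      by (simp add: falling_def prod_dividef)
    also have "\<dots> = (\<Prod>i<k. 1 - real i / real m)"
      using elim by (intro prod.cong) (auto simp: field_simps)
    finally show ?case by simp
  qed
  then show ?thesis using Lim_transform_eventually[OF lim] by simp
qed

context hyp_op
begin

definition symb :: "real \<Rightarrow> real poly" where
  "symb \<theta> = (\<Sum>k=0..N. monom (poly (Q k) \<theta>) k)"

lemma coeff_symb: "coeff (symb \<theta>) k = poly (Q k) \<theta>"
  using Q_eq_0[of k] by (auto simp: symb_def coeff_sum)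

lemma degree_symb: "degree (symb \<theta>) \<le> N"
  by (intro degree_le) (auto simp: coeff_symb Q_eq_0)

lemma poly_T_eq: "poly (T g) \<theta> = (\<Sum>k=0..N. poly (Q k) \<theta> * poly ((pderiv ^^ k) g) \<theta>)"
  by (simp add: diff_op_def poly_sum)

text \<open>If \<open>T\<close> annihilated real and imaginary part of \<open>(z - x)\<^sup>m\<close> at \<open>\<theta>\<close>, then some real combination
  \<open>p\<close> would have an image with a double zero at \<open>\<theta>\<close>, so that \<open>T (p / (z - \<beta>))\<close> would vanish
  at \<open>\<theta>\<close> for all zeros \<open>\<beta>\<close> of \<open>p\<close> as well.\<close>
lemma symb_eq_0_of_common_zero:
  assumes v: "v \<noteq> 0" and m: "m > N"
    and F0: "poly (T (re_pow u v m)) \<theta> = 0" and G0: "poly (T (im_pow u v m)) \<theta> = 0"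
  shows "symb \<theta> = 0"
proof -
  obtain m' where m': "m = Suc m'" using m by (cases m) auto
  define a0 b0 where "a0 = poly (pderiv (T (im_pow u v m))) \<theta>" and "b0 = - poly (pderiv (T (re_pow u v m))) \<theta>"
  \<comment> \<open>The derivative of the image of \<open>p\<close> at \<open>\<theta>\<close>
    cancels for the coefficients \<open>a0\<close>, \<open>b0\<close>. If both are zero, every
    combination has this property, and (1, 0) is taken.\<close>
  define a b where "a = (if a0 = 0 \<and> b0 = 0 then 1 else a0)" and "b = (if a0 = 0 \<and> b0 = 0 then 0 else b0)"
  have ab: "a \<noteq> 0 \<or> b \<noteq> 0" by (auto simp: a_def b_def)
  define p where "p = smult a (re_pow u v m) + smult b (im_pow u v m)"
  have nz: "p \<noteq> 0" unfolding p_def using re_im_pow_independent[OF v _ ab] m by simp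
  have pen: "pencil (re_pow u v m) (im_pow u v m)" using re_im_pow_pencil[OF v] m by simp
  have hyp: "hyperbolic p" using nz pencilD[OF pen] unfolding p_def hyp0_def by blast
  have "degree (re_pow u v j) = j \<and> coeff (re_pow u v j) j = 1 \<and> degree (im_pow u v j) \<le> j \<and> coeff (im_pow u v j) j = 0" for j
  proof (induction j)
    case (Suc j)
    have r: "coeff (re_pow u v (Suc j)) i = (if i = 0 then 0 else coeff (re_pow u v j) (i - 1)) - u * coeff (re_pow u v j) i + v * coeff (im_pow u v j) i"
      and i: "coeff (im_pow u v (Suc j)) i = (if i = 0 then 0 else coeff (im_pow u v j) (i - 1)) - u * coeff (im_pow u v j) i - v * coeff (re_pow u v j) i" for i
      by (simp_all add: re_pow_Suc im_pow_Suc mult_pCons_left coeff_pCons split: nat.split)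
    have 1: "coeff (re_pow u v (Suc j)) (Suc j) = 1" "coeff (im_pow u v (Suc j)) (Suc j) = 0"
      using Suc by (simp_all add: r i coeff_eq_0)
    have "degree (re_pow u v (Suc j)) \<le> Suc j" "degree (im_pow u v (Suc j)) \<le> Suc j"
      using Suc by (auto intro!: degree_le simp: r i coeff_eq_0)
    then show ?case using 1 le_degree[of "re_pow u v (Suc j)" "Suc j"] by simp
  qed (simp add: re_im_pow_0)
  then have degF: "degree (re_pow u v m) = m" "re_pow u v m \<noteq> 0" by (metis, metis coeff_0 zero_neq_one)
  \<comment> \<open>The top coefficient of \<open>p\<close> may vanish, but degrees in a pencil
    differ by at most one, so \<open>m > N\<close> still gives degree at least
    \<open>N\<close>.\<close>
  have "pencil (re_pow u v m) p" using pencil_comb[OF pen, of 1 0 a b] by (simp add: p_def)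
  then have dp: "N \<le> degree p" using pencil_degree[of "re_pow u v m" p] degF nz m by simp
  have QN: "Q N \<noteq> 0" using top_coeff by auto
  have Tp: "T p \<noteq> 0" using T_nonzero[OF _ nz] QN dp by (auto simp: nz_def)
  have "T p = smult a (T (re_pow u v m)) + smult b (T (im_pow u v m))" by (simp add: p_def T_add T_smult)
  then have p0: "poly (T p) \<theta> = 0" "poly (pderiv (T p)) \<theta> = 0"
    using F0 G0 by (auto simp: pderiv_add pderiv_smult a_def b_def a0_def b0_def)
  have sq: "rsquarefree p" unfolding rsquarefree_roots
    using re_im_pow_simple[OF v ab p_def[unfolded m']] by blast
  define xs where "xs = zeros_list p"
  have lenxs: "length xs = degree p" unfolding xs_def by (rule length_zeros_list_hyperbolic[OF hyp])
  have fin: "finite {x. poly p x = 0}" by (rule poly_roots_finite[OF nz])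
  have ms: "mset xs = mset_set {x. poly p x = 0}"
    unfolding xs_def mset_zeros_list by (rule proots_rsquarefree[OF sq])
  have "set xs = {x. poly p x = 0}" using arg_cong[OF ms, of set_mset] fin by simp
  then have "card (set xs) = length xs" using arg_cong[OF ms, of size] by simp
  then have dist: "distinct xs" by (rule card_distinct)
  have pxs: "p = smult (lead_coeff p) (rpoly xs)" using rpoly_zeros[OF hyp] by (simp add: xs_def)
  have van: "poly (T f) \<theta> = 0" if "degree f \<le> degree p" for f
  proof (rule functional_vanishes[of "\<lambda>f. poly (T f) \<theta>", OF _ _ dist])
    show "poly (T (rpoly xs)) \<theta> = 0" using p0(1) nz by (subst (asm) pxs) (simp add: T_smult)
    fix b assume "b \<in> set xs"
    then have "rpoly xs = rpoly (b # remove1 b xs)" by (intro rpoly_mset_cong) simp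
    then have "p = smult (lead_coeff p) ([:- b, 1:] * rpoly (remove1 b xs))" using pxs by (simp add: rpoly_Cons)
    moreover have "pencil ([:- b, 1:] * rpoly (remove1 b xs)) (rpoly (remove1 b xs))" by (intro pencil_linear) simp
    ultimately have "pencil p (rpoly (remove1 b xs))"
      using pencil_comb[of "[:- b, 1:] * rpoly (remove1 b xs)" "rpoly (remove1 b xs)" "lead_coeff p" 0 0 1] by simp
    then show "poly (T (rpoly (remove1 b xs))) \<theta> = 0"
      using pencil_double_zero[OF T_pencil Tp p0] by blast
  qed (use that lenxs in \<open>simp_all add: T_diff T_smult\<close>)
  have "poly (Q k) \<theta> = 0" if k: "k \<le> N" for k
  proof -
    have "degree ([:- \<theta>, 1:] ^ k) \<le> degree p" using k dp by (simp add: degree_power_eq)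
    then have "0 = (\<Sum>i=0..N. poly (Q i) \<theta> * falling k i * 0 ^ (k - i))"
      using van poly_T_linear_power[of \<theta> k \<theta>] by simp
    also have "\<dots> = (\<Sum>i=0..N. if i = k then poly (Q k) \<theta> * falling k k else 0)"
      by (intro sum.cong) (auto simp: falling_eq_0 power_0_left)
    finally show ?thesis using k falling_pos[of k k] by simp
  qed
  then show ?thesis by (intro poly_eqI) (metis coeff_0 coeff_symb Q_eq_0 linorder_not_le poly_0)
qed

text \<open>The symbol is the limit of the polynomials \<open>R m\<close>, since
  \<open>falling m k\<close> is asymptotic to \<open>m ^ k\<close>. A nonreal zero of
  \<open>R m\<close> would produce a power (z - u - i v)^m whose image has vanishing real and
  imaginary part at \<open>\<theta>\<close>.\<close>

lemma symb_hyp0: "hyp0 (symb \<theta>)"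
proof (cases "symb \<theta> = 0")
  case False
  define R where "R m = (\<Sum>k=0..N. monom (poly (Q k) \<theta> * (falling m k / real m ^ k)) k)" for m
  have mon: "cpoly (monom c k) w = of_real c * w ^ k" for c k w
    by (induction k) (auto simp: monom_Suc monom_0)
  show ?thesis
  proof (rule hyp0_limit)
    show "\<forall>\<^sub>F m in sequentially. degree (R m) \<le> N"
      by (intro always_eventually allI) (auto simp: R_def intro!: degree_sum_le order_trans[OF degree_monom_le])
    show "(\<lambda>m. cpoly (R m) w) \<longlonglongrightarrow> cpoly (symb \<theta>) w" for w
    proof -
      have "(\<lambda>m. \<Sum>k=0..N. of_real (poly (Q k) \<theta> * (falling m k / real m ^ k)) * w ^ k)
        \<longlonglongrightarrow> (\<Sum>k=0..N. of_real (poly (Q k) \<theta> * 1) * w ^ k)"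
        by (intro tendsto_sum tendsto_mult tendsto_of_real tendsto_const falling_div_power_tendsto)
      then show ?thesis by (simp add: R_def symb_def mon)
    qed
    show "\<forall>\<^sub>F m in sequentially. hyp0 (R m)"
      using eventually_gt_at_top[of N]
    proof eventually_elim
      case (elim m)
      have "cpoly (R m) w \<noteq> 0" if w: "Im w \<noteq> 0" for w
      proof
        assume zero: "cpoly (R m) w = 0"
        \<comment> \<open>With \<open>\<theta>\<close> minus the base point equal to y = m / w, the
          factor \<open>y ^ (m - k)\<close> in the k-th derivative becomes y^m w^k / m^k, so the
          image at \<open>\<theta>\<close> is y^m times the value of \<open>R m\<close> at
          \<open>w\<close>.\<close>
        define y where "y = of_nat m / w"
        have w0: "w \<noteq> 0" using w by auto
        have m0: "m > 0" using elim by simp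
        define u v where "u = \<theta> - Re y" and "v = - Im y"
        have xy: "of_real \<theta> - Complex u v = y" by (simp add: u_def v_def complex_eq_iff)
        have v: "v \<noteq> 0" using w w0 m0 by (auto simp: v_def y_def Im_divide complex_eq_iff)
        have y0: "y \<noteq> 0" using w0 m0 by (simp add: y_def)
        let ?F = "re_pow u v m" and ?G = "im_pow u v m"
        have hp: "of_real (poly ((pderiv ^^ k) ?F) \<theta>) + \<i> * of_real (poly ((pderiv ^^ k) ?G) \<theta>) = of_real (falling m k) * y ^ (m - k)"
          if "k \<le> N" for k
        proof -
          have "k \<le> m" using that elim by simp
          then have "of_real (poly ((pderiv ^^ k) ?F) \<theta>) + \<i> * of_real (poly ((pderiv ^^ k) ?G) \<theta>)
             = of_real (falling m k) * (cpoly (re_pow u v (m - k)) (of_real \<theta>) + \<i> * cpoly (im_pow u v (m - k)) (of_real \<theta>))"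
            using higher_pderiv_re_im_pow[of k m u v] by (simp add: algebra_simps)
          then show ?thesis unfolding cpoly_re_im_pow(1) xy .
        qed
        have "of_real (poly (T ?F) \<theta>) + \<i> * of_real (poly (T ?G) \<theta>) =
          (\<Sum>k=0..N. of_real (poly (Q k) \<theta>) * (of_real (poly ((pderiv ^^ k) ?F) \<theta>) + \<i> * of_real (poly ((pderiv ^^ k) ?G) \<theta>)))"
          by (simp add: poly_T_eq sum_distrib_left sum.distrib algebra_simps)
        also have "\<dots> = (\<Sum>k=0..N. of_real (poly (Q k) \<theta>) * (of_real (falling m k) * y ^ (m - k)))"
          by (intro sum.cong refl) (simp only: hp atLeastAtMost_iff)
        also have "\<dots> = (\<Sum>k=0..N. y ^ m * (of_real (poly (Q k) \<theta> * (falling m k / real m ^ k)) * w ^ k))"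
        proof (intro sum.cong refl)
          fix k assume "k \<in> {0..N}"
          then have "k \<le> m" using elim by simp
          then have "y ^ (m - k) = y ^ m / y ^ k" using y0 by (simp add: power_diff)
          also have "\<dots> = y ^ m * (w ^ k / of_nat m ^ k)" using w0 m0 by (simp add: y_def power_divide)
          finally show "of_real (poly (Q k) \<theta>) * (of_real (falling m k) * y ^ (m - k)) =
             y ^ m * (of_real (poly (Q k) \<theta> * (falling m k / real m ^ k)) * w ^ k)" by simp
        qed
        also have "\<dots> = y ^ m * cpoly (R m) w" by (simp add: R_def mon sum_distrib_left)
        also have "\<dots> = 0" using zero by simp
        finally have "poly (T ?F) \<theta> = 0" "poly (T ?G) \<theta> = 0" by (simp_all add: complex_eq_iff)
        then show False using symb_eq_0_of_common_zero[OF v] elim False by blast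
      qed
      then show ?case unfolding hyp0_def using hyperbolicI by blast
    qed
  qed simp
qed (simp add: hyp0_def)

end

subsection \<open>Common zeros of the images of an interlacing pair\<close>

text \<open>The product of the operators D - l over all l in \<open>ls\<close>, in expanded form so
  that its coefficients match those of \<open>symb\<close>.\<close>

definition dsum :: "real list \<Rightarrow> real poly \<Rightarrow> real poly" where
  "dsum ls f = (\<Sum>k\<le>length ls. smult (coeff (rpoly ls) k) ((pderiv ^^ k) f))"

lemma dsum_Nil [simp]: "dsum [] f = f"
  by (simp add: dsum_def)

lemma dsum_Cons: "dsum (l # ls) f = pderiv (dsum ls f) - smult l (dsum ls f)"
proof -
  let ?c = "coeff (rpoly ls)"
  have smult_sum: "smult c (sum g A) = (\<Sum>x\<in>A. smult c (g x))" for c and g :: "nat \<Rightarrow> real poly" and A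
    by (induction A rule: infinite_finite_induct) (auto simp: smult_add_right)
  have pderiv_sum: "pderiv (sum g A) = (\<Sum>x\<in>A. pderiv (g x))" for g :: "nat \<Rightarrow> real poly" and A
    by (induction A rule: infinite_finite_induct) (auto simp: pderiv_add)
  have co: "coeff (rpoly (l # ls)) k = (if k = 0 then 0 else ?c (k - 1)) - l * ?c k" for k
    unfolding rpoly_Cons by (simp add: mult_pCons_left coeff_pCons split: nat.split)
  have "dsum (l # ls) f = (\<Sum>k\<le>Suc (length ls). smult (if k = 0 then 0 else ?c (k - 1)) ((pderiv ^^ k) f))
      - (\<Sum>k\<le>Suc (length ls). smult (l * ?c k) ((pderiv ^^ k) f))"
    by (simp only: dsum_def co length_Cons smult_diff_left sum_subtractf)
  also have "(\<Sum>k\<le>Suc (length ls). smult (if k = 0 then 0 else ?c (k - 1)) ((pderiv ^^ k) f)) = (\<Sum>k\<le>length ls. smult (?c k) (pderiv ((pderiv ^^ k) f)))"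
    by (subst sum.atMost_Suc_shift) simp
  also have "\<dots> = pderiv (dsum ls f)" by (simp add: dsum_def pderiv_sum pderiv_smult)
  also have "(\<Sum>k\<le>Suc (length ls). smult (l * ?c k) ((pderiv ^^ k) f)) = smult l (dsum ls f)"
    by (simp add: dsum_def coeff_eq_0 smult_sum)
  finally show ?thesis .
qed

text \<open>Up to the factor |f|^2 this is the imaginary part of f'/f, the sum of 1 / (z - c) over
  the zeros c. Hence f' - l f has no zero above the real axis, which makes each D - l preserve
  \<open>hyp0\<close>.\<close>

lemma Im_logarithmic_derivative:
  "hyperbolic f \<Longrightarrow> Im z > 0 \<Longrightarrow> Im (cpoly (pderiv f) z * cnj (cpoly f z)) \<le> 0 \<and>
     (degree f > 0 \<longrightarrow> Im (cpoly (pderiv f) z * cnj (cpoly f z)) < 0)"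
proof (induction rule: hyperbolic_induct)
  case (linear c g)
  have d: "cpoly (pderiv ([:- c, 1:] * g)) z = (z - of_real c) * cpoly (pderiv g) z + cpoly g z"
    unfolding pderiv_linear_mult by simp
  have f: "cpoly ([:- c, 1:] * g) z = (z - of_real c) * cpoly g z" by simp
  have g0: "cpoly g z \<noteq> 0" using hyperbolicD[OF linear(1), of z] linear(3) by auto
  have "cpoly (pderiv ([:- c, 1:] * g)) z * cnj (cpoly ([:- c, 1:] * g) z) =
     ((z - of_real c) * cnj (z - of_real c)) * (cpoly (pderiv g) z * cnj (cpoly g z)) + (cpoly g z * cnj (cpoly g z)) * cnj (z - of_real c)"
    unfolding d f by (simp add: algebra_simps)
  also have "\<dots> = of_real ((norm (z - of_real c))\<^sup>2) * (cpoly (pderiv g) z * cnj (cpoly g z)) + of_real ((norm (cpoly g z))\<^sup>2) * cnj (z - of_real c)"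
    by (simp only: complex_norm_square)
  finally have eq: "Im (cpoly (pderiv ([:- c, 1:] * g)) z * cnj (cpoly ([:- c, 1:] * g) z)) =
     (norm (z - of_real c))\<^sup>2 * Im (cpoly (pderiv g) z * cnj (cpoly g z)) - (norm (cpoly g z))\<^sup>2 * Im z"
    by simp
  have "(norm (z - of_real c))\<^sup>2 * Im (cpoly (pderiv g) z * cnj (cpoly g z)) \<le> 0"
    using linear by (intro mult_nonneg_nonpos) auto
  moreover have "(norm (cpoly g z))\<^sup>2 * Im z > 0" using g0 linear(3) by simp
  ultimately show ?case unfolding eq by linarith
qed simp

lemma pderiv_minus_smult_hyp0: "hyp0 f \<Longrightarrow> hyp0 (pderiv f - smult l f)"
proof (cases "f = 0")
  case False
  assume "hyp0 f"
  then have f: "hyperbolic f" using False by (simp add: hyp0_def)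
  show ?thesis
  proof (cases "degree f = 0")
    case True
    then obtain c where "f = [:c:]" using degree_eq_zeroE by metis
    then show ?thesis by (auto simp: hyp0_def)
  next
    case deg: False
    have "cpoly (pderiv f - smult l f) z \<noteq> 0" if z: "Im z > 0" for z
    proof
      assume "cpoly (pderiv f - smult l f) z = 0"
      then have "cpoly (pderiv f) z * cnj (cpoly f z) = of_real l * (cpoly f z * cnj (cpoly f z))" by simp
      also have "\<dots> = of_real (l * (norm (cpoly f z))\<^sup>2)" by (simp only: complex_norm_square[symmetric] of_real_mult)
      finally have "Im (cpoly (pderiv f) z * cnj (cpoly f z)) = 0" by (metis Im_complex_of_real)
      then show False using Im_logarithmic_derivative[OF f z] deg by simp
    qed
    then show ?thesis unfolding hyp0_def using hyperbolicI_upper by blast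
  qed
qed (simp add: hyp0_def)

lemma dsum_linear: "dsum ls (smult a f + smult b g) = smult a (dsum ls f) + smult b (dsum ls g)"
proof (induction ls)
  case (Cons l ls)
  then show ?case by (simp add: dsum_Cons pderiv_add pderiv_smult smult_add_right smult_diff_right mult.commute)
qed simp

lemma dsum_hyp0: "hyp0 f \<Longrightarrow> hyp0 (dsum ls f)"
  by (induction ls) (auto simp: dsum_Cons intro: pderiv_minus_smult_hyp0)

lemma dsum_pencil: "pencil f g \<Longrightarrow> pencil (dsum ls f) (dsum ls g)"
  unfolding pencil_def dsum_linear[symmetric] by (blast intro: dsum_hyp0)

lemma degree_dsum:
  assumes "degree F = degree f + 1" "dsum ls f \<noteq> 0"
  shows "degree (dsum ls F) = degree (dsum ls f) + 1"
  using assms(2)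
proof (induction ls)
  case (Cons l ls)
  have f0: "dsum ls f \<noteq> 0" using Cons.prems by (auto simp: dsum_Cons)
  then have IH: "degree (dsum ls F) = degree (dsum ls f) + 1" using Cons.IH by blast
  show ?case
  proof (cases "l = 0")
    case True
    then have "pderiv (dsum ls f) \<noteq> 0" using Cons.prems by (simp add: dsum_Cons)
    then have "degree (dsum ls f) > 0" by (simp add: pderiv_eq_0_iff)
    then show ?thesis using True IH by (simp add: dsum_Cons degree_pderiv)
  next
    case False
    have deg: "degree (pderiv g - smult l g) = degree g" for g :: "real poly"
    proof (cases "degree g = 0")
      case True
      then have "pderiv g = 0" by (simp add: pderiv_eq_0_iff)
      then show ?thesis using False by simp
    next
      case g: False
      then have "degree (pderiv g) < degree (- smult l g)" using False by (simp add: degree_pderiv)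
      then show ?thesis using degree_add_eq_right[of "pderiv g" "- smult l g"] False by simp
    qed
    show ?thesis unfolding dsum_Cons deg by (rule IH)
  qed
qed (use assms in simp)

text \<open>A common zero after applying D - l means u' = l u and U' = l U at
  \<open>\<theta>\<close>. If \<open>u\<close> did not vanish there, U - c u would have a double
  zero not shared by \<open>u\<close>. So \<open>u\<close> has a double zero, \<open>U\<close>
  vanishes too, and the next factor can be peeled off.\<close>

lemma dsum_common_zero:
  assumes pen: "pencil f F" and deg: "degree F = degree f + 1"
    and "ls \<noteq> []" "dsum ls f \<noteq> 0" "poly (dsum ls f) \<theta> = 0" "poly (dsum ls F) \<theta> = 0"
  shows "poly f \<theta> = 0"
  using assms(3-)
proof (induction ls)
  case (Cons l ls)
  define u U where "u = dsum ls f" and "U = dsum ls F"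
  have u0: "u \<noteq> 0" using Cons.prems(2) by (auto simp: u_def dsum_Cons)
  have d: "degree U = degree u + 1" unfolding u_def U_def using degree_dsum[OF deg] u0 u_def by blast
  have pu: "pencil u U" unfolding u_def U_def by (rule dsum_pencil[OF pen])
  have eu: "poly (pderiv u) \<theta> = l * poly u \<theta>" and eU: "poly (pderiv U) \<theta> = l * poly U \<theta>"
    using Cons.prems by (simp_all add: u_def U_def dsum_Cons)
  have u1: "poly u \<theta> = 0"
  proof (rule ccontr)
    assume nz: "poly u \<theta> \<noteq> 0"
    define c where "c = poly U \<theta> / poly u \<theta>"
    define h where "h = smult (- c) u + smult 1 U"
    have "poly h \<theta> = 0" "poly (pderiv h) \<theta> = 0"
      using nz by (simp_all add: h_def c_def pderiv_add pderiv_minus pderiv_diff pderiv_smult eu eU)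
    moreover have "h \<noteq> 0"
    proof
      assume "h = 0"
      then have "U = smult c u" by (simp add: h_def)
      then have "degree U \<le> degree u" by (simp add: degree_smult_le)
      then show False using d by simp
    qed
    moreover have "pencil h u" using pencil_comb[OF pu, of "- c" 1 1 0] by (simp add: h_def)
    ultimately show False using pencil_double_zero nz by blast
  qed
  show ?case
  proof (cases "ls = []")
    case True
    then show ?thesis using u1 by (simp add: u_def)
  next
    case False
    have "poly U \<theta> = 0" using pencil_double_zero[OF pu u0 u1] eu u1 by simp
    then show ?thesis using Cons.IH[OF False] u0 u1 by (simp add: u_def U_def)
  qed
qed simp

text \<open>The derivative of lowest order with a nonzero coefficient has the highest degree and
  cannot be cancelled.\<close>

lemma dsum_nonzero:
  assumes k: "coeff (rpoly ls) k \<noteq> 0" "k \<le> degree f" and f: "f \<noteq> 0"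
  shows "dsum ls f \<noteq> 0"
proof -
  define t where "t = (LEAST k. coeff (rpoly ls) k \<noteq> 0)"
  have t: "coeff (rpoly ls) t \<noteq> 0" unfolding t_def using k(1) by (rule LeastI)
  have tk: "t \<le> k" unfolding t_def using k(1) by (rule Least_le)
  have low: "coeff (rpoly ls) i = 0" if "i < t" for i using not_less_Least that unfolding t_def by blast
  have tl: "t \<le> length ls" using t le_degree[of "rpoly ls" t] by simp
  have "coeff (dsum ls f) (degree f - t) = (\<Sum>i\<le>length ls. coeff (rpoly ls) i * coeff ((pderiv ^^ i) f) (degree f - t))"
    by (simp add: dsum_def coeff_sum)
  also have "\<dots> = (\<Sum>i\<in>{t}. coeff (rpoly ls) i * coeff ((pderiv ^^ i) f) (degree f - t))"
  proof (rule sum.mono_neutral_right)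
    show "\<forall>i\<in>{..length ls} - {t}. coeff (rpoly ls) i * coeff ((pderiv ^^ i) f) (degree f - t) = 0"
    proof
      fix i assume i: "i \<in> {..length ls} - {t}"
      show "coeff (rpoly ls) i * coeff ((pderiv ^^ i) f) (degree f - t) = 0"
      proof (cases "i < t")
        case False
        then have i': "i > t" using i by auto
        show ?thesis
        proof (cases "i \<le> degree f")
          case True
          then have "degree ((pderiv ^^ i) f) < degree f - t" using i' by (simp add: degree_higher_pderiv)
          then show ?thesis by (simp add: coeff_eq_0)
        qed (simp add: higher_pderiv_eq_0)
      qed (simp add: low)
    qed
  qed (use tl in auto)
  also have "\<dots> = coeff (rpoly ls) t * (falling (degree f) t * lead_coeff f)"
    using coeff_higher_pderiv_top[of f "degree f" t] tk k(2) by simp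
  also have "\<dots> \<noteq> 0" using t falling_pos[of t "degree f"] tk k(2) f by simp
  finally show ?thesis by auto
qed

context hyp_op
begin

lemma symb_factor:
  assumes "poly (Q k) \<theta> \<noteq> 0"
  obtains ls c where "c \<noteq> 0" "\<And>g. poly (T g) \<theta> = c * poly (dsum ls g) \<theta>"
    "\<And>k. coeff (rpoly ls) k \<noteq> 0 \<longleftrightarrow> poly (Q k) \<theta> \<noteq> 0"
proof -
  have nz: "symb \<theta> \<noteq> 0" using assms coeff_symb[of \<theta> k] by auto
  then have hyp: "hyperbolic (symb \<theta>)" using symb_hyp0 hyp0_def by blast
  define ls where "ls = zeros_list (symb \<theta>)"
  define c where "c = lead_coeff (symb \<theta>)"
  have c: "c \<noteq> 0" using nz by (simp add: c_def)
  have eq: "symb \<theta> = smult c (rpoly ls)" using rpoly_zeros[OF hyp] by (simp add: c_def ls_def)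
  have co: "poly (Q k) \<theta> = c * coeff (rpoly ls) k" for k using coeff_symb[of \<theta> k] eq by simp
  have len: "length ls \<le> N" using degree_symb[of \<theta>] c unfolding eq by simp
  have "poly (T g) \<theta> = c * poly (dsum ls g) \<theta>" for g
  proof -
    have "poly (T g) \<theta> = c * (\<Sum>k=0..N. coeff (rpoly ls) k * poly ((pderiv ^^ k) g) \<theta>)"
      by (simp add: poly_T_eq co sum_distrib_left mult.assoc)
    also have "(\<Sum>k=0..N. coeff (rpoly ls) k * poly ((pderiv ^^ k) g) \<theta>) = (\<Sum>k\<le>length ls. coeff (rpoly ls) k * poly ((pderiv ^^ k) g) \<theta>)"
      using len by (intro sum.mono_neutral_right) (auto simp: coeff_eq_0)
    finally show ?thesis by (simp add: dsum_def poly_sum)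
  qed
  then show ?thesis using that[OF c] c co by simp
qed

text \<open>The index \<open>l\<close> makes the list of factors nonempty, and \<open>k\<close>
  keeps the image of \<open>f\<close> under them nonzero, as \<open>dsum_common_zero\<close>
  requires.\<close>

lemma T_common_zero:
  assumes pen: "pencil f F" and deg: "degree F = degree f + 1" and f0: "f \<noteq> 0"
    and k: "k \<le> degree f" "poly (Q k) \<theta> \<noteq> 0" and l: "l \<noteq> 0" "poly (Q l) \<theta> \<noteq> 0"
    and zero: "poly (T f) \<theta> = 0" "poly (T F) \<theta> = 0"
  shows "poly f \<theta> = 0"
proof -
  obtain ls c where ls: "c \<noteq> 0" "\<And>g. poly (T g) \<theta> = c * poly (dsum ls g) \<theta>"
    "\<And>k. coeff (rpoly ls) k \<noteq> 0 \<longleftrightarrow> poly (Q k) \<theta> \<noteq> 0"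
    using symb_factor[OF k(2)] by metis
  have "ls \<noteq> []" using ls(3)[of l] l by (auto simp: coeff_eq_0)
  moreover have "dsum ls f \<noteq> 0" using dsum_nonzero[of ls k f] ls(3) k f0 by blast
  ultimately show ?thesis using dsum_common_zero[OF pen deg] zero ls by simp
qed

text \<open>The multiplicity of a zero of \<open>f\<close> cannot increase under \<open>T\<close>: otherwise, dividing \<open>f\<close> repeatedly by
  \<open>z - \<theta>\<close>, the images of \<open>g\<close> and \<open>(z - \<theta>) g\<close> would both vanish at \<open>\<theta>\<close>, where \<open>g \<theta> \<noteq> 0\<close>.\<close>
lemma T_multiplicity:
  assumes f: "hyperbolic f" "poly f \<theta> = 0"
    and l: "l \<noteq> 0" "l \<le> degree f" "poly (Q l) \<theta> \<noteq> 0"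
    and dvd: "[:- \<theta>, 1:] * f dvd T f"
  shows False
proof -
  have f0: "f \<noteq> 0" using f hyperbolic_nz by blast
  define p where "p = order \<theta> f"
  obtain g where g: "f = [:- \<theta>, 1:] ^ p * g" "\<not> [:- \<theta>, 1:] dvd g"
    using order_decomp[OF f0, of \<theta>] unfolding p_def by blast
  have p: "p \<ge> 1" using f f0 order_root[of f \<theta>] by (simp add: p_def)
  have gh: "hyperbolic g" using f(1) unfolding g(1) hyperbolic_mult_iff by blast
  have g0: "g \<noteq> 0" using gh hyperbolic_nz by blast
  have gt: "poly g \<theta> \<noteq> 0" using g(2) by (simp add: poly_eq_0_iff_dvd)
  have deg: "degree ([:- \<theta>, 1:] ^ i * g) = i + degree g" for i
    using g0 by (subst degree_mult_eq) (auto simp: degree_power_eq)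
  \<comment> \<open>Downward induction from \<open>i = p\<close>, where the divisibility hypothesis
    applies; each division by z - \<theta> costs one order of vanishing by
    \<open>pencil_multiple_zero\<close>.\<close>
  have D: "[:- \<theta>, 1:] ^ Suc i dvd T ([:- \<theta>, 1:] ^ i * g)" if "i \<le> p" for i
    using that
  proof (induction "p - i" arbitrary: i)
    case 0
    then have "i = p" by simp
    moreover have "[:- \<theta>, 1:] ^ Suc p dvd [:- \<theta>, 1:] * f" unfolding g(1) by (simp add: mult.assoc[symmetric])
    ultimately show ?case using dvd g(1) dvd_trans by metis
  next
    case (Suc d)
    let ?h = "[:- \<theta>, 1:] ^ i * g"
    have IH: "[:- \<theta>, 1:] ^ Suc (Suc i) dvd T ([:- \<theta>, 1:] * ?h)"
      using Suc.hyps(1)[of "Suc i"] Suc.hyps(2) Suc.prems by (simp add: mult.assoc)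
    have "hyperbolic ?h" using gh by (auto simp: hyperbolic_mult_iff intro: hyperbolic_power)
    then have pen: "pencil (T ([:- \<theta>, 1:] * ?h)) (T ?h)" by (intro T_pencil pencil_linear)
    show ?case
    proof (cases "T ([:- \<theta>, 1:] * ?h) = 0")
      case True
      then have "\<not> nz (degree ([:- \<theta>, 1:] * ?h))" using T_nonzero g0 by auto
      then have "\<not> nz (degree ?h)" using nz_mono deg[of i] deg[of "Suc i"] by (metis add.commute le_add1 mult.assoc plus_1_eq_Suc power_Suc add_Suc)
      then show ?thesis using T_eq_0 by simp
    next
      case False
      then show ?thesis using pencil_multiple_zero[OF pen False IH] by simp
    qed
  qed
  have Z: "poly (T ([:- \<theta>, 1:] ^ i * g)) \<theta> = 0" if "i \<le> p" for i
  proof -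
    have "[:- \<theta>, 1:] dvd [:- \<theta>, 1:] ^ Suc i" by (simp only: power_Suc dvd_triv_left)
    then show ?thesis unfolding poly_eq_0_iff_dvd using D[OF that] by (rule dvd_trans)
  qed
  have df: "degree f = p + degree g" using deg[of p] g(1) by simp
  \<comment> \<open>Otherwise the least \<open>t\<close> with \<open>Q t\<close> nonzero at
    \<open>\<theta>\<close> exceeds the degree of \<open>g\<close>. Taking i = t - deg g gives (z -
    \<theta>)^i g the degree \<open>t\<close>, so its image at \<open>\<theta>\<close> is a single
    nonzero term, against \<open>Z\<close>.\<close>
  have ex: "\<exists>k\<le>degree g. poly (Q k) \<theta> \<noteq> 0"
  proof (rule ccontr)
    assume neg: "\<not> ?thesis"
    define t where "t = (LEAST k. poly (Q k) \<theta> \<noteq> 0)"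
    have t: "poly (Q t) \<theta> \<noteq> 0" unfolding t_def using l(3) by (rule LeastI)
    have tl: "t \<le> l" unfolding t_def using l(3) by (rule Least_le)
    have low: "poly (Q i) \<theta> = 0" if "i < t" for i using not_less_Least that unfolding t_def by blast
    have tg: "degree g < t" using neg t by (meson linorder_not_le)
    define i where "i = t - degree g"
    have i: "i \<le> p" "i + degree g = t" using tg tl l(2) df by (auto simp: i_def)
    let ?h = "[:- \<theta>, 1:] ^ i * g"
    have dh: "degree ?h = t" using deg i by simp
    have tN: "t \<le> N" using t Q_eq_0[of t] by (metis linorder_not_le poly_0)
    have "poly (T ?h) \<theta> = (\<Sum>k\<in>{t}. poly (Q k) \<theta> * poly ((pderiv ^^ k) ?h) \<theta>)"
      unfolding poly_T_eq
    proof (rule sum.mono_neutral_right)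
      show "\<forall>k\<in>{0..N} - {t}. poly (Q k) \<theta> * poly ((pderiv ^^ k) ?h) \<theta> = 0"
      proof
        fix k assume k: "k \<in> {0..N} - {t}"
        show "poly (Q k) \<theta> * poly ((pderiv ^^ k) ?h) \<theta> = 0"
        proof (cases "k < t")
          case False
          then have "degree ?h < k" using k dh by auto
          then show ?thesis by (simp only: higher_pderiv_eq_0) simp
        qed (simp add: low)
      qed
    qed (use tN in auto)
    also have "\<dots> = poly (Q t) \<theta> * poly ((pderiv ^^ t) ?h) \<theta>" by simp
    also have "poly ((pderiv ^^ t) ?h) \<theta> = falling t t * lead_coeff ?h"
    proof -
      have "degree ((pderiv ^^ t) ?h) = 0" using dh by (simp only: degree_higher_pderiv)
      then obtain c where c: "(pderiv ^^ t) ?h = [:c:]" using degree_eq_zeroE by metis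
      then have "poly ((pderiv ^^ t) ?h) \<theta> = coeff ((pderiv ^^ t) ?h) (t - t)" by simp
      also have "\<dots> = falling t t * coeff ?h t" using dh by (intro coeff_higher_pderiv_top) auto
      finally show ?thesis using dh by simp
    qed
    finally have "poly (Q t) \<theta> * (falling t t * lead_coeff ?h) = 0" using Z[OF i(1)] by simp
    then show False using t falling_pos[of t t] g0 by simp
  qed
  then obtain k where k: "k \<le> degree g" "poly (Q k) \<theta> \<noteq> 0" by blast
  have "pencil g ([:- \<theta>, 1:] * g)" by (intro pencil_sym[OF pencil_linear] gh)
  moreover have "degree ([:- \<theta>, 1:] * g) = degree g + 1" using deg[of 1] by simp
  moreover have "poly (T g) \<theta> = 0" "poly (T ([:- \<theta>, 1:] * g)) \<theta> = 0" using Z[of 0] Z[of 1] p by simp_all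
  ultimately have "poly g \<theta> = 0" using T_common_zero[OF _ _ g0 k l(1,3)] by blast
  then show False using gt by simp
qed

end

subsection \<open>Interlacing of the limit polynomials\<close>

lemma sorted_list_of_set_eqI: "sorted_wrt (<) xs \<Longrightarrow> set xs = A \<Longrightarrow> sorted_list_of_set A = (xs :: nat list)"
  using sorted_list_of_set.idem_if_sorted_distinct[of xs] strict_sorted_iff[of xs] by simp

lemma sorted_list_of_set_Suc_image:
  "finite A \<Longrightarrow> sorted_list_of_set (Suc ` A) = map Suc (sorted_list_of_set A)"
  by (intro sorted_list_of_set_eqI) (simp_all add: sorted_wrt_map)

lemma proper_position_rpoly:
  assumes sorted: "sorted xs" "sorted ys" and len: "length xs = length ys"
    and le: "\<And>j. j < length ys \<Longrightarrow> xs ! j \<le> ys ! j" "\<And>j. Suc j < length xs \<Longrightarrow> ys ! j \<le> xs ! Suc j"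
    and cd: "c * d > 0"
  shows "smult c (rpoly xs) \<lless> smult d (rpoly ys)"
proof -
  have nz: "c \<noteq> 0" "d \<noteq> 0" using cd by auto
  have "interlacing (smult c (rpoly xs)) (smult d (rpoly ys))"
    unfolding interlacing_def alternating_def using nz sorted len le
    by (simp add: hyperbolic_smult_iff zeros_list_smult zeros_list_rpoly)
  moreover have "poly (pderiv (smult c (rpoly xs)) * smult d (rpoly ys) - smult c (rpoly xs) * pderiv (smult d (rpoly ys))) x \<le> 0" for x
  proof -
    have "poly (pderiv (smult c (rpoly xs)) * smult d (rpoly ys) - smult c (rpoly xs) * pderiv (smult d (rpoly ys))) x
      = (c * d) * poly (pderiv (rpoly xs) * rpoly ys - rpoly xs * pderiv (rpoly ys)) x"
      by (simp add: pderiv_smult algebra_simps)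
    then show ?thesis using wronskian_nonpos[OF len le, of x] cd by (simp add: mult_nonneg_nonpos)
  qed
  ultimately show ?thesis unfolding proper_position_def by blast
qed

lemma coprime_rpoly:
  assumes "set xs \<inter> set ys = {}" "c \<noteq> 0" "d \<noteq> 0"
  shows "coprime (smult c (rpoly xs)) (smult d (rpoly ys))"
proof (rule coprimeI)
  fix q assume q: "q dvd smult c (rpoly xs)" "q dvd smult d (rpoly ys)"
  then obtain s where s: "smult c (rpoly xs) = q * s" by (auto elim: dvdE)
  have "hyperbolic (q * s)" unfolding s[symmetric] using assms by (simp add: hyperbolic_smult_iff)
  then have h: "hyperbolic q" using hyperbolic_mult_iff by blast
  have "degree q = 0"
  proof (rule ccontr)
    assume "degree q \<noteq> 0"
    then obtain x where "poly q x = 0" using hyperbolic_real_root[OF h] by blast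
    then have "[:- x, 1:] dvd smult c (rpoly xs)" "[:- x, 1:] dvd smult d (rpoly ys)"
      using q by (auto simp: poly_eq_0_iff_dvd intro: dvd_trans)
    then have "x \<in> set xs" "x \<in> set ys"
      using assms unfolding poly_eq_0_iff_dvd[symmetric] by (auto simp: poly_rpoly_eq_0_iff)
    then show False using assms by blast
  qed
  then show "is_unit q" using hyperbolic_nz[OF h] by (simp add: is_unit_iff_degree)
qed

context hyp_op
begin

text \<open>Passing to n + 1 appends the index n + r + 1 to the complement of \<open>A\<close> and
  leaves the other positions unchanged.\<close>

lemma pattern_chain_same:
  assumes A: "A \<subseteq> {1..n + r}" "card A = r"
  shows "pattern_chain ({1..Suc n + r} - A) ({1..n + r} - A) n"
proof -
  define B where "B = {1..n + r} - A"
  define bs where "bs = sorted_list_of_set B"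
  have fA: "finite A" using A(1) finite_subset by (metis finite_atLeastAtMost)
  have cB: "card B = n" unfolding B_def using A fA by (simp add: card_Diff_subset)
  have lb: "length bs = n" by (simp add: bs_def cB)
  have sb: "set bs = B" "sorted_wrt (<) bs" by (simp_all add: bs_def B_def)
  have B': "sorted_list_of_set ({1..Suc n + r} - A) = bs @ [Suc (n + r)]"
    by (rule sorted_list_of_set_eqI) (use A sb in \<open>auto simp: sorted_wrt_append B_def\<close>)
  have cB': "card ({1..Suc n + r} - A) = Suc n"
    using arg_cong[OF B', of length] lb by (simp only: length_sorted_list_of_set) simp
  have less: "bs ! j < (bs @ [Suc (n + r)]) ! Suc j" if j: "j < n" for j
  proof (cases "Suc j < n")
    case True
    then show ?thesis using sorted_wrt_nth_less[OF sb(2), of j "Suc j"] lb by (simp add: nth_append)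
  next
    case False
    have "bs ! j \<in> B" using sb(1) lb j nth_mem by metis
    then have "bs ! j \<le> n + r" by (auto simp: B_def)
    moreover have "Suc j = n" using False j by simp
    ultimately show ?thesis using lb by (simp add: nth_append)
  qed
  show ?thesis unfolding pattern_chain_def B' B_def[symmetric] bs_def[symmetric] cB' cB
    using less lb by (auto simp: nth_append B_def)
qed

text \<open>The complement of the shifted set consists of 1 and the old positions raised by one, so
  the new index comes first instead of last.\<close>

lemma pattern_chain_shift:
  assumes A: "A \<subseteq> {1..n + r}" "card A = r"
  shows "pattern_chain ({1..Suc n + r} - Suc ` A) ({1..n + r} - A) n"
proof -
  define B where "B = {1..n + r} - A"
  define bs where "bs = sorted_list_of_set B"
  have fA: "finite A" using A(1) finite_subset by (metis finite_atLeastAtMost)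
  have cB: "card B = n" unfolding B_def using A fA by (simp add: card_Diff_subset)
  have lb: "length bs = n" by (simp add: bs_def cB)
  have sb: "set bs = B" "sorted_wrt (<) bs" by (simp_all add: bs_def B_def)
  have pos: "0 < x" if "x \<in> B" for x using that by (auto simp: B_def)
  have B': "sorted_list_of_set ({1..Suc n + r} - Suc ` A) = 1 # map Suc bs"
  proof (rule sorted_list_of_set_eqI)
    show "sorted_wrt (<) (1 # map Suc bs)" using sb pos by (auto simp: sorted_wrt_map)
    have "{1..Suc n + r} - Suc ` A = insert 1 (Suc ` B)"
    proof (rule set_eqI)
      fix x show "x \<in> {1..Suc n + r} - Suc ` A \<longleftrightarrow> x \<in> insert 1 (Suc ` B)"
        using A(1) by (cases x) (auto simp: B_def image_iff)
    qed
    then show "set (1 # map Suc bs) = {1..Suc n + r} - Suc ` A" using sb by simp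
  qed
  have cB': "card ({1..Suc n + r} - Suc ` A) = Suc n"
    using arg_cong[OF B', of length] lb by (simp only: length_sorted_list_of_set) simp
  have le: "(1 # map Suc bs) ! j \<le> bs ! j" if j: "j < n" for j
  proof (cases j)
    case 0
    have "bs ! j \<in> B" using sb(1) lb j nth_mem by metis
    then show ?thesis using 0 pos by (simp add: Suc_le_eq)
  next
    case (Suc i)
    then show ?thesis using sorted_wrt_nth_less[OF sb(2), of i j] j lb by simp
  qed
  show ?thesis unfolding pattern_chain_def B' B_def[symmetric] bs_def[symmetric] cB' cB
    using le lb by (auto simp: B_def)
qed

lemma admissible_start_zero: "nz n \<Longrightarrow> admissible n (start_zero Q N n)"
proof -
  assume "nz n"
  then obtain i where "i \<le> n" "Q i \<noteq> 0" by (auto simp: nz_def)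
  then have "Q (min n N) \<noteq> 0" using Q_nonzero[of i "min n N"] Q_eq_0[of i]
    by (metis linorder_not_le min.boundedI min.cobounded2)
  then have fin: "finite {x. poly (Q (min n N)) x = 0}" by (rule poly_roots_finite)
  then show ?thesis unfolding admissible_def start_zero_def by (auto intro: Min_le)
qed

lemma pattern_factors_T:
  assumes nz: "nz n" and A: "A \<subseteq> {1..n + r}" and len: "length xs = n"
  defines "B \<equiv> {1..n + r} - A"
  shows "pattern_factors A B (T (rpoly xs)) =
    (smult (\<gamma> n) (rpoly (sel A (zeros_list (T (rpoly xs))))), rpoly (sel B (zeros_list (T (rpoly xs)))))"
proof -
  have nz': "nz (length xs)" using nz len by simp
  have "A \<inter> B = {}" "A \<union> B = {1..degree (T (rpoly xs))}"
    using A T_rpoly(2)[OF nz'] len by (auto simp: B_def)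
  from pattern_factors_eq[OF T_rpoly(1)[OF nz'] this] show ?thesis
    using T_rpoly(3)[OF nz'] len by simp
qed

lemma v_pattern_eq:
  assumes nz: "nz n" and A: "A \<subseteq> {1..n + r}" "card A = r" and M: "\<And>k. k < M \<Longrightarrow> Q k = 0"
    and lim: "limits ({1..n + r} - A) n (start_zero Q N n) L W"
  shows "v_pattern Q M N A n = smult (\<gamma> n) (rpoly (sel A W))"
proof -
  define B where "B = {1..n + r} - A"
  define c where "c = start_zero Q N n"
  have dT: "diff_op Q M N = T" by (rule diff_op_from_0) (use M in simp)
  have fA: "finite A" using A(1) finite_subset by (metis finite_atLeastAtMost)
  have cB: "card B = n" unfolding B_def using A fA by (simp add: card_Diff_subset)
  have lenz: "length (f_zeros B n c i) = n" for i by (rule length_f_zeros[OF cB])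
  have pf: "pattern_factors A B (T (rpoly (f_zeros B n c i))) =
      (smult (\<gamma> n) (rpoly (sel A (Tf_zeros B n c i))), rpoly (sel B (Tf_zeros B n c i)))" for i
    unfolding B_def using pattern_factors_T[OF nz A(1) lenz[of i, unfolded B_def]] .
  have fi: "f_iter Q M N A B n i = rpoly (f_zeros B n c i)" for i
  proof (induction i)
    case 0
    have "[:- c, 1:] ^ n = rpoly (replicate n c)" by (induction n) (auto simp: rpoly_Cons)
    then show ?case by (simp add: c_def)
  next
    case (Suc i)
    then show ?case by (simp only: f_iter.simps dT pf snd_conv f_zeros.simps)
  qed
  have vi: "v_iter Q M N A B n = (\<lambda>i. smult (\<gamma> n) (rpoly (sel A (Tf_zeros B n c i))))"
    by (rule ext) (simp only: v_iter_def fi dT pf fst_conv)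
  have lw: "(\<lambda>i. Tf_zeros B n c i ! j) \<longlonglongrightarrow> W ! j" if "j < n + r" for j
    using limitsD(6)[OF lim that] by (simp add: B_def c_def)
  have "(\<lambda>i. coeff (rpoly (sel A (Tf_zeros B n c i))) k) \<longlonglongrightarrow> coeff (rpoly (sel A W)) k" for k
  proof (rule rpoly_coeff_tendsto)
    fix j assume "j < length (sel A W)"
    then have j: "j < card A" by simp
    have "sorted_list_of_set A ! j - 1 < n + r" using index_bounds[OF A(1) j] by auto
    then show "(\<lambda>i. sel A (Tf_zeros B n c i) ! j) \<longlonglongrightarrow> sel A W ! j" unfolding sel_nth[OF j] by (rule lw)
  qed simp
  then have "poly_lim (v_iter Q M N A B n) = smult (\<gamma> n) (rpoly (sel A W))"
    unfolding vi by (intro poly_lim_eq) (auto intro: tendsto_mult_left)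
  then show ?thesis by (simp add: v_pattern_def A(2) B_def)
qed

text \<open>For \<open>n \<ge> N\<close> the iterations for \<open>n\<close> and \<open>n + 1\<close> start at the same point; otherwise both may
  be started at the smaller of the two starting points without changing their limits.\<close>
lemma common_start:
  assumes nz: "nz n" and B: "card B = n" "B \<subseteq> {1..n + r}" and B': "card B' = Suc n" "B' \<subseteq> {1..Suc n + r}"
  shows "\<exists>c L W L' W'. limits B n c L W \<and> limits B' (Suc n) c L' W' \<and>
    limits B n (start_zero Q N n) L W \<and> limits B' (Suc n) (start_zero Q N (Suc n)) L' W'"
proof -
  have nz': "nz (Suc n)" using nz_mono[OF nz] by simp
  let ?s = "start_zero Q N n" and ?s' = "start_zero Q N (Suc n)"
  define c where "c = min ?s ?s'"
  have g: "admissible n ?s" "admissible (Suc n) ?s'" using admissible_start_zero nz nz' by auto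
  have gc: "admissible n c" "admissible (Suc n) c" using g by (auto simp: admissible_def c_def min_def intro: order_trans)
  obtain L W where L: "limits B n ?s L W" using limits_exist[OF nz g(1) B] by blast
  obtain L' W' where L': "limits B' (Suc n) ?s' L' W'" using limits_exist[OF nz' g(2) B'] by blast
  show ?thesis
  proof (cases "N \<le> n")
    case True
    then have "?s = ?s'" by (simp add: start_zero_def min_def)
    then show ?thesis using L L' by metis
  next
    case False
    obtain L1 W1 where L1: "limits B n c L1 W1" using limits_exist[OF nz gc(1) B] by blast
    obtain L2 W2 where L2: "limits B' (Suc n) c L2 W2" using limits_exist[OF nz' gc(2) B'] by blast
    have "L1 = L" using False by (intro limits_start_independent[OF nz _ B _ gc(1) g(1) L1 L]) (auto simp: c_def)
    moreover have "L2 = L'" using False by (intro limits_start_independent[OF nz' _ B' _ gc(2) g(2) L2 L']) (auto simp: c_def)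
    ultimately have "W1 = W" "W2 = W'"
      using limits_W_eq[OF L nz] limits_W_eq[OF L1 nz] limits_W_eq[OF L' nz'] limits_W_eq[OF L2 nz'] by simp_all
    then show ?thesis using L L' L1 L2 \<open>L1 = L\<close> \<open>L2 = L'\<close> by blast
  qed
qed

lemma limits_factor:
  assumes lim: "limits ({1..n + r} - A) n c L W" and A: "A \<subseteq> {1..n + r}"
  shows "T (rpoly L) = smult (\<gamma> n) (rpoly (sel A W) * rpoly L)"
proof -
  have "mset (sel A W) + mset (sel ({1..n + r} - A) W) = mset W"
    by (rule mset_sel_Un) (use A limitsD(2)[OF lim] in auto)
  then have "mset (sel A W @ L) = mset W" using limitsD(4)[OF lim] by simp
  then have "rpoly (sel A W) * rpoly L = rpoly W" unfolding rpoly_append[symmetric] by (rule rpoly_mset_cong)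
  then show ?thesis using limitsD(7)[OF lim] by simp
qed

text \<open>At a common zero of the cofactors both images vanish, so \<open>T_common_zero\<close>
  makes it a zero of \<open>L\<close>. Together with the zero of the cofactor this would raise its
  multiplicity under \<open>T\<close>. The hypothesis on \<open>Q\<close> supplies the index that
  both arguments require.\<close>

lemma limits_strict:
  assumes nz: "nz n" and A: "A \<subseteq> {1..n + r}" and A': "A' \<subseteq> {1..Suc n + r}"
    and L: "limits ({1..n + r} - A) n c L W" and L': "limits ({1..Suc n + r} - A') (Suc n) c L' W'"
    and chain: "chain L' L" and Q: "\<not> (\<exists>\<theta>. \<forall>k\<in>{1..n}. poly (Q k) \<theta> = 0)"
  shows "set (sel A W) \<inter> set (sel A' W') = {}"
proof (rule ccontr)
  assume "\<not> ?thesis"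
  then obtain \<theta> where \<theta>: "\<theta> \<in> set (sel A W)" "\<theta> \<in> set (sel A' W')" by blast
  obtain l where l: "l \<in> {1..n}" "poly (Q l) \<theta> \<noteq> 0" using Q by blast
  then have l': "l \<noteq> 0" "l \<le> degree (rpoly L)" using limitsD(1)[OF L] by auto
  have fac: "T (rpoly L) = smult (\<gamma> n) (rpoly (sel A W) * rpoly L)" by (rule limits_factor[OF L A])
  have fac': "T (rpoly L') = smult (\<gamma> (Suc n)) (rpoly (sel A' W') * rpoly L')" by (rule limits_factor[OF L' A'])
  have zero: "poly (rpoly (sel A W)) \<theta> = 0" "poly (rpoly (sel A' W')) \<theta> = 0"
    using \<theta> by (simp_all add: poly_rpoly_eq_0_iff)
  have "poly (rpoly L) \<theta> \<noteq> 0"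
  proof
    assume z: "poly (rpoly L) \<theta> = 0"
    have "[:- \<theta>, 1:] dvd rpoly (sel A W)" using zero(1) by (simp only: poly_eq_0_iff_dvd)
    then have "[:- \<theta>, 1:] * rpoly L dvd T (rpoly L)" unfolding fac by (intro dvd_smult mult_dvd_mono) auto
    then show False by (rule T_multiplicity[OF rpoly_hyperbolic z l' l(2)])
  qed
  moreover have "poly (rpoly L) \<theta> = 0"
  proof (rule T_common_zero)
    show "pencil (rpoly L) (rpoly L')"
      using chain unfolding chain_def by (intro pencil_sym[OF chain_pencil]) auto
    show "degree (rpoly L') = degree (rpoly L) + 1" using chain by (simp add: chain_def)
    show "poly (T (rpoly L)) \<theta> = 0" "poly (T (rpoly L')) \<theta> = 0" using zero unfolding fac fac' by simp_all
  qed (use l l' in auto)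
  ultimately show False by blast
qed

lemma \<gamma>_consecutive: "nz n \<Longrightarrow> \<gamma> n * \<gamma> (Suc n) > 0"
  using \<gamma>_sign[of n] \<gamma>_sign[of "Suc n"] nz_mono[of n "Suc n"] by (auto simp: zero_less_mult_iff)

lemma v_pattern_same:
  assumes nz: "nz n" and A: "A \<subseteq> {1..n + r}" "card A = r" and M: "\<And>k. k < M \<Longrightarrow> Q k = 0"
  shows "v_pattern Q M N A (Suc n) \<lless> v_pattern Q M N A n"
    and "\<not> (\<exists>\<theta>. \<forall>k\<in>{1..n}. poly (Q k) \<theta> = 0) \<Longrightarrow>
      coprime (v_pattern Q M N A (Suc n)) (v_pattern Q M N A n)"
proof -
  have nz': "nz (Suc n)" using nz_mono[OF nz] by simp
  have A': "A \<subseteq> {1..Suc n + r}" using A(1) by auto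
  let ?B = "{1..n + r} - A" and ?B' = "{1..Suc n + r} - A"
  have pc: "pattern_chain ?B' ?B n" by (rule pattern_chain_same[OF A])
  obtain c L W L' W' where L: "limits ?B n c L W" "limits ?B' (Suc n) c L' W'"
    "limits ?B n (start_zero Q N n) L W" "limits ?B' (Suc n) (start_zero Q N (Suc n)) L' W'"
    using common_start[OF nz, of ?B ?B'] pc unfolding pattern_chain_def by blast
  have v: "v_pattern Q M N A n = smult (\<gamma> n) (rpoly (sel A W))"
    "v_pattern Q M N A (Suc n) = smult (\<gamma> (Suc n)) (rpoly (sel A W'))"
    using v_pattern_eq[OF nz A M L(3)] v_pattern_eq[OF nz' A' A(2) M L(4)] by blast+
  have chain: "chain L' L" "chain W' W" using chain_limits[OF nz pc L(1,2)] by blast+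
  have lenW: "length W = n + r" "length W' = Suc n + r" using limitsD(2)[OF L(1)] limitsD(2)[OF L(2)] by auto
  have sW: "sorted W" "sorted W'" using limitsD(3)[OF L(1)] limitsD(3)[OF L(2)] by auto
  have W: "W' ! i \<le> W ! i" "W ! i \<le> W' ! Suc i" if "i < n + r" for i
    using chain(2) that lenW unfolding chain_def by auto
  show "v_pattern Q M N A (Suc n) \<lless> v_pattern Q M N A n" unfolding v
  proof (rule proper_position_rpoly)
    show "sorted (sel A W')" "sorted (sel A W)" using A(1) A' lenW by (auto intro!: sorted_sel sW)
    fix j
    let ?a = "sorted_list_of_set A ! j" and ?b = "sorted_list_of_set A ! Suc j"
    show "sel A W' ! j \<le> sel A W ! j" if "j < length (sel A W)"
      using that index_bounds[OF A(1), of j] by (auto simp: sel_nth intro!: W)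
    show "sel A W ! j \<le> sel A W' ! Suc j" if "Suc j < length (sel A W')"
    proof -
      have j: "j < card A" "Suc j < card A" using that by simp_all
      have ab: "?a \<in> {1..n + r}" "?b \<in> {1..n + r}" "?a < ?b"
        using index_bounds[OF A(1)] index_less[of j A] j by auto
      have "W ! (?a - 1) \<le> W' ! Suc (?a - 1)" using ab by (intro W) auto
      also have "\<dots> \<le> W' ! (?b - 1)" using ab lenW by (intro sorted_nth_mono sW) auto
      finally show ?thesis using j by (simp add: sel_nth)
    qed
  qed (use \<gamma>_consecutive[OF nz] in \<open>simp_all add: mult.commute\<close>)
  assume "\<not> (\<exists>\<theta>. \<forall>k\<in>{1..n}. poly (Q k) \<theta> = 0)"
  then have "set (sel A W) \<inter> set (sel A W') = {}" by (rule limits_strict[OF nz A(1) A' L(1,2) chain(1)])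
  then show "coprime (v_pattern Q M N A (Suc n)) (v_pattern Q M N A n)"
    unfolding v using \<gamma>_nonzero nz nz' by (intro coprime_rpoly) auto
qed

lemma v_pattern_shift:
  assumes nz: "nz n" and A: "A \<subseteq> {1..n + r}" "card A = r" and M: "\<And>k. k < M \<Longrightarrow> Q k = 0"
  shows "v_pattern Q M N A n \<lless> v_pattern Q M N (Suc ` A) (Suc n)"
    and "\<not> (\<exists>\<theta>. \<forall>k\<in>{1..n}. poly (Q k) \<theta> = 0) \<Longrightarrow>
      coprime (v_pattern Q M N A n) (v_pattern Q M N (Suc ` A) (Suc n))"
proof -
  have nz': "nz (Suc n)" using nz_mono[OF nz] by simp
  have A': "Suc ` A \<subseteq> {1..Suc n + r}" "card (Suc ` A) = r" using A by (auto simp: card_image)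
  have fA: "finite A" using A(1) finite_subset by (metis finite_atLeastAtMost)
  let ?B = "{1..n + r} - A" and ?B' = "{1..Suc n + r} - Suc ` A"
  have pc: "pattern_chain ?B' ?B n" by (rule pattern_chain_shift[OF A])
  obtain c L W L' W' where L: "limits ?B n c L W" "limits ?B' (Suc n) c L' W'"
    "limits ?B n (start_zero Q N n) L W" "limits ?B' (Suc n) (start_zero Q N (Suc n)) L' W'"
    using common_start[OF nz, of ?B ?B'] pc unfolding pattern_chain_def by blast
  have v: "v_pattern Q M N A n = smult (\<gamma> n) (rpoly (sel A W))"
    "v_pattern Q M N (Suc ` A) (Suc n) = smult (\<gamma> (Suc n)) (rpoly (sel (Suc ` A) W'))"
    using v_pattern_eq[OF nz A M L(3)] v_pattern_eq[OF nz' A' M L(4)] by blast+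
  have chain: "chain L' L" "chain W' W" using chain_limits[OF nz pc L(1,2)] by blast+
  have lenW: "length W = n + r" "length W' = Suc n + r" using limitsD(2)[OF L(1)] limitsD(2)[OF L(2)] by auto
  have sW: "sorted W" "sorted W'" using limitsD(3)[OF L(1)] limitsD(3)[OF L(2)] by auto
  have W: "W' ! i \<le> W ! i" "W ! i \<le> W' ! Suc i" if "i < n + r" for i
    using chain(2) that lenW unfolding chain_def by auto
  \<comment> \<open>Raising the one-based index by one cancels the \<open>- 1\<close> in
    \<open>sel\<close>.\<close>
  have nth': "sel (Suc ` A) W' ! j = W' ! (sorted_list_of_set A ! j)" if "j < card A" for j
    using that fA A by (simp add: sel_def sorted_list_of_set_Suc_image)
  show "v_pattern Q M N A n \<lless> v_pattern Q M N (Suc ` A) (Suc n)" unfolding v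
  proof (rule proper_position_rpoly)
    show "sorted (sel (Suc ` A) W')" "sorted (sel A W)" using A(1) A' lenW by (auto intro!: sorted_sel sW)
    show "length (sel A W) = length (sel (Suc ` A) W')" using A A' by simp
    fix j
    let ?a = "sorted_list_of_set A ! j" and ?b = "sorted_list_of_set A ! Suc j"
    show "sel A W ! j \<le> sel (Suc ` A) W' ! j" if "j < length (sel (Suc ` A) W')"
    proof -
      have j: "j < card A" using that A A' by simp
      then have a: "?a \<in> {1..n + r}" using index_bounds[OF A(1)] by blast
      then have "W ! (?a - 1) \<le> W' ! Suc (?a - 1)" by (intro W) auto
      then show ?thesis using j a by (simp add: sel_nth nth')
    qed
    show "sel (Suc ` A) W' ! j \<le> sel A W ! Suc j" if "Suc j < length (sel A W)"
    proof -
      have j: "j < card A" "Suc j < card A" using that by simp_all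
      have ab: "?a \<in> {1..n + r}" "?b \<in> {1..n + r}" "?a < ?b"
        using index_bounds[OF A(1)] index_less[of j A] j by auto
      have "W' ! ?a \<le> W' ! (?b - 1)" using ab lenW by (intro sorted_nth_mono sW) auto
      also have "\<dots> \<le> W ! (?b - 1)" using ab by (intro W) auto
      finally show ?thesis using j by (simp add: sel_nth nth')
    qed
  qed (use \<gamma>_consecutive[OF nz] in simp)
  assume "\<not> (\<exists>\<theta>. \<forall>k\<in>{1..n}. poly (Q k) \<theta> = 0)"
  then have "set (sel A W) \<inter> set (sel (Suc ` A) W') = {}" by (rule limits_strict[OF nz A(1) A'(1) L(1,2) chain(1)])
  then show "coprime (v_pattern Q M N A n) (v_pattern Q M N (Suc ` A) (Suc n))"
    unfolding v using \<gamma>_nonzero nz nz' by (intro coprime_rpoly) auto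
qed

end

section \<open>From the hypotheses of the theorem to the locale, and the conclusion\<close>

lemma nondegenerate_preserver_hyp_op:
  assumes Q0: "\<And>k. k < M \<or> N < k \<Longrightarrow> Q k = 0"
    and MN: "Q M * Q N \<noteq> 0"
    and hyp: "hyperbolicity_preserver (diff_op Q M N)"
    and nd: "nondegenerate Q N"
    and fi: "fuchs_index Q = int r"
  shows "hyp_op Q N r"
proof
  have QN: "Q N \<noteq> 0" using MN by auto
  have dN: "degree (Q N) = N + r" using nd fi by (simp add: nondegenerate_def)
  then show "coeff (Q N) (N + r) \<noteq> 0" using QN by (metis leading_coeff_0_iff)
  show "Q k = 0" if "k > N" for k using Q0 that by blast
  show "degree (Q k) \<le> k + r" for k
  proof (cases "Q k = 0")
    case False
    have eq: "{int (degree (Q k)) - int k | k. Q k \<noteq> 0} = (\<lambda>k. int (degree (Q k)) - int k) ` {k. Q k \<noteq> 0}" by auto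
    have "{k. Q k \<noteq> 0} \<subseteq> {..N}" using Q0 by (auto simp: not_less[symmetric])
    then have "finite {int (degree (Q k)) - int k | k. Q k \<noteq> 0}" unfolding eq by (intro finite_imageI finite_subset[OF _ finite_atMost])
    then have "int (degree (Q k)) - int k \<le> fuchs_index Q" unfolding fuchs_index_def using False by (intro Max_ge) auto
    then show ?thesis using fi by simp
  qed simp
  have "diff_op Q M N = diff_op Q 0 N" by (rule diff_op_from_0) (use Q0 in simp)
  then show "hyp0 (diff_op Q 0 N f)" if "hyperbolic f" for f
    using hyp that by (auto simp: hyperbolicity_preserver_def hyp0_def)
qed

theorem theorem4p7:
  fixes Q :: "nat \<Rightarrow> real poly" and M N n r :: nat and A :: "nat set"
  assumes "\<And>k. k < M \<or> N < k \<Longrightarrow> Q k = 0"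
    and "Q M * Q N \<noteq> 0"
    and "hyperbolicity_preserver (diff_op Q M N)"
    and "nondegenerate Q N"
    and "fuchs_index Q = int r"
    and "M \<le> n"
    and "A \<subseteq> {1..n + r}" and "card A = r"
  shows "v_pattern Q M N A (n + 1) \<lless> v_pattern Q M N A n \<and>
         v_pattern Q M N A n \<lless> v_pattern Q M N ((\<lambda>a. a + 1) ` A) (n + 1) \<and>
         (\<not> (\<exists>\<theta>::real. \<forall>k\<in>{1..n}. poly (Q k) \<theta> = 0) \<longrightarrow>
            strictly_interlacing (v_pattern Q M N A (n + 1)) (v_pattern Q M N A n) \<and>
            strictly_interlacing (v_pattern Q M N A n)
              (v_pattern Q M N ((\<lambda>a. a + 1) ` A) (n + 1)))"
proof -
  interpret hyp_op Q N r by (rule nondegenerate_preserver_hyp_op[OF assms(1-5)])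
  have "Q M \<noteq> 0" using assms(2) by auto
  then have nz: "nz n" using assms(6) by (auto simp: nz_def)
  have low: "\<And>k. k < M \<Longrightarrow> Q k = 0" using assms(1) by blast
  have img: "(\<lambda>a. a + 1) ` A = Suc ` A" by simp
  note same = v_pattern_same[OF nz assms(7,8) low] and shift = v_pattern_shift[OF nz assms(7,8) low]
  show ?thesis unfolding img Suc_eq_plus1[symmetric] strictly_interlacing_def
    using same shift unfolding proper_position_def by blast
qed

end
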